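(* Let $\kappa$ be a regular (infinite) cardinal and $\lambda$ a cardinal with $\kappa<\lambda$. Let $\mathrm{Set}^m_{\geqslant\lambda}$ denote the category of sets of cardinality at least $\lambda$ and monomorphisms (injective maps) between them. Then there is no $\kappa$-topos $\mathcal{T}$ such that $\mathrm{Set}^m_{\geqslant\lambda}$ is equivalent to the category of $\kappa$-points of $\mathcal{T}$.
   Context: A $\kappa$-small limit is a limit indexed by a diagram of size $<\kappa$. A $\kappa$-topos is a $\kappa$-exact localization of a presheaf category, i.e. a (full) reflective subcategory of the category of presheaves of sets on a small category such that the reflection functor preserves all $\kappa$-small limits. A $\kappa$-point of a $\kappa$-topos $\mathcal{T}$ is a functor $\mathcal{T}\to\mathrm{Set}$ which preserves all (small) colimits and all $\kappa$-small limits; the category of $\kappa$-points of $\mathcal{T}$ has these functors as objects and natural transformations as morphisms. *)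

theory Defs
  imports "HOL-Library.FuncSet"
begin

unbundle cardinal_syntax

section \<open>Universes\<close>

text \<open>
  The sets of the mathematical text are the sets of a Grothendieck universe: a type \<open>'v\<close> whose
  cardinality is (strongly) inaccessible plays the role of the universe, the small sets being
  those of cardinality less than that of \<open>'v\<close>.  Up to bijection, every small set is a subset of
  \<open>'v\<close>.  Large categories, such as the category of all small sets, have carriers that need not be
  small.
\<close>

definition inaccessible :: "'a rel \<Rightarrow> bool" where
  "inaccessible r \<longleftrightarrow>
     Card_order r \<and> natLeq <o r \<and> regularCard r \<and>
     (\<forall>A \<subseteq> Field r. |A| <o r \<longrightarrow> |Pow A| <o r)"

definition small :: "'v set \<Rightarrow> bool" where
  "small A \<longleftrightarrow> |A| <o |UNIV :: 'v set|"


section \<open>Categories, functors and natural transformations\<close>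

record ('o, 'm) cat =
  Obj :: "'o set"
  Arr :: "'m set"
  Dom :: "'m \<Rightarrow> 'o"
  Cod :: "'m \<Rightarrow> 'o"
  Idt :: "'o \<Rightarrow> 'm"
  Cmp :: "'m \<Rightarrow> 'm \<Rightarrow> 'm"  \<comment> \<open>\<open>Cmp C g f\<close> is \<open>g\<close> after \<open>f\<close>\<close>

definition hom :: "('o, 'm) cat \<Rightarrow> 'o \<Rightarrow> 'o \<Rightarrow> 'm set" where
  "hom C A B = {f \<in> Arr C. Dom C f = A \<and> Cod C f = B}"

locale category =
  fixes C :: "('o, 'm) cat"
  assumes Dom_in: "f \<in> Arr C \<Longrightarrow> Dom C f \<in> Obj C"
    and Cod_in: "f \<in> Arr C \<Longrightarrow> Cod C f \<in> Obj C"
    and Idt_in: "A \<in> Obj C \<Longrightarrow> Idt C A \<in> hom C A A"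
    and Cmp_in: "f \<in> hom C A B \<Longrightarrow> g \<in> hom C B D \<Longrightarrow> Cmp C g f \<in> hom C A D"
    and Cmp_Idt_right: "f \<in> hom C A B \<Longrightarrow> Cmp C f (Idt C A) = f"
    and Cmp_Idt_left: "f \<in> hom C A B \<Longrightarrow> Cmp C (Idt C B) f = f"
    and Cmp_assoc: "f \<in> hom C A B \<Longrightarrow> g \<in> hom C B D \<Longrightarrow> h \<in> hom C D E \<Longrightarrow>
      Cmp C h (Cmp C g f) = Cmp C (Cmp C h g) f"

definition iso_arr :: "('o, 'm) cat \<Rightarrow> 'm \<Rightarrow> bool" where
  "iso_arr C f \<longleftrightarrow> f \<in> Arr C \<and>
     (\<exists>g \<in> hom C (Cod C f) (Dom C f).
        Cmp C g f = Idt C (Dom C f) \<and> Cmp C f g = Idt C (Cod C f))"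

definition isomorphic :: "('o, 'm) cat \<Rightarrow> 'o \<Rightarrow> 'o \<Rightarrow> bool" where
  "isomorphic C A B \<longleftrightarrow> (\<exists>f \<in> hom C A B. iso_arr C f)"

definition op_cat :: "('o, 'm) cat \<Rightarrow> ('o, 'm) cat" where
  "op_cat C = C\<lparr>Dom := Cod C, Cod := Dom C, Cmp := (\<lambda>g f. Cmp C f g)\<rparr>"

definition full_sub :: "('o, 'm) cat \<Rightarrow> 'o set \<Rightarrow> ('o, 'm) cat" where
  "full_sub C S = C\<lparr>Obj := S, Arr := {f \<in> Arr C. Dom C f \<in> S \<and> Cod C f \<in> S}\<rparr>"

record ('o, 'm, 'p, 'n) funct =
  Fobj :: "'o \<Rightarrow> 'p"
  Farr :: "'m \<Rightarrow> 'n"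

text \<open>
  Functors are required to be extensional, that is, undefined outside of their source, so that
  equality of functors is equality in the logic.  The same convention applies to the components
  of natural transformations and to the maps of the category of sets.
\<close>

definition is_functor ::
    "('o, 'm) cat \<Rightarrow> ('p, 'n) cat \<Rightarrow> ('o, 'm, 'p, 'n) funct \<Rightarrow> bool" where
  "is_functor C D F \<longleftrightarrow>
     category C \<and> category D \<and>
     Fobj F \<in> Obj C \<rightarrow>\<^sub>E Obj D \<and>
     Farr F \<in> Arr C \<rightarrow>\<^sub>E Arr D \<and>
     (\<forall>f \<in> Arr C. Dom D (Farr F f) = Fobj F (Dom C f) \<and> Cod D (Farr F f) = Fobj F (Cod C f)) \<and>
     (\<forall>A \<in> Obj C. Farr F (Idt C A) = Idt D (Fobj F A)) \<and>
     (\<forall>f \<in> Arr C. \<forall>g \<in> Arr C. Cod C f = Dom C g \<longrightarrow>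
        Farr F (Cmp C g f) = Cmp D (Farr F g) (Farr F f))"

text \<open>
  For a full subcategory \<open>T\<close> of \<open>C\<close>, the functor \<open>id_funct T\<close>, regarded as a functor from \<open>T\<close>
  to \<open>C\<close>, is the inclusion.
\<close>

definition id_funct :: "('o, 'm) cat \<Rightarrow> ('o, 'm, 'o, 'm) funct" where
  "id_funct C = \<lparr>Fobj = (\<lambda>A \<in> Obj C. A), Farr = (\<lambda>f \<in> Arr C. f)\<rparr>"

definition comp_funct ::
    "('o, 'm) cat \<Rightarrow> ('p, 'n, 'q, 'r) funct \<Rightarrow> ('o, 'm, 'p, 'n) funct \<Rightarrow> ('o, 'm, 'q, 'r) funct" where
  "comp_funct C G F =
     \<lparr>Fobj = (\<lambda>A \<in> Obj C. Fobj G (Fobj F A)), Farr = (\<lambda>f \<in> Arr C. Farr G (Farr F f))\<rparr>"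

record ('o, 'm, 'p, 'n) nattrans =
  Src :: "('o, 'm, 'p, 'n) funct"
  Tgt :: "('o, 'm, 'p, 'n) funct"
  Component :: "'o \<Rightarrow> 'n"

definition is_nattrans ::
    "('o, 'm) cat \<Rightarrow> ('p, 'n) cat \<Rightarrow> ('o, 'm, 'p, 'n) nattrans \<Rightarrow> bool" where
  "is_nattrans C D t \<longleftrightarrow>
     is_functor C D (Src t) \<and> is_functor C D (Tgt t) \<and>
     Component t \<in> extensional (Obj C) \<and>
     (\<forall>A \<in> Obj C. Component t A \<in> hom D (Fobj (Src t) A) (Fobj (Tgt t) A)) \<and>
     (\<forall>f \<in> Arr C.
        Cmp D (Farr (Tgt t) f) (Component t (Dom C f)) =
        Cmp D (Component t (Cod C f)) (Farr (Src t) f))"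

definition functor_cat ::
    "('o, 'm) cat \<Rightarrow> ('p, 'n) cat \<Rightarrow> (('o, 'm, 'p, 'n) funct, ('o, 'm, 'p, 'n) nattrans) cat" where
  "functor_cat C D =
     \<lparr>Obj = {F. is_functor C D F},
      Arr = {t. is_nattrans C D t},
      Dom = Src,
      Cod = Tgt,
      Idt = (\<lambda>F. \<lparr>Src = F, Tgt = F, Component = (\<lambda>A \<in> Obj C. Idt D (Fobj F A))\<rparr>),
      Cmp = (\<lambda>t s. \<lparr>Src = Src s, Tgt = Tgt t,
        Component = (\<lambda>A \<in> Obj C. Cmp D (Component t A) (Component s A))\<rparr>)\<rparr>"

definition equivalent :: "('o, 'm) cat \<Rightarrow> ('p, 'n) cat \<Rightarrow> bool" where
  "equivalent C D \<longleftrightarrow>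
     (\<exists>F G. is_functor C D F \<and> is_functor D C G \<and>
        isomorphic (functor_cat C C) (comp_funct C G F) (id_funct C) \<and>
        isomorphic (functor_cat D D) (comp_funct D F G) (id_funct D))"

text \<open>\<open>L\<close> is left adjoint to \<open>R\<close> with unit \<open>\<eta>\<close>, expressed by the universal property of the unit.\<close>

definition adjunction ::
    "('o, 'm) cat \<Rightarrow> ('p, 'n) cat \<Rightarrow> ('o, 'm, 'p, 'n) funct \<Rightarrow> ('p, 'n, 'o, 'm) funct \<Rightarrow>
     ('o, 'm, 'o, 'm) nattrans \<Rightarrow> bool" where
  "adjunction C D L R \<eta> \<longleftrightarrow>
     is_functor C D L \<and> is_functor D C R \<and>
     \<eta> \<in> hom (functor_cat C C) (id_funct C) (comp_funct C R L) \<and>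
     (\<forall>A \<in> Obj C. \<forall>B \<in> Obj D. \<forall>f \<in> hom C A (Fobj R B).
        \<exists>!g. g \<in> hom D (Fobj L A) B \<and> Cmp C (Farr R g) (Component \<eta> A) = f)"


section \<open>Limits and colimits\<close>

definition is_cone ::
    "('j, 'i) cat \<Rightarrow> ('o, 'm) cat \<Rightarrow> ('j, 'i, 'o, 'm) funct \<Rightarrow> 'o \<Rightarrow> ('j \<Rightarrow> 'm) \<Rightarrow> bool" where
  "is_cone J C F A p \<longleftrightarrow>
     A \<in> Obj C \<and> (\<forall>j \<in> Obj J. p j \<in> hom C A (Fobj F j)) \<and>
     (\<forall>u \<in> Arr J. Cmp C (Farr F u) (p (Dom J u)) = p (Cod J u))"

definition is_limit ::
    "('j, 'i) cat \<Rightarrow> ('o, 'm) cat \<Rightarrow> ('j, 'i, 'o, 'm) funct \<Rightarrow> 'o \<Rightarrow> ('j \<Rightarrow> 'm) \<Rightarrow> bool" where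
  "is_limit J C F A p \<longleftrightarrow>
     is_cone J C F A p \<and>
     (\<forall>B q. is_cone J C F B q \<longrightarrow>
        (\<exists>!h. h \<in> hom C B A \<and> (\<forall>j \<in> Obj J. Cmp C (p j) h = q j)))"

definition is_cocone ::
    "('j, 'i) cat \<Rightarrow> ('o, 'm) cat \<Rightarrow> ('j, 'i, 'o, 'm) funct \<Rightarrow> 'o \<Rightarrow> ('j \<Rightarrow> 'm) \<Rightarrow> bool" where
  "is_cocone J C F A p \<longleftrightarrow>
     A \<in> Obj C \<and> (\<forall>j \<in> Obj J. p j \<in> hom C (Fobj F j) A) \<and>
     (\<forall>u \<in> Arr J. Cmp C (p (Cod J u)) (Farr F u) = p (Dom J u))"

definition is_colimit ::
    "('j, 'i) cat \<Rightarrow> ('o, 'm) cat \<Rightarrow> ('j, 'i, 'o, 'm) funct \<Rightarrow> 'o \<Rightarrow> ('j \<Rightarrow> 'm) \<Rightarrow> bool" where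
  "is_colimit J C F A p \<longleftrightarrow>
     is_cocone J C F A p \<and>
     (\<forall>B q. is_cocone J C F B q \<longrightarrow>
        (\<exists>!h. h \<in> hom C A B \<and> (\<forall>j \<in> Obj J. Cmp C h (p j) = q j)))"

text \<open>
  The size of a diagram is the cardinality of the set of arrows of its index category (which
  bounds that of the set of objects).  For a cardinal \<open>r :: 'k rel\<close>, every category of size
  less than \<open>r\<close> is isomorphic to one whose objects and arrows are elements of \<open>'k\<close>, so it is
  enough to consider index categories of that kind.  With \<open>r = |UNIV :: 'v set|\<close> one obtains
  all small diagrams.
\<close>

definition preserves_limits_below ::
    "'k rel \<Rightarrow> ('o, 'm) cat \<Rightarrow> ('p, 'n) cat \<Rightarrow> ('o, 'm, 'p, 'n) funct \<Rightarrow> bool" where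
  "preserves_limits_below r C D G \<longleftrightarrow>
     (\<forall>(J :: ('k, 'k) cat) F A p.
        category J \<and> |Arr J| <o r \<and> is_functor J C F \<and> is_limit J C F A p \<longrightarrow>
        is_limit J D (comp_funct J G F) (Fobj G A) (\<lambda>j. Farr G (p j)))"

definition preserves_colimits_below ::
    "'k rel \<Rightarrow> ('o, 'm) cat \<Rightarrow> ('p, 'n) cat \<Rightarrow> ('o, 'm, 'p, 'n) funct \<Rightarrow> bool" where
  "preserves_colimits_below r C D G \<longleftrightarrow>
     (\<forall>(J :: ('k, 'k) cat) F A p.
        category J \<and> |Arr J| <o r \<and> is_functor J C F \<and> is_colimit J C F A p \<longrightarrow>
        is_colimit J D (comp_funct J G F) (Fobj G A) (\<lambda>j. Farr G (p j)))"


section \<open>Categories of sets\<close>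

record 'v setmap =
  Sdom :: "'v set"
  Scod :: "'v set"
  Smap :: "'v \<Rightarrow> 'v"

definition set_cat :: "('v set, 'v setmap) cat" where
  "set_cat =
     \<lparr>Obj = {A. small A},
      Arr = {f. small (Sdom f) \<and> small (Scod f) \<and> Smap f \<in> Sdom f \<rightarrow>\<^sub>E Scod f},
      Dom = Sdom,
      Cod = Scod,
      Idt = (\<lambda>A. \<lparr>Sdom = A, Scod = A, Smap = (\<lambda>x \<in> A. x)\<rparr>),
      Cmp = (\<lambda>g f. \<lparr>Sdom = Sdom f, Scod = Scod g, Smap = compose (Sdom f) (Smap g) (Smap f)\<rparr>)\<rparr>"

definition set_mono_ge :: "'l rel \<Rightarrow> ('v set, 'v setmap) cat" where
  "set_mono_ge r =
     set_cat\<lparr>Obj := {A \<in> Obj set_cat. r \<le>o |A|},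
             Arr := {f \<in> Arr set_cat.
               r \<le>o |Sdom f| \<and> r \<le>o |Scod f| \<and> inj_on (Smap f) (Sdom f)}\<rparr>"


section \<open>Toposes and their points\<close>

type_synonym 'v presheaf = "('v, 'v, 'v set, 'v setmap) funct"
type_synonym 'v presheaf_map = "('v, 'v, 'v set, 'v setmap) nattrans"

definition small_category :: "('v, 'v) cat \<Rightarrow> bool" where
  "small_category C \<longleftrightarrow> category C \<and> small (Obj C) \<and> small (Arr C)"

definition presheaf_cat :: "('v, 'v) cat \<Rightarrow> ('v presheaf, 'v presheaf_map) cat" where
  "presheaf_cat C = functor_cat (op_cat C) set_cat"

definition kappa_topos :: "'k rel \<Rightarrow> ('v presheaf, 'v presheaf_map) cat \<Rightarrow> bool" where
  "kappa_topos \<kappa> T \<longleftrightarrow>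
     (\<exists>C S L \<eta>.
        small_category C \<and>
        S \<subseteq> Obj (presheaf_cat C) \<and> T = full_sub (presheaf_cat C) S \<and>
        adjunction (presheaf_cat C) T L (id_funct T) \<eta> \<and>
        preserves_limits_below \<kappa> (presheaf_cat C) T L)"

text \<open>A point takes its values in the sets of the same universe \<open>'v\<close> as the topos.\<close>

type_synonym 'v point = "('v presheaf, 'v presheaf_map, 'v set, 'v setmap) funct"
type_synonym 'v point_map = "('v presheaf, 'v presheaf_map, 'v set, 'v setmap) nattrans"

definition is_kappa_point ::
    "'k rel \<Rightarrow> ('v presheaf, 'v presheaf_map) cat \<Rightarrow> 'v point \<Rightarrow> bool" where
  "is_kappa_point \<kappa> T P \<longleftrightarrow>
     is_functor T set_cat P \<and>
     preserves_colimits_below |UNIV :: 'v set| T set_cat P \<and>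
     preserves_limits_below \<kappa> T set_cat P"

definition kappa_points ::
    "'k rel \<Rightarrow> ('v presheaf, 'v presheaf_map) cat \<Rightarrow> ('v point, 'v point_map) cat" where
  "kappa_points \<kappa> T = full_sub (functor_cat T set_cat) {P. is_kappa_point \<kappa> T P}"

end

theory Submission
  imports Defs
begin

text \<open>
  Suppose that the category is equivalent to the \<open>\<kappa>\<close>-points of \<open>T\<close>, and let \<open>el Y X\<close> be the value at an
  object \<open>X\<close> of \<open>T\<close> of the point corresponding to a set \<open>Y\<close>.  As \<open>\<kappa>\<close>-directed colimits of points exist and
  are computed pointwise, \<open>el Y X\<close> is the union of the images of the \<open>el (Y - D \<union> S) X\<close> where \<open>S \<subseteq> D\<close> has fewer
  than \<open>\<kappa>\<close> elements.  Applied to \<open>D\<close> and to its complement, this shows that every element of \<open>el B X\<close> has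
  a support of fewer than \<open>\<kappa>\<close> elements.  For \<open>A \<subseteq> B\<close> of cardinality \<open>\<kappa>\<close>, the elements with such a support
  inside \<open>A\<close> form a \<open>\<kappa>\<close>-point again: the point which \<open>A\<close> would correspond to if it were not too small.
  This point corresponds to some set \<open>E\<close>, and its inclusion into the point of \<open>B\<close> to an injection
  \<open>E \<rightarrow> B\<close> which is fixed by the permutations of \<open>B\<close> that fix \<open>A\<close>.  So the image lies in \<open>A\<close>, whence
  \<open>|E| \<le> \<kappa>\<close>, a contradiction.
\<close>

section \<open>Equivalences of categories\<close>

text \<open>Two features of the category shape the argument: its morphisms are only injections, and
  sets smaller than \<open>lam\<close> are missing. So an element cannot be pushed to a subset by a
  retraction, and a small subset has no point of its own. The colimit of points is computed
  pointwise because, by regularity of \<kappa>, \<kappa>-directed colimits of sets commute with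
  \<kappa>-small limits. It is then represented by an unknown set, and a map from \<open>Y\<close>
  into that set must be glued from the parts to see that every element over \<open>Y\<close> is
  reached. Retractions are replaced by room: a large set contains infinitely many disjoint copies of
  itself, so an injection can be undone on a subset with large complement, or altered away from a
  prescribed subset. The size of \<open>A\<close> meets two demands: \<open>A\<close> must absorb
  any set of fewer than \<kappa> elements while another such set stays fixed, which makes the
  supported elements respect colimits, and \<open>A\<close> must be smaller than \<open>lam\<close>,
  so that no set of the category fits into it.\<close>

lemma homI: "f \<in> Arr C \<Longrightarrow> Dom C f = A \<Longrightarrow> Cod C f = B \<Longrightarrow> f \<in> hom C A B"
  by (simp add: hom_def)

lemma is_functor_hom:
  assumes "is_functor C D F" "f \<in> hom C A B"
  shows "Farr F f \<in> hom D (Fobj F A) (Fobj F B)"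
  using assms by (auto simp: is_functor_def hom_def)

lemma is_functor_Obj: "is_functor C D F \<Longrightarrow> A \<in> Obj C \<Longrightarrow> Fobj F A \<in> Obj D"
  by (auto simp: is_functor_def)

lemma is_functor_Cmp:
  assumes "is_functor C D F" "f \<in> hom C A B" "g \<in> hom C B E"
  shows "Farr F (Cmp C g f) = Cmp D (Farr F g) (Farr F f)"
  using assms by (auto simp: is_functor_def hom_def)

lemma is_functor_Idt: "is_functor C D F \<Longrightarrow> A \<in> Obj C \<Longrightarrow> Farr F (Idt C A) = Idt D (Fobj F A)"
  by (auto simp: is_functor_def)

lemma is_functor_comp:
  assumes F: "is_functor C D F" and G: "is_functor D E G"
  shows "is_functor C E (comp_funct C G F)"
proof -
  interpret C: category C using F by (simp add: is_functor_def)
  show ?thesis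
    unfolding is_functor_def
  proof (intro conjI ballI impI)
    show "category C" "category E" using F G by (auto simp: is_functor_def)
    show "Fobj (comp_funct C G F) \<in> Obj C \<rightarrow>\<^sub>E Obj E"
      using F G by (auto simp: comp_funct_def is_functor_Obj)
    show "Farr (comp_funct C G F) \<in> Arr C \<rightarrow>\<^sub>E Arr E"
      using F G by (auto simp: comp_funct_def is_functor_def)
  next
    fix f assume "f \<in> Arr C"
    then show "Dom E (Farr (comp_funct C G F) f) = Fobj (comp_funct C G F) (Dom C f)"
      "Cod E (Farr (comp_funct C G F) f) = Fobj (comp_funct C G F) (Cod C f)"
      using F G by (auto simp: comp_funct_def is_functor_def C.Dom_in C.Cod_in Pi_iff PiE_def)
  next
    fix A assume A: "A \<in> Obj C"
    then have "Idt C A \<in> Arr C" using C.Idt_in by (auto simp: hom_def)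
    then show "Farr (comp_funct C G F) (Idt C A) = Idt E (Fobj (comp_funct C G F) A)"
      using A F G by (simp add: comp_funct_def is_functor_Idt is_functor_Obj)
  next
    fix f g assume fg: "f \<in> Arr C" "g \<in> Arr C" "Cod C f = Dom C g"
    then have f: "f \<in> hom C (Dom C f) (Cod C f)" and g: "g \<in> hom C (Cod C f) (Cod C g)"
      by (auto simp: hom_def)
    then have "Cmp C g f \<in> Arr C" using C.Cmp_in by (auto simp: hom_def)
    then show "Farr (comp_funct C G F) (Cmp C g f) =
        Cmp E (Farr (comp_funct C G F) g) (Farr (comp_funct C G F) f)"
      using fg is_functor_Cmp[OF F f g]
        is_functor_Cmp[OF G is_functor_hom[OF F f] is_functor_hom[OF F g]]
      by (simp add: comp_funct_def)
  qed
qed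

lemma functor_cat_simps [simp]:
  "Obj (functor_cat C D) = {F. is_functor C D F}"
  "Arr (functor_cat C D) = {t. is_nattrans C D t}"
  "Dom (functor_cat C D) = Src" "Cod (functor_cat C D) = Tgt"
  by (auto simp: functor_cat_def)

lemma isomorphic_functor_catE:
  assumes "isomorphic (functor_cat C D) H K"
  obtains a b where
    "\<And>A. A \<in> Obj C \<Longrightarrow> a A \<in> hom D (Fobj H A) (Fobj K A)"
    "\<And>A. A \<in> Obj C \<Longrightarrow> b A \<in> hom D (Fobj K A) (Fobj H A)"
    "\<And>A. A \<in> Obj C \<Longrightarrow> Cmp D (b A) (a A) = Idt D (Fobj H A)"
    "\<And>A. A \<in> Obj C \<Longrightarrow> Cmp D (a A) (b A) = Idt D (Fobj K A)"
    "\<And>f A B. f \<in> hom C A B \<Longrightarrow> Cmp D (Farr K f) (a A) = Cmp D (a B) (Farr H f)"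
proof -
  from assms obtain t s where t: "is_nattrans C D t" "Src t = H" "Tgt t = K"
    and s: "is_nattrans C D s" "Src s = K" "Tgt s = H"
    and st: "Cmp (functor_cat C D) s t = Idt (functor_cat C D) H"
    and ts: "Cmp (functor_cat C D) t s = Idt (functor_cat C D) K"
    by (auto simp: isomorphic_def iso_arr_def hom_def)
  show thesis
  proof (rule that[of "Component t" "Component s"])
    fix A assume A: "A \<in> Obj C"
    show "Component t A \<in> hom D (Fobj H A) (Fobj K A)"
      "Component s A \<in> hom D (Fobj K A) (Fobj H A)"
      using A t s by (auto simp: is_nattrans_def)
    show "Cmp D (Component s A) (Component t A) = Idt D (Fobj H A)"
      using arg_cong[OF st, of "\<lambda>x. Component x A"] A by (simp add: functor_cat_def)
    show "Cmp D (Component t A) (Component s A) = Idt D (Fobj K A)"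
      using arg_cong[OF ts, of "\<lambda>x. Component x A"] A by (simp add: functor_cat_def)
  next
    fix f A B assume "f \<in> hom C A B"
    then show "Cmp D (Farr K f) (Component t A) = Cmp D (Component t B) (Farr H f)"
      using t by (auto simp: is_nattrans_def hom_def)
  qed
qed

lemma retraction_components:
  assumes "isomorphic (functor_cat C C) (comp_funct C G F) (id_funct C)" "category C"
  shows "\<exists>a b. (\<forall>A \<in> Obj C. a A \<in> hom C (Fobj G (Fobj F A)) A \<and> b A \<in> hom C A (Fobj G (Fobj F A)) \<and>
      Cmp C (b A) (a A) = Idt C (Fobj G (Fobj F A)) \<and> Cmp C (a A) (b A) = Idt C A) \<and>
    (\<forall>f A B. f \<in> hom C A B \<longrightarrow> Cmp C f (a A) = Cmp C (a B) (Farr G (Farr F f)))"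
proof (rule isomorphic_functor_catE[OF assms(1)])
  interpret category C by fact
  fix a b
  assume *: "\<And>A. A \<in> Obj C \<Longrightarrow> a A \<in> hom C (Fobj (comp_funct C G F) A) (Fobj (id_funct C) A)"
    "\<And>A. A \<in> Obj C \<Longrightarrow> b A \<in> hom C (Fobj (id_funct C) A) (Fobj (comp_funct C G F) A)"
    "\<And>A. A \<in> Obj C \<Longrightarrow> Cmp C (b A) (a A) = Idt C (Fobj (comp_funct C G F) A)"
    "\<And>A. A \<in> Obj C \<Longrightarrow> Cmp C (a A) (b A) = Idt C (Fobj (id_funct C) A)"
    and nat: "\<And>f A B. f \<in> hom C A B \<Longrightarrow> Cmp C (Farr (id_funct C) f) (a A) =
      Cmp C (a B) (Farr (comp_funct C G F) f)"
  have "Cmp C f (a A) = Cmp C (a B) (Farr G (Farr F f))" if "f \<in> hom C A B" for f A B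
    using nat[OF that] that by (simp add: id_funct_def comp_funct_def hom_def)
  then show ?thesis
    using * by (intro exI[of _ a] exI[of _ b]) (simp add: id_funct_def comp_funct_def)
qed

text \<open>The natural isomorphism recovers \<open>f\<close> from \<open>G (F f)\<close> by
  conjugation with its components, so \<open>F f\<close> determines \<open>f\<close>.\<close>

lemma faithful_if_retraction:
  assumes F: "is_functor C D F" and G: "is_functor D C G"
    and iso: "isomorphic (functor_cat C C) (comp_funct C G F) (id_funct C)"
    and f: "f \<in> hom C A B" and g: "g \<in> hom C A B" and eq: "Farr F f = Farr F g"
  shows "f = g"
proof -
  interpret C: category C using F by (simp add: is_functor_def)
  have A: "A \<in> Obj C" and B: "B \<in> Obj C"
    using f C.Dom_in C.Cod_in by (auto simp: hom_def)
  obtain a b where *: "\<forall>A \<in> Obj C. a A \<in> hom C (Fobj G (Fobj F A)) A \<and> b A \<in> hom C A (Fobj G (Fobj F A)) \<and>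
      Cmp C (b A) (a A) = Idt C (Fobj G (Fobj F A)) \<and> Cmp C (a A) (b A) = Idt C A"
    and nat: "\<forall>f A B. f \<in> hom C A B \<longrightarrow> Cmp C f (a A) = Cmp C (a B) (Farr G (Farr F f))"
    using retraction_components[OF iso C.category_axioms] by (elim exE conjE)
    note a = *[THEN bspec, THEN conjunct1] and b = *[THEN bspec, THEN conjunct2, THEN conjunct1]
      and ba = *[THEN bspec, THEN conjunct2, THEN conjunct2, THEN conjunct1]
      and ab = *[THEN bspec, THEN conjunct2, THEN conjunct2, THEN conjunct2] and nat = nat[rule_format]
  have *: "h = Cmp C (Cmp C (a B) (Farr G (Farr F h))) (b A)" if h: "h \<in> hom C A B" for h
  proof -
    have "h = Cmp C h (Cmp C (a A) (b A))" using h A by (simp add: ab C.Cmp_Idt_right)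
    also have "\<dots> = Cmp C (Cmp C h (a A)) (b A)"
      using C.Cmp_assoc[OF b[OF A] a[OF A] h] .
    finally show ?thesis using nat[OF h] by simp
  qed
  show ?thesis using *[OF f] *[OF g] eq by simp
qed

lemma equivalentE:
  assumes "equivalent C D"
  obtains F where "is_functor C D F"
    "\<And>A B f g. f \<in> hom C A B \<Longrightarrow> g \<in> hom C A B \<Longrightarrow> Farr F f = Farr F g \<Longrightarrow> f = g"
    "\<And>A B t. A \<in> Obj C \<Longrightarrow> B \<in> Obj C \<Longrightarrow> t \<in> hom D (Fobj F A) (Fobj F B) \<Longrightarrow>
       \<exists>f \<in> hom C A B. Farr F f = t"
    "\<And>P. P \<in> Obj D \<Longrightarrow> \<exists>A \<in> Obj C. \<exists>s \<in> hom D (Fobj F A) P. \<exists>t \<in> hom D P (Fobj F A).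
       Cmp D s t = Idt D P \<and> Cmp D t s = Idt D (Fobj F A)"
proof -
  from assms obtain F G where F: "is_functor C D F" and G: "is_functor D C G"
    and i1: "isomorphic (functor_cat C C) (comp_funct C G F) (id_funct C)"
    and i2: "isomorphic (functor_cat D D) (comp_funct D F G) (id_funct D)"
    by (auto simp: equivalent_def)
  interpret C: category C using F by (simp add: is_functor_def)
  interpret D: category D using F by (simp add: is_functor_def)
  show thesis
  proof (rule that[OF F])
    show "f = g" if "f \<in> hom C A B" "g \<in> hom C A B" "Farr F f = Farr F g" for A B f g
      using faithful_if_retraction[OF F G i1] that by blast
  next
    fix A B t assume A: "A \<in> Obj C" and B: "B \<in> Obj C" and t: "t \<in> hom D (Fobj F A) (Fobj F B)"
    obtain a b where *: "\<forall>A \<in> Obj C. a A \<in> hom C (Fobj G (Fobj F A)) A \<and> b A \<in> hom C A (Fobj G (Fobj F A)) \<and>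
      Cmp C (b A) (a A) = Idt C (Fobj G (Fobj F A)) \<and> Cmp C (a A) (b A) = Idt C A"
    and nat: "\<forall>f A B. f \<in> hom C A B \<longrightarrow> Cmp C f (a A) = Cmp C (a B) (Farr G (Farr F f))"
    using retraction_components[OF i1 C.category_axioms] by (elim exE conjE)
    note a = *[THEN bspec, THEN conjunct1] and b = *[THEN bspec, THEN conjunct2, THEN conjunct1]
      and ba = *[THEN bspec, THEN conjunct2, THEN conjunct2, THEN conjunct1]
      and ab = *[THEN bspec, THEN conjunct2, THEN conjunct2, THEN conjunct2] and nat = nat[rule_format]
    \<comment> \<open>This is \<open>G t\<close> conjugated by the isomorphism from
      \<open>G F\<close> to the identity. Naturality and cancellation of \<open>a B\<close> then
      give \<open>G (F f) = G t\<close>.\<close>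
    define f where "f = Cmp C (Cmp C (a B) (Farr G t)) (b A)"
    have Gt: "Farr G t \<in> hom C (Fobj G (Fobj F A)) (Fobj G (Fobj F B))"
      using is_functor_hom[OF G t] .
    have aGt: "Cmp C (a B) (Farr G t) \<in> hom C (Fobj G (Fobj F A)) B"
      using C.Cmp_in[OF Gt a[OF B]] .
    have f: "f \<in> hom C A B" unfolding f_def using C.Cmp_in[OF b[OF A] aGt] .
    have GFf: "Farr G (Farr F f) \<in> hom C (Fobj G (Fobj F A)) (Fobj G (Fobj F B))"
      using is_functor_hom[OF G is_functor_hom[OF F f]] .
    have "Cmp C f (a A) = Cmp C (Cmp C (a B) (Farr G t)) (Cmp C (b A) (a A))"
      unfolding f_def using C.Cmp_assoc[OF a[OF A] b[OF A] aGt] by simp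
    also have "\<dots> = Cmp C (a B) (Farr G t)" using ba[OF A] C.Cmp_Idt_right[OF aGt] by simp
    finally have "Cmp C (a B) (Farr G (Farr F f)) = Cmp C (a B) (Farr G t)" using nat[OF f] by simp
    then have "Cmp C (Cmp C (b B) (a B)) (Farr G (Farr F f)) =
        Cmp C (Cmp C (b B) (a B)) (Farr G t)"
      using C.Cmp_assoc[OF Gt a[OF B] b[OF B]] C.Cmp_assoc[OF GFf a[OF B] b[OF B]] by simp
    then have "Farr G (Farr F f) = Farr G t"
      using ba[OF B] C.Cmp_Idt_left[OF Gt] C.Cmp_Idt_left[OF GFf] by simp
    \<comment> \<open>The faithfulness lemma is applied with the two functors exchanged:
      \<open>G\<close> is faithful because \<open>F G\<close> is isomorphic to the identity.\<close>
    then have "Farr F f = t"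
      using faithful_if_retraction[OF G F i2] is_functor_hom[OF F f] t by blast
    then show "\<exists>f \<in> hom C A B. Farr F f = t" using f by blast
  next
    fix P assume P: "P \<in> Obj D"
    obtain a b where *: "\<forall>A \<in> Obj D. a A \<in> hom D (Fobj F (Fobj G A)) A \<and> b A \<in> hom D A (Fobj F (Fobj G A)) \<and>
      Cmp D (b A) (a A) = Idt D (Fobj F (Fobj G A)) \<and> Cmp D (a A) (b A) = Idt D A"
    and nat: "\<forall>f A B. f \<in> hom D A B \<longrightarrow> Cmp D f (a A) = Cmp D (a B) (Farr F (Farr G f))"
    using retraction_components[OF i2 D.category_axioms] by (elim exE conjE)
    note a = *[THEN bspec, THEN conjunct1] and b = *[THEN bspec, THEN conjunct2, THEN conjunct1]
      and ba = *[THEN bspec, THEN conjunct2, THEN conjunct2, THEN conjunct1]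
      and ab = *[THEN bspec, THEN conjunct2, THEN conjunct2, THEN conjunct2] and nat = nat[rule_format]
    show "\<exists>A \<in> Obj C. \<exists>s \<in> hom D (Fobj F A) P. \<exists>t \<in> hom D P (Fobj F A).
       Cmp D s t = Idt D P \<and> Cmp D t s = Idt D (Fobj F A)"
      using a[OF P] b[OF P] ab[OF P] ba[OF P] is_functor_Obj[OF G P] by blast
  qed
qed

section \<open>Set-valued functors\<close>

lemma set_cat_simps [simp]:
  "Obj set_cat = {A. small A}"
  "Dom set_cat = Sdom" "Cod set_cat = Scod"
  "Idt set_cat A = \<lparr>Sdom = A, Scod = A, Smap = (\<lambda>x \<in> A. x)\<rparr>"
  "Cmp set_cat g f = \<lparr>Sdom = Sdom f, Scod = Scod g, Smap = compose (Sdom f) (Smap g) (Smap f)\<rparr>"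
  by (auto simp: set_cat_def)

lemma hom_set_cat:
  "f \<in> hom set_cat A B \<longleftrightarrow>
     small A \<and> small B \<and> Sdom f = A \<and> Scod f = B \<and> Smap f \<in> A \<rightarrow>\<^sub>E B"
  by (auto simp: hom_def set_cat_def)

lemma Arr_set_cat:
  "f \<in> Arr set_cat \<longleftrightarrow> small (Sdom f) \<and> small (Scod f) \<and> Smap f \<in> Sdom f \<rightarrow>\<^sub>E Scod f"
  by (auto simp: set_cat_def)

lemma setmap_eqI:
  assumes "f \<in> hom set_cat A B" "g \<in> hom set_cat A B" "\<And>x. x \<in> A \<Longrightarrow> Smap f x = Smap g x"
  shows "f = g"
proof -
  have "Smap f = Smap g"
    using assms by (intro extensionalityI[of _ A]) (auto simp: hom_set_cat PiE_def)
  then show ?thesis using assms by (simp add: hom_set_cat)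
qed

lemma hom_set_cat_Cmp:
  "f \<in> hom set_cat A B \<Longrightarrow> g \<in> hom set_cat B D \<Longrightarrow> Cmp set_cat g f \<in> hom set_cat A D"
  by (simp add: hom_set_cat compose_def PiE_def Pi_def)

lemma category_set_cat: "category set_cat"
proof
  fix A B D E :: "'v set" and f g h
  show "Cmp set_cat f (Idt set_cat A) = f" if "f \<in> hom set_cat A B"
    using that by (intro setmap_eqI[of _ A B]) (auto simp: hom_set_cat compose_def)
  show "Cmp set_cat (Idt set_cat B) f = f" if "f \<in> hom set_cat A B"
    using that by (intro setmap_eqI[of _ A B]) (auto simp: hom_set_cat compose_def)
  show "Cmp set_cat h (Cmp set_cat g f) = Cmp set_cat (Cmp set_cat h g) f"
    if "f \<in> hom set_cat A B" "g \<in> hom set_cat B D" "h \<in> hom set_cat D E"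
  proof (rule setmap_eqI)
    show "Cmp set_cat h (Cmp set_cat g f) \<in> hom set_cat A E"
      "Cmp set_cat (Cmp set_cat h g) f \<in> hom set_cat A E"
      using that hom_set_cat_Cmp by blast+
  qed (use that in \<open>simp add: hom_set_cat compose_def PiE_def Pi_def\<close>)
qed (auto simp: hom_set_cat Arr_set_cat compose_def PiE_def Pi_def)

locale set_valued =
  fixes C :: "('o, 'm) cat" and P :: "('o, 'm, 'v set, 'v setmap) funct"
  assumes set_functor: "is_functor C set_cat P"
begin

lemma category: "category C"
  using set_functor by (simp add: is_functor_def)

lemma small: "X \<in> Obj C \<Longrightarrow> small (Fobj P X)"
  using set_functor by (auto simp: is_functor_def)

lemma Farr_hom: "u \<in> hom C X Y \<Longrightarrow> Farr P u \<in> hom set_cat (Fobj P X) (Fobj P Y)"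
  by (rule is_functor_hom[OF set_functor])

lemma Sdom_Scod: "u \<in> hom C X Y \<Longrightarrow> Sdom (Farr P u) = Fobj P X \<and> Scod (Farr P u) = Fobj P Y"
  using Farr_hom[of u X Y] by (auto simp: hom_set_cat)

lemma map_in: "u \<in> hom C X Y \<Longrightarrow> x \<in> Fobj P X \<Longrightarrow> Smap (Farr P u) x \<in> Fobj P Y"
  using Farr_hom[of u X Y] by (auto simp: hom_set_cat)

lemma map_Idt: "X \<in> Obj C \<Longrightarrow> x \<in> Fobj P X \<Longrightarrow> Smap (Farr P (Idt C X)) x = x"
  using is_functor_Idt[OF set_functor] by simp

lemma map_Cmp:
  "u \<in> hom C X Y \<Longrightarrow> v \<in> hom C Y Z \<Longrightarrow> x \<in> Fobj P X \<Longrightarrow>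
    Smap (Farr P (Cmp C v u)) x = Smap (Farr P v) (Smap (Farr P u) x)"
  using is_functor_Cmp[OF set_functor] Sdom_Scod[of u X Y] by (simp add: compose_def)

end

text \<open>Builds a set-valued functor from a bare action \<open>m\<close> on elements; the
  restrictions supply the extensionality that functors and maps of sets must have here.\<close>

definition set_functor ::
    "('o, 'm) cat \<Rightarrow> ('o \<Rightarrow> 'v set) \<Rightarrow> ('m \<Rightarrow> 'v \<Rightarrow> 'v) \<Rightarrow> ('o, 'm, 'v set, 'v setmap) funct" where
  "set_functor C Q m =
     \<lparr>Fobj = (\<lambda>X \<in> Obj C. Q X),
      Farr = (\<lambda>u \<in> Arr C. \<lparr>Sdom = Q (Dom C u), Scod = Q (Cod C u), Smap = (\<lambda>x \<in> Q (Dom C u). m u x)\<rparr>)\<rparr>"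

lemma set_functor_simps [simp]:
  "X \<in> Obj C \<Longrightarrow> Fobj (set_functor C Q m) X = Q X"
  "u \<in> hom C X Y \<Longrightarrow> Farr (set_functor C Q m) u = \<lparr>Sdom = Q X, Scod = Q Y, Smap = (\<lambda>x \<in> Q X. m u x)\<rparr>"
  by (auto simp: set_functor_def hom_def)

lemma set_valued_set_functor:
  assumes C: "category C"
    and small: "\<And>X. X \<in> Obj C \<Longrightarrow> small (Q X)"
    and m_in: "\<And>u X Y x. u \<in> hom C X Y \<Longrightarrow> x \<in> Q X \<Longrightarrow> m u x \<in> Q Y"
    and m_Idt: "\<And>X x. X \<in> Obj C \<Longrightarrow> x \<in> Q X \<Longrightarrow> m (Idt C X) x = x"
    and m_Cmp: "\<And>u v X Y Z x. u \<in> hom C X Y \<Longrightarrow> v \<in> hom C Y Z \<Longrightarrow> x \<in> Q X \<Longrightarrow>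
      m (Cmp C v u) x = m v (m u x)"
  shows "set_valued C (set_functor C Q m)"
proof
  interpret category C by (rule C)
  have homI: "u \<in> hom C (Dom C u) (Cod C u)" if "u \<in> Arr C" for u
    using that by (simp add: hom_def)
  show "is_functor C set_cat (set_functor C Q m)"
    unfolding is_functor_def
  proof (intro conjI ballI impI)
    show "Fobj (set_functor C Q m) \<in> Obj C \<rightarrow>\<^sub>E Obj set_cat"
      using small by (auto simp: set_functor_def)
    show "Farr (set_functor C Q m) \<in> Arr C \<rightarrow>\<^sub>E Arr set_cat"
      using small m_in[OF homI] by (auto simp: set_functor_def Arr_set_cat Dom_in Cod_in)
  next
    fix u assume "u \<in> Arr C"
    then show "Dom set_cat (Farr (set_functor C Q m) u) = Fobj (set_functor C Q m) (Dom C u)"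
      "Cod set_cat (Farr (set_functor C Q m) u) = Fobj (set_functor C Q m) (Cod C u)"
      by (auto simp: set_functor_def Dom_in Cod_in)
  next
    fix X assume X: "X \<in> Obj C"
    have "restrict (m (Idt C X)) (Q X) = (\<lambda>x \<in> Q X. x)"
      using m_Idt[OF X] by (auto intro!: restrict_ext)
    then show "Farr (set_functor C Q m) (Idt C X) = Idt set_cat (Fobj (set_functor C Q m) X)"
      using set_functor_simps(2)[OF Idt_in[OF X], where Q=Q and m=m] X by simp
  next
    fix u v assume uv: "u \<in> Arr C" "v \<in> Arr C" "Cod C u = Dom C v"
    then have u: "u \<in> hom C (Dom C u) (Dom C v)" and v: "v \<in> hom C (Dom C v) (Cod C v)"
      by (auto simp: hom_def)
    show "Farr (set_functor C Q m) (Cmp C v u) =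
        Cmp set_cat (Farr (set_functor C Q m) v) (Farr (set_functor C Q m) u)"
      using set_functor_simps(2)[OF Cmp_in[OF u v], where Q=Q and m=m] set_functor_simps(2)[OF u, where Q=Q and m=m]
        set_functor_simps(2)[OF v, where Q=Q and m=m] m_Cmp[OF u v] m_in[OF u]
      by (auto simp: compose_def intro!: restrict_ext)
  qed (auto simp: C category_set_cat)
qed

definition set_nattrans ::
    "('o, 'm) cat \<Rightarrow> ('o, 'm, 'v set, 'v setmap) funct \<Rightarrow> ('o, 'm, 'v set, 'v setmap) funct \<Rightarrow>
     ('o \<Rightarrow> 'v \<Rightarrow> 'v) \<Rightarrow> ('o, 'm, 'v set, 'v setmap) nattrans" where
  "set_nattrans C P Q t =
     \<lparr>Src = P, Tgt = Q,
      Component = (\<lambda>X \<in> Obj C. \<lparr>Sdom = Fobj P X, Scod = Fobj Q X, Smap = (\<lambda>x \<in> Fobj P X. t X x)\<rparr>)\<rparr>"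

lemma is_nattrans_set_nattrans:
  assumes P: "set_valued C P" and Q: "set_valued C Q"
    and t_in: "\<And>X x. X \<in> Obj C \<Longrightarrow> x \<in> Fobj P X \<Longrightarrow> t X x \<in> Fobj Q X"
    and t_nat: "\<And>u X Y x. u \<in> hom C X Y \<Longrightarrow> x \<in> Fobj P X \<Longrightarrow>
      Smap (Farr Q u) (t X x) = t Y (Smap (Farr P u) x)"
  shows "is_nattrans C set_cat (set_nattrans C P Q t)"
proof -
  interpret P: set_valued C P by (rule P)
  interpret Q: set_valued C Q by (rule Q)
  interpret category C by (rule P.category)
  show ?thesis
    unfolding is_nattrans_def
  proof (intro conjI ballI)
    fix X assume "X \<in> Obj C"
    then show "Component (set_nattrans C P Q t) X \<in>
       hom set_cat (Fobj (Src (set_nattrans C P Q t)) X) (Fobj (Tgt (set_nattrans C P Q t)) X)"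
      using P.small Q.small t_in by (auto simp: set_nattrans_def hom_set_cat)
  next
    fix u assume u: "u \<in> Arr C"
    then have h: "u \<in> hom C (Dom C u) (Cod C u)" by (simp add: hom_def)
    show "Cmp set_cat (Farr (Tgt (set_nattrans C P Q t)) u)
          (Component (set_nattrans C P Q t) (Dom C u)) =
         Cmp set_cat (Component (set_nattrans C P Q t) (Cod C u))
          (Farr (Src (set_nattrans C P Q t)) u)"
      using P.Sdom_Scod[OF h] Q.Sdom_Scod[OF h] P.map_in[OF h] t_nat[OF h] Dom_in[OF u] Cod_in[OF u]
      by (auto simp: set_nattrans_def compose_def intro!: restrict_ext)
  qed (auto simp: set_nattrans_def P.set_functor Q.set_functor)
qed

lemma set_nattrans_simps [simp]:
  "Src (set_nattrans C P Q t) = P" "Tgt (set_nattrans C P Q t) = Q"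
  "X \<in> Obj C \<Longrightarrow> Component (set_nattrans C P Q t) X =
     \<lparr>Sdom = Fobj P X, Scod = Fobj Q X, Smap = (\<lambda>x \<in> Fobj P X. t X x)\<rparr>"
  by (auto simp: set_nattrans_def)

lemma nattrans_component:
  assumes "is_nattrans C set_cat t" "X \<in> Obj C"
  shows "Sdom (Component t X) = Fobj (Src t) X" "Scod (Component t X) = Fobj (Tgt t) X"
    "x \<in> Fobj (Src t) X \<Longrightarrow> Smap (Component t X) x \<in> Fobj (Tgt t) X"
  using assms by (auto simp: is_nattrans_def hom_set_cat)

lemma nattrans_natural:
  assumes t: "is_nattrans C set_cat t" and u: "u \<in> hom C X Y" and x: "x \<in> Fobj (Src t) X"
  shows "Smap (Farr (Tgt t) u) (Smap (Component t X) x) =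
    Smap (Component t Y) (Smap (Farr (Src t) u) x)"
proof -
  interpret S: set_valued C "Src t" using t by unfold_locales (simp add: is_nattrans_def)
  interpret category C by (rule S.category)
  have X: "X \<in> Obj C" and uX: "u \<in> Arr C" "Dom C u = X" "Cod C u = Y"
    using u Dom_in by (auto simp: hom_def)
  have "Cmp set_cat (Farr (Tgt t) u) (Component t X) = Cmp set_cat (Component t Y) (Farr (Src t) u)"
    using t uX by (auto simp: is_nattrans_def)
  then have "compose (Fobj (Src t) X) (Smap (Farr (Tgt t) u)) (Smap (Component t X)) x =
      compose (Fobj (Src t) X) (Smap (Component t Y)) (Smap (Farr (Src t) u)) x"
    using nattrans_component[OF t X] S.Sdom_Scod[OF u] by simp
  then show ?thesis using x by (simp add: compose_def)
qed

lemma nattrans_eqI: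
  assumes "is_nattrans C set_cat s" "is_nattrans C set_cat t" "Src s = Src t" "Tgt s = Tgt t"
    and eq: "\<And>X x. X \<in> Obj C \<Longrightarrow> x \<in> Fobj (Src t) X \<Longrightarrow>
      Smap (Component s X) x = Smap (Component t X) x"
  shows "s = t"
proof -
  have "Component s = Component t"
  proof (rule extensionalityI[of _ "Obj C"])
    show "Component s X = Component t X" if "X \<in> Obj C" for X
      using assms that by (intro setmap_eqI[of _ "Fobj (Src t) X" "Fobj (Tgt t) X"])
        (auto simp: is_nattrans_def)
  qed (use assms in \<open>auto simp: is_nattrans_def\<close>)
  then show ?thesis using assms(3,4) by simp
qed

section \<open>Limits and colimits of sets\<close>

lemma set_map_in: "f \<in> hom set_cat A B \<Longrightarrow> x \<in> A \<Longrightarrow> Smap f x \<in> B"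
  by (auto simp: hom_set_cat)

lemma set_Cmp_apply:
  "f \<in> hom set_cat A B \<Longrightarrow> x \<in> A \<Longrightarrow> Smap (Cmp set_cat g f) x = Smap g (Smap f x)"
  by (simp add: hom_set_cat compose_def)

lemma set_Cmp_eqD:
  "Cmp set_cat g f = h \<Longrightarrow> f \<in> hom set_cat A B \<Longrightarrow> x \<in> A \<Longrightarrow> Smap g (Smap f x) = Smap h x"
  using set_Cmp_apply by metis

lemma (in category) hom_Obj: "f \<in> hom C A B \<Longrightarrow> A \<in> Obj C \<and> B \<in> Obj C"
  using Dom_in Cod_in by (auto simp: hom_def)

lemma Idt_inj_card:
  assumes "category J"
  shows "|Obj J| \<le>o |Arr J|"
proof -
  interpret category J by fact
  have "inj_on (Idt J) (Obj J)"
    using Idt_in by (intro inj_on_inverseI[of _ "Dom J"]) (auto simp: hom_def)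
  moreover have "Idt J ` Obj J \<subseteq> Arr J" using Idt_in by (auto simp: hom_def)
  ultimately show ?thesis using card_of_ordLeq by blast
qed

lemma is_functor_cone:
  assumes G: "is_functor C D G" and F: "is_functor J C F" and cone: "is_cone J C F A p"
  shows "is_cone J D (comp_funct J G F) (Fobj G A) (\<lambda>j. Farr G (p j))"
proof -
  interpret J: category J using F by (simp add: is_functor_def)
  have p: "\<And>j. j \<in> Obj J \<Longrightarrow> p j \<in> hom C A (Fobj F j)" using cone by (simp add: is_cone_def)
  have "Cmp D (Farr (comp_funct J G F) u) (Farr G (p (Dom J u))) = Farr G (p (Cod J u))"
    if u: "u \<in> Arr J" for u
  proof -
    have "Farr F u \<in> hom C (Fobj F (Dom J u)) (Fobj F (Cod J u))"
      using is_functor_hom[OF F homI[OF u refl refl]] .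
    from is_functor_Cmp[OF G p[OF J.Dom_in[OF u]] this] show ?thesis
      using u cone by (simp add: comp_funct_def is_cone_def)
  qed
  then show ?thesis
    using cone is_functor_Obj[OF G] is_functor_hom[OF G p]
    by (simp add: is_cone_def comp_funct_def)
qed

lemma is_functor_cocone:
  assumes G: "is_functor C D G" and F: "is_functor J C F" and cone: "is_cocone J C F A p"
  shows "is_cocone J D (comp_funct J G F) (Fobj G A) (\<lambda>j. Farr G (p j))"
proof -
  interpret J: category J using F by (simp add: is_functor_def)
  have p: "\<And>j. j \<in> Obj J \<Longrightarrow> p j \<in> hom C (Fobj F j) A" using cone by (simp add: is_cocone_def)
  have "Cmp D (Farr G (p (Cod J u))) (Farr (comp_funct J G F) u) = Farr G (p (Dom J u))"
    if u: "u \<in> Arr J" for u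
  proof -
    have "Farr F u \<in> hom C (Fobj F (Dom J u)) (Fobj F (Cod J u))"
      using is_functor_hom[OF F homI[OF u refl refl]] .
    from is_functor_Cmp[OF G this p[OF J.Cod_in[OF u]]] show ?thesis
      using u cone by (simp add: comp_funct_def is_cocone_def)
  qed
  then show ?thesis
    using cone is_functor_Obj[OF G] is_functor_hom[OF G p]
    by (simp add: is_cocone_def comp_funct_def)
qed

text \<open>These families are the cones from a one-point set, that is, the elements of the usual
  limit of a diagram of sets.\<close>

definition compatible :: "('j, 'i) cat \<Rightarrow> ('j, 'i, 'v set, 'v setmap) funct \<Rightarrow> ('j \<Rightarrow> 'v) \<Rightarrow> bool" where
  "compatible J G x \<longleftrightarrow> (\<forall>j \<in> Obj J. x j \<in> Fobj G j) \<and>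
     (\<forall>u \<in> Arr J. Smap (Farr G u) (x (Dom J u)) = x (Cod J u))"

lemma small_subset: "A \<subseteq> B \<Longrightarrow> small B \<Longrightarrow> small A"
  unfolding small_def using card_of_mono1 ordLeq_ordLess_trans by blast

lemma small_finite:
  assumes inf: "infinite (UNIV :: 'v set)" and "finite (A :: 'v set)"
  shows "small A"
  using finite_ordLess_infinite[OF card_of_Well_order card_of_Well_order, of A "UNIV :: 'v set"] assms
  by (simp add: small_def Field_card_of)

lemma small_singleton:
  assumes inf: "infinite (UNIV :: 'v set)"
  shows "small {a :: 'v}"
  using small_finite[OF inf, of "{a}"] by simp

lemma small_doubleton:
  assumes inf: "infinite (UNIV :: 'v set)"
  shows "small {a, b :: 'v}"
  using small_finite[OF inf, of "{a, b}"] by simp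

text \<open>A one-point set detects limits of sets: cones from it are compatible families, and maps
  from it are elements. Conversely, a cone from any set is a family of compatible families, so the
  mediating map is defined element by element. Infinity of the universe makes the one-point set
  small.\<close>

lemma is_limit_set_iff:
  fixes G :: "('j, 'i, 'v set, 'v setmap) funct"
  assumes inf: "infinite (UNIV :: 'v set)" and G: "set_valued J G"
  shows "is_limit J set_cat G A p \<longleftrightarrow> is_cone J set_cat G A p \<and>
    (\<forall>x. compatible J G x \<longrightarrow> (\<exists>!a. a \<in> A \<and> (\<forall>j \<in> Obj J. Smap (p j) a = x j)))"
    (is "?L \<longleftrightarrow> ?C \<and> ?R")
proof -
  interpret G: set_valued J G by fact
  interpret J: category J by (rule G.category)
  interpret S: category "set_cat :: ('v set, 'v setmap) cat" by (rule category_set_cat)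
  have "?L \<longleftrightarrow> ?R" if cone: ?C
  proof
    have p: "p j \<in> hom set_cat A (Fobj G j)" if "j \<in> Obj J" for j
      using cone that by (simp add: is_cone_def)
    have A: "small A" using cone by (simp add: is_cone_def)
    show ?R if L: ?L
    proof (intro allI impI)
      fix x assume x: "compatible J G x"
      \<comment> \<open>An arbitrary element of the universe, used as the point of the test
        object.\<close>
      obtain pt :: 'v where True by simp
      define q where "q j = \<lparr>Sdom = {pt}, Scod = Fobj G j, Smap = (\<lambda>_ \<in> {pt}. x j)\<rparr>" for j
      have q: "q j \<in> hom set_cat {pt} (Fobj G j)" if "j \<in> Obj J" for j
        using x that small_singleton[OF inf] G.small
        by (auto simp: q_def hom_set_cat compatible_def)
      have "is_cone J set_cat G {pt} q"
        unfolding is_cone_def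
      proof (intro conjI ballI)
        fix u assume u: "u \<in> Arr J"
        show "Cmp set_cat (Farr G u) (q (Dom J u)) = q (Cod J u)"
          using x u G.Sdom_Scod[OF homI[OF u refl refl]]
          by (auto simp: q_def compatible_def compose_def intro!: restrict_ext)
      qed (use q small_singleton[OF inf] in auto)
      then obtain h where h: "h \<in> hom set_cat {pt} A" "\<forall>j \<in> Obj J. Cmp set_cat (p j) h = q j"
        and uniq: "\<And>h'. h' \<in> hom set_cat {pt} A \<Longrightarrow>
          \<forall>j \<in> Obj J. Cmp set_cat (p j) h' = q j \<Longrightarrow> h' = h"
        using L unfolding is_limit_def by blast
      have hpt: "Smap (p j) (Smap h pt) = x j" if "j \<in> Obj J" for j
        using set_Cmp_eqD[OF h(2)[rule_format, OF that] h(1)] by (simp add: q_def)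
      show "\<exists>!a. a \<in> A \<and> (\<forall>j \<in> Obj J. Smap (p j) a = x j)"
      proof (rule ex1I)
        show "Smap h pt \<in> A \<and> (\<forall>j \<in> Obj J. Smap (p j) (Smap h pt) = x j)"
          using set_map_in[OF h(1)] hpt by simp
      next
        fix a assume a: "a \<in> A \<and> (\<forall>j \<in> Obj J. Smap (p j) a = x j)"
        define h' where "h' = \<lparr>Sdom = {pt}, Scod = A, Smap = (\<lambda>_ \<in> {pt}. a)\<rparr>"
        have h': "h' \<in> hom set_cat {pt} A"
          using a A small_singleton[OF inf] by (auto simp: h'_def hom_set_cat)
        have "Cmp set_cat (p j) h' = q j" if j: "j \<in> Obj J" for j
          by (rule setmap_eqI[OF S.Cmp_in[OF h' p[OF j]] q[OF j]])
            (use set_Cmp_apply[OF h'] a j in \<open>simp add: h'_def q_def del: set_cat_simps(5)\<close>)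
        then have "h' = h" using uniq h' by blast
        then show "a = Smap h pt" by (auto simp: h'_def)
      qed
    qed
    show ?L if R: ?R
      unfolding is_limit_def
    proof (intro conjI allI impI)
      fix B q assume q: "is_cone J set_cat G B q"
      have qh: "q j \<in> hom set_cat B (Fobj G j)" if "j \<in> Obj J" for j
        using q that by (simp add: is_cone_def)
      have B: "small B" using q by (simp add: is_cone_def)
      have comp: "compatible J G (\<lambda>j. Smap (q j) b)" if b: "b \<in> B" for b
        unfolding compatible_def
      proof (intro conjI ballI)
        show "Smap (q j) b \<in> Fobj G j" if "j \<in> Obj J" for j
          using qh[OF that] b by (auto simp: hom_set_cat)
        show "Smap (Farr G u) (Smap (q (Dom J u)) b) = Smap (q (Cod J u)) b" if u: "u \<in> Arr J" for u
        proof -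
          have "Cmp set_cat (Farr G u) (q (Dom J u)) = q (Cod J u)"
            using q u by (simp add: is_cone_def)
          from arg_cong[OF this, of "\<lambda>f. Smap f b"] show ?thesis
            using qh[OF J.Dom_in[OF u]] b by (simp add: compose_def hom_set_cat)
        qed
      qed
      define a where "a b = (THE a. a \<in> A \<and> (\<forall>j \<in> Obj J. Smap (p j) a = Smap (q j) b))" for b
      have a: "a b \<in> A \<and> (\<forall>j \<in> Obj J. Smap (p j) (a b) = Smap (q j) b)" if "b \<in> B" for b
        unfolding a_def by (rule theI'[OF R[rule_format, OF comp[OF that]]])
      define h where "h = \<lparr>Sdom = B, Scod = A, Smap = (\<lambda>b \<in> B. a b)\<rparr>"
      have h: "h \<in> hom set_cat B A" using a A B by (auto simp: h_def hom_set_cat)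
      show "\<exists>!h. h \<in> hom set_cat B A \<and> (\<forall>j \<in> Obj J. Cmp set_cat (p j) h = q j)"
      proof (rule ex1I)
        have "Cmp set_cat (p j) h = q j" if j: "j \<in> Obj J" for j
          by (rule setmap_eqI[OF S.Cmp_in[OF h p[OF j]] qh[OF j]])
            (use set_Cmp_apply[OF h] a j in \<open>simp add: h_def del: set_cat_simps(5)\<close>)
        then show "h \<in> hom set_cat B A \<and> (\<forall>j \<in> Obj J. Cmp set_cat (p j) h = q j)"
          using h by blast
      next
        fix h' assume h': "h' \<in> hom set_cat B A \<and> (\<forall>j \<in> Obj J. Cmp set_cat (p j) h' = q j)"
        show "h' = h"
        proof (rule setmap_eqI)
          fix b assume b: "b \<in> B"
          have "Smap (p j) (Smap h' b) = Smap (q j) b" if j: "j \<in> Obj J" for j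
          proof -
            have "Cmp set_cat (p j) h' = q j" using h' j by blast
            from arg_cong[OF this, of "\<lambda>f. Smap f b"] show ?thesis
              using h' b by (simp add: compose_def hom_set_cat)
          qed
          moreover have "Smap h' b \<in> A" using h' b by (auto simp: hom_set_cat)
          ultimately have "Smap h' b = a b" using R comp[OF b] a[OF b] by blast
          then show "Smap h' b = Smap h b" using b by (simp add: h_def)
        qed (use h h' in auto)
      qed
    qed (rule cone)
  qed
  then show ?thesis unfolding is_limit_def by blast
qed

text \<open>Such a predicate is a union of classes of the equivalence relation that the diagram
  generates on the disjoint union of its sets; equivalently, a cocone to a two-element set.\<close>

definition class_predicate ::
    "('j, 'i) cat \<Rightarrow> ('j, 'i, 'v set, 'v setmap) funct \<Rightarrow> ('j \<Rightarrow> 'v \<Rightarrow> bool) \<Rightarrow> bool" where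
  "class_predicate J G c \<longleftrightarrow>
     (\<forall>u \<in> Arr J. \<forall>x \<in> Fobj G (Dom J u). c (Cod J u) (Smap (Farr G u) x) = c (Dom J u) x)"

text \<open>
  The second condition says, in Leibniz style, that only those elements become equal in the colimit
  which are related by the equivalence relation that the diagram generates.
\<close>

definition elementwise_colimit ::
    "('j, 'i) cat \<Rightarrow> ('j, 'i, 'v set, 'v setmap) funct \<Rightarrow> 'v set \<Rightarrow> ('j \<Rightarrow> 'v \<Rightarrow> 'v) \<Rightarrow> bool" where
  "elementwise_colimit J G A p \<longleftrightarrow>
     (\<forall>a \<in> A. \<exists>j \<in> Obj J. \<exists>x \<in> Fobj G j. p j x = a) \<and>
     (\<forall>c. class_predicate J G c \<longrightarrow>
       (\<forall>j \<in> Obj J. \<forall>k \<in> Obj J. \<forall>x \<in> Fobj G j. \<forall>y \<in> Fobj G k. p j x = p k y \<longrightarrow> c j x = c k y))"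

text \<open>A two-element set detects colimits of sets. Uniqueness of maps to it forces the cocone
  to be jointly surjective, and their existence extends each class predicate to the colimit.
  Conversely, the mediating map is defined through representatives, whose choice does not matter by
  the second condition.\<close>

lemma is_colimit_set_iff:
  fixes G :: "('j, 'i, 'v set, 'v setmap) funct"
  assumes inf: "infinite (UNIV :: 'v set)" and G: "set_valued J G"
  shows "is_colimit J set_cat G A p \<longleftrightarrow>
    is_cocone J set_cat G A p \<and> elementwise_colimit J G A (\<lambda>j. Smap (p j))"
proof -
  interpret G: set_valued J G by fact
  interpret J: category J by (rule G.category)
  interpret S: category "set_cat :: ('v set, 'v setmap) cat" by (rule category_set_cat)
  have "is_colimit J set_cat G A p \<longleftrightarrow> elementwise_colimit J G A (\<lambda>j. Smap (p j))" (is "?L \<longleftrightarrow> ?R")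
    if cone: "is_cocone J set_cat G A p"
  proof
    have p: "p j \<in> hom set_cat (Fobj G j) A" if "j \<in> Obj J" for j
      using cone that by (simp add: is_cocone_def)
    have p_nat: "Smap (p (Cod J u)) (Smap (Farr G u) x) = Smap (p (Dom J u)) x"
      if u: "u \<in> Arr J" and x: "x \<in> Fobj G (Dom J u)" for u x
    proof -
      have "Cmp set_cat (p (Cod J u)) (Farr G u) = p (Dom J u)"
        using cone u by (simp add: is_cocone_def)
      from arg_cong[OF this, of "\<lambda>f. Smap f x"] show ?thesis
        using x G.Sdom_Scod[OF homI[OF u refl refl]] by (simp add: compose_def)
    qed
    have A: "small A" using cone by (simp add: is_cocone_def)
    show ?R if L: ?L
    proof -
      obtain t f :: 'v where tf: "t \<noteq> f"
        using ex_new_if_finite[OF inf, of "{undefined}"] by auto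
      define ind where "ind B c = \<lparr>Sdom = B, Scod = {t, f}, Smap = (\<lambda>x \<in> B. if c x then t else f)\<rparr>" for B c
      have ind: "ind B c \<in> hom set_cat B {t, f}" if "small B" for B c
        using that small_doubleton[OF inf] by (auto simp: ind_def hom_set_cat)
      show ?thesis
        unfolding elementwise_colimit_def
      proof (intro conjI allI impI ballI)
        fix a assume a: "a \<in> A"
        show "\<exists>j \<in> Obj J. \<exists>x \<in> Fobj G j. Smap (p j) x = a"
        proof (rule ccontr)
          assume neg: "\<not> ?thesis"
          \<comment> \<open>An element \<open>a\<close> missed by the cocone lets the indicator of
            \<open>a\<close> and the constant map agree on all of it, although they differ at
            \<open>a\<close>.\<close>
          have eq: "Cmp set_cat (ind A (\<lambda>x. x = a)) (p j) = Cmp set_cat (ind A (\<lambda>_. False)) (p j)"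
            if j: "j \<in> Obj J" for j
            by (rule setmap_eqI[OF S.Cmp_in[OF p[OF j] ind[OF A]] S.Cmp_in[OF p[OF j] ind[OF A]]])
              (use set_Cmp_apply[OF p[OF j]] set_map_in[OF p[OF j]] neg j in
                \<open>auto simp: ind_def simp del: set_cat_simps(5)\<close>)
          have "is_cocone J set_cat G {t, f} (\<lambda>j. Cmp set_cat (ind A (\<lambda>_. False)) (p j))"
            unfolding is_cocone_def
          proof (intro conjI ballI)
            fix u assume u: "u \<in> Arr J"
            have "Cmp set_cat (p (Cod J u)) (Farr G u) = p (Dom J u)"
              using cone u by (simp add: is_cocone_def)
            then show "Cmp set_cat (Cmp set_cat (ind A (\<lambda>_. False)) (p (Cod J u))) (Farr G u) =
                Cmp set_cat (ind A (\<lambda>_. False)) (p (Dom J u))"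
              using S.Cmp_assoc[OF G.Farr_hom[OF homI[OF u refl refl]] p[OF J.Cod_in[OF u]] ind[OF A]]
              by metis
          qed (use small_doubleton[OF inf] S.Cmp_in[OF p ind[OF A]] in auto)
          then have "\<exists>!h. h \<in> hom set_cat A {t, f} \<and>
              (\<forall>j \<in> Obj J. Cmp set_cat h (p j) = Cmp set_cat (ind A (\<lambda>_. False)) (p j))"
            using L unfolding is_colimit_def by blast
          then have "ind A (\<lambda>x. x = a) = ind A (\<lambda>_. False)"
            by (rule ex1E) (use ind[OF A] eq in blast)
          from arg_cong[OF this, of "\<lambda>h. Smap h a"] show False
            using a tf by (simp add: ind_def)
        qed
      next
        fix c j k x y
        assume c: "class_predicate J G c" and jk: "j \<in> Obj J" "k \<in> Obj J"
          and xy: "x \<in> Fobj G j" "y \<in> Fobj G k" and eq: "Smap (p j) x = Smap (p k) y"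
        have "is_cocone J set_cat G {t, f} (\<lambda>j. ind (Fobj G j) (c j))"
          unfolding is_cocone_def
        proof (intro conjI ballI)
          fix u assume u: "u \<in> Arr J"
          note uh = homI[OF u refl refl]
          show "Cmp set_cat (ind (Fobj G (Cod J u)) (c (Cod J u))) (Farr G u) =
              ind (Fobj G (Dom J u)) (c (Dom J u))"
            by (rule setmap_eqI[OF S.Cmp_in[OF G.Farr_hom[OF uh] ind[OF G.small[OF J.Cod_in[OF u]]]]
                  ind[OF G.small[OF J.Dom_in[OF u]]]])
              (use set_Cmp_apply[OF G.Farr_hom[OF uh]] G.map_in[OF uh] c u in
                \<open>simp add: ind_def class_predicate_def del: set_cat_simps(5)\<close>)
        qed (use small_doubleton[OF inf] ind G.small in auto)
        then obtain h where h: "\<forall>j \<in> Obj J. Cmp set_cat h (p j) = ind (Fobj G j) (c j)"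
          using L unfolding is_colimit_def by blast
        have "Smap h (Smap (p j) x) = (if c j x then t else f)" if "j \<in> Obj J" "x \<in> Fobj G j" for j x
          using set_Cmp_eqD[OF h[rule_format, OF that(1)] p[OF that(1)] that(2)] that
          by (simp add: ind_def)
        then show "c j x = c k y" using jk xy eq tf by metis
      qed
    qed
    show ?L if R: ?R
      unfolding is_colimit_def
    proof (intro conjI allI impI)
      fix B q assume q: "is_cocone J set_cat G B q"
      have qh: "q j \<in> hom set_cat (Fobj G j) B" if "j \<in> Obj J" for j
        using q that by (simp add: is_cocone_def)
      have B: "small B" using q by (simp add: is_cocone_def)
      have surj: "\<And>a. a \<in> A \<Longrightarrow> \<exists>j x. j \<in> Obj J \<and> x \<in> Fobj G j \<and> Smap (p j) x = a"
        using R unfolding elementwise_colimit_def by blast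
      have eq: "Smap (q j) x = Smap (q k) y"
        if "j \<in> Obj J" "k \<in> Obj J" "x \<in> Fobj G j" "y \<in> Fobj G k" "Smap (p j) x = Smap (p k) y" for j k x y
      proof -
        \<comment> \<open>The Leibniz condition is tested on the predicate of having the same image
          in \<open>B\<close> as \<open>x\<close>, which holds for \<open>x\<close> itself.\<close>
        have "class_predicate J G (\<lambda>k y. Smap (q k) y = Smap (q j) x)"
          unfolding class_predicate_def
        proof (intro ballI)
          fix u y assume u: "u \<in> Arr J" and y: "y \<in> Fobj G (Dom J u)"
          have "Cmp set_cat (q (Cod J u)) (Farr G u) = q (Dom J u)"
            using q u by (simp add: is_cocone_def)
          from arg_cong[OF this, of "\<lambda>f. Smap f y"]
          show "(Smap (q (Cod J u)) (Smap (Farr G u) y) = Smap (q j) x) =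
              (Smap (q (Dom J u)) y = Smap (q j) x)"
            using y G.Sdom_Scod[OF homI[OF u refl refl]] by (simp add: compose_def)
        qed
        with R have "\<forall>i \<in> Obj J. \<forall>k \<in> Obj J. \<forall>z \<in> Fobj G i. \<forall>y \<in> Fobj G k. Smap (p i) z = Smap (p k) y \<longrightarrow>
            (Smap (q i) z = Smap (q j) x) = (Smap (q k) y = Smap (q j) x)"
          unfolding elementwise_colimit_def by blast
        from this[rule_format, OF that] show ?thesis by simp
      qed
      have "\<forall>a \<in> A. \<exists>b. \<exists>j x. j \<in> Obj J \<and> x \<in> Fobj G j \<and> Smap (p j) x = a \<and> b = Smap (q j) x"
      proof
        fix a assume "a \<in> A"
        from surj[OF this] obtain j x where "j \<in> Obj J" "x \<in> Fobj G j" "Smap (p j) x = a" by blast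
        then show "\<exists>b j x. j \<in> Obj J \<and> x \<in> Fobj G j \<and> Smap (p j) x = a \<and> b = Smap (q j) x"
          by (intro exI[of _ "Smap (q j) x"] exI[of _ j] exI[of _ x]) simp
      qed
      from bchoice[OF this] obtain b where b: "\<And>a. a \<in> A \<Longrightarrow>
          \<exists>j x. j \<in> Obj J \<and> x \<in> Fobj G j \<and> Smap (p j) x = a \<and> b a = Smap (q j) x"
        by (elim exE) (rule that, erule bspec)
      have bp: "b (Smap (p j) x) = Smap (q j) x" if "j \<in> Obj J" "x \<in> Fobj G j" for j x
      proof -
        have "Smap (p j) x \<in> A" using p[of j] that by (auto simp: hom_set_cat)
        from b[OF this] obtain k y where "k \<in> Obj J" "y \<in> Fobj G k" "Smap (p k) y = Smap (p j) x"
          "b (Smap (p j) x) = Smap (q k) y" by blast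
        then show ?thesis using eq[of k j y x] that by simp
      qed
      define h where "h = \<lparr>Sdom = A, Scod = B, Smap = (\<lambda>a \<in> A. b a)\<rparr>"
      have "b a \<in> B" if "a \<in> A" for a
        using b[OF that] set_map_in[OF qh] by auto
      then have h: "h \<in> hom set_cat A B" using A B by (auto simp: h_def hom_set_cat)
      show "\<exists>!h. h \<in> hom set_cat A B \<and> (\<forall>j \<in> Obj J. Cmp set_cat h (p j) = q j)"
      proof (rule ex1I)
        have "Cmp set_cat h (p j) = q j" if j: "j \<in> Obj J" for j
          by (rule setmap_eqI[OF S.Cmp_in[OF p[OF j] h] qh[OF j]])
            (use set_Cmp_apply[OF p[OF j]] set_map_in[OF p[OF j]] bp j in
              \<open>simp add: h_def del: set_cat_simps(5)\<close>)
        then show "h \<in> hom set_cat A B \<and> (\<forall>j \<in> Obj J. Cmp set_cat h (p j) = q j)"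
          using h by blast
      next
        fix h' assume h': "h' \<in> hom set_cat A B \<and> (\<forall>j \<in> Obj J. Cmp set_cat h' (p j) = q j)"
        show "h' = h"
        proof (rule setmap_eqI)
          fix a assume a: "a \<in> A"
          then obtain j x where jx: "j \<in> Obj J" "x \<in> Fobj G j" "Smap (p j) x = a" using surj by blast
          have "Cmp set_cat h' (p j) = q j" using h' jx by blast
          from set_Cmp_eqD[OF this p[OF jx(1)] jx(2)] have "Smap h' a = Smap (q j) x"
            using jx by simp
          then show "Smap h' a = Smap h a" using bp[OF jx(1,2)] jx a by (simp add: h_def)
        qed (use h h' in auto)
      qed
    qed (rule cone)
  qed
  then show ?thesis unfolding is_colimit_def by blast
qed

section \<open>Points on elements\<close>

lemma set_valued_comp:
  assumes "set_valued C P" "is_functor J C F"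
  shows "set_valued J (comp_funct J P F)"
  using assms is_functor_comp unfolding set_valued_def by blast

lemma is_kappa_point_set_valued: "is_kappa_point \<kappa> T P \<Longrightarrow> set_valued T P"
  by (simp add: is_kappa_point_def set_valued_def)

text \<open>A functor sends cones to cones and cocones to cocones, so only the elementwise parts of
  the two descriptions of limits and colimits of sets remain to be required.\<close>

lemma is_kappa_point_iff:
  fixes P :: "'v point" and \<kappa> :: "'k rel"
  assumes inf: "infinite (UNIV :: 'v set)" and P: "set_valued T P"
  shows "is_kappa_point \<kappa> T P \<longleftrightarrow>
    (\<forall>(J :: ('v, 'v) cat) F A p. category J \<and> |Arr J| <o |UNIV :: 'v set| \<and> is_functor J T F \<and>
      is_colimit J T F A p \<longrightarrow>
      elementwise_colimit J (comp_funct J P F) (Fobj P A) (\<lambda>j. Smap (Farr P (p j)))) \<and>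
    (\<forall>(J :: ('k, 'k) cat) F A p x. category J \<and> |Arr J| <o \<kappa> \<and> is_functor J T F \<and>
      is_limit J T F A p \<and> compatible J (comp_funct J P F) x \<longrightarrow>
      (\<exists>!a. a \<in> Fobj P A \<and> (\<forall>j \<in> Obj J. Smap (Farr P (p j)) a = x j)))"
proof -
  interpret P: set_valued T P by fact
  have lim: "is_limit J set_cat (comp_funct J P F) (Fobj P A) (\<lambda>j. Farr P (p j)) \<longleftrightarrow>
      (\<forall>x. compatible J (comp_funct J P F) x \<longrightarrow>
        (\<exists>!a. a \<in> Fobj P A \<and> (\<forall>j \<in> Obj J. Smap (Farr P (p j)) a = x j)))"
    if "is_functor J T F" "is_limit J T F A p" for J :: "('k, 'k) cat" and F A p
  proof -
    have "is_cone J set_cat (comp_funct J P F) (Fobj P A) (\<lambda>j. Farr P (p j))"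
      using is_functor_cone[OF P.set_functor that(1)] that(2) unfolding is_limit_def by blast
    then show ?thesis
      by (simp only: is_limit_set_iff[OF inf set_valued_comp[OF P that(1)]] simp_thms)
  qed
  have colim: "is_colimit J set_cat (comp_funct J P F) (Fobj P A) (\<lambda>j. Farr P (p j)) \<longleftrightarrow>
      elementwise_colimit J (comp_funct J P F) (Fobj P A) (\<lambda>j. Smap (Farr P (p j)))"
    if "is_functor J T F" "is_colimit J T F A p" for J :: "('v, 'v) cat" and F A p
  proof -
    have "is_cocone J set_cat (comp_funct J P F) (Fobj P A) (\<lambda>j. Farr P (p j))"
      using is_functor_cocone[OF P.set_functor that(1)] that(2) unfolding is_colimit_def by blast
    then show ?thesis
      by (simp only: is_colimit_set_iff[OF inf set_valued_comp[OF P that(1)]] simp_thms)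
  qed
  have 1: "preserves_colimits_below |UNIV :: 'v set| T set_cat P \<longleftrightarrow>
    (\<forall>(J :: ('v, 'v) cat) F A p. category J \<and> |Arr J| <o |UNIV :: 'v set| \<and> is_functor J T F \<and>
      is_colimit J T F A p \<longrightarrow>
      elementwise_colimit J (comp_funct J P F) (Fobj P A) (\<lambda>j. Smap (Farr P (p j))))"
    unfolding preserves_colimits_below_def by (intro iff_allI imp_cong refl) (simp add: colim)
  have 2: "preserves_limits_below \<kappa> T set_cat P \<longleftrightarrow>
    (\<forall>(J :: ('k, 'k) cat) F A p x. category J \<and> |Arr J| <o \<kappa> \<and> is_functor J T F \<and>
      is_limit J T F A p \<and> compatible J (comp_funct J P F) x \<longrightarrow>
      (\<exists>!a. a \<in> Fobj P A \<and> (\<forall>j \<in> Obj J. Smap (Farr P (p j)) a = x j)))"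
    unfolding preserves_limits_below_def
  proof (intro iff_allI)
    fix J :: "('k, 'k) cat" and F A p
    show "(category J \<and> |Arr J| <o \<kappa> \<and> is_functor J T F \<and> is_limit J T F A p \<longrightarrow>
        is_limit J set_cat (comp_funct J P F) (Fobj P A) (\<lambda>j. Farr P (p j))) =
      (\<forall>x. category J \<and> |Arr J| <o \<kappa> \<and> is_functor J T F \<and> is_limit J T F A p \<and>
        compatible J (comp_funct J P F) x \<longrightarrow>
        (\<exists>!a. a \<in> Fobj P A \<and> (\<forall>j \<in> Obj J. Smap (Farr P (p j)) a = x j)))"
      using lim[of J F A p] by blast
  qed
  show ?thesis unfolding is_kappa_point_def 1 2 using P.set_functor by blast
qed

section \<open>Maps of points and injections of sets as plain functions\<close>

lemma kappa_points_simps [simp]: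
  "Obj (kappa_points \<kappa> T) = {P. is_kappa_point \<kappa> T P}"
  "t \<in> Arr (kappa_points \<kappa> T) \<longleftrightarrow>
     is_nattrans T set_cat t \<and> is_kappa_point \<kappa> T (Src t) \<and> is_kappa_point \<kappa> T (Tgt t)"
  "Dom (kappa_points \<kappa> T) = Src" "Cod (kappa_points \<kappa> T) = Tgt"
  by (auto simp: kappa_points_def full_sub_def)

lemma hom_kappa_points:
  "t \<in> hom (kappa_points \<kappa> T) P Q \<longleftrightarrow>
     is_nattrans T set_cat t \<and> Src t = P \<and> Tgt t = Q \<and> is_kappa_point \<kappa> T P \<and> is_kappa_point \<kappa> T Q"
  by (auto simp: hom_def)

lemma kappa_points_Cmp_apply:
  assumes "t \<in> hom (kappa_points \<kappa> T) P Q" "X \<in> Obj T" "x \<in> Fobj P X"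
  shows "Smap (Component (Cmp (kappa_points \<kappa> T) s t) X) x = Smap (Component s X) (Smap (Component t X) x)"
proof -
  have "Component t X \<in> hom set_cat (Fobj P X) (Fobj Q X)"
    using assms by (auto simp: hom_kappa_points is_nattrans_def)
  from set_Cmp_apply[OF this assms(3)] show ?thesis
    using assms(2) by (simp add: kappa_points_def full_sub_def functor_cat_def del: set_cat_simps(5))
qed

lemma kappa_points_Idt_apply:
  "X \<in> Obj T \<Longrightarrow> x \<in> Fobj P X \<Longrightarrow> Smap (Component (Idt (kappa_points \<kappa> T) P) X) x = x"
  by (simp add: kappa_points_def full_sub_def functor_cat_def)

text \<open>Natural transformations without extensionality or recorded source and target, so that
  composites and glued maps can be written as plain functions. They are packed into morphisms only
  when fullness is invoked.\<close>

definition natural_family ::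
    "('o, 'm) cat \<Rightarrow> ('o, 'm, 'v set, 'v setmap) funct \<Rightarrow> ('o, 'm, 'v set, 'v setmap) funct \<Rightarrow>
     ('o \<Rightarrow> 'v \<Rightarrow> 'v) \<Rightarrow> bool" where
  "natural_family T P Q t \<longleftrightarrow>
     (\<forall>X \<in> Obj T. \<forall>x \<in> Fobj P X. t X x \<in> Fobj Q X) \<and>
     (\<forall>u X Y. u \<in> hom T X Y \<longrightarrow> (\<forall>x \<in> Fobj P X.
        Smap (Farr Q u) (t X x) = t Y (Smap (Farr P u) x)))"

lemma natural_familyD:
  assumes "natural_family T P Q t"
  shows "X \<in> Obj T \<Longrightarrow> x \<in> Fobj P X \<Longrightarrow> t X x \<in> Fobj Q X"
    "u \<in> hom T X Y \<Longrightarrow> x \<in> Fobj P X \<Longrightarrow> Smap (Farr Q u) (t X x) = t Y (Smap (Farr P u) x)"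
  using assms by (auto simp: natural_family_def)

lemma natural_family_comp:
  assumes T: "category T" and t: "natural_family T P Q t" and s: "natural_family T Q R s"
  shows "natural_family T P R (\<lambda>X x. s X (t X x))"
proof -
  interpret category T by fact
  show ?thesis
    unfolding natural_family_def
    using natural_familyD[OF t] natural_familyD[OF s] hom_Obj by auto
qed

lemma natural_family_Component:
  assumes "t \<in> hom (kappa_points \<kappa> T) P Q"
  shows "natural_family T P Q (\<lambda>X. Smap (Component t X))"
proof -
  have t: "is_nattrans T set_cat t" "Src t = P" "Tgt t = Q" using assms by (auto simp: hom_kappa_points)
  show ?thesis
    unfolding natural_family_def
    using nattrans_component(3)[OF t(1)] nattrans_natural[OF t(1)] t(2,3) by auto
qed

lemma set_mono_ge_simps [simp]:
  "A \<in> Obj (set_mono_ge r) \<longleftrightarrow> small A \<and> r \<le>o |A|"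
  "Idt (set_mono_ge r) = Idt set_cat" "Cmp (set_mono_ge r) = Cmp set_cat"
  by (auto simp: set_mono_ge_def)

lemma hom_set_mono_ge:
  "f \<in> hom (set_mono_ge r) A B \<longleftrightarrow>
     f \<in> hom set_cat A B \<and> r \<le>o |A| \<and> r \<le>o |B| \<and> inj_on (Smap f) A"
  by (auto simp: set_mono_ge_def hom_def)

text \<open>Makes a morphism from a total function, so that all inclusions can be written with the
  one function \<open>\<lambda>y. y\<close>.\<close>

definition restricted_map :: "'v set \<Rightarrow> 'v set \<Rightarrow> ('v \<Rightarrow> 'v) \<Rightarrow> 'v setmap" where
  "restricted_map A B f = \<lparr>Sdom = A, Scod = B, Smap = restrict f A\<rparr>"

lemma hom_set_mono_geE:
  assumes "f \<in> hom (set_mono_ge r) A B"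
  obtains g where "inj_on g A" "g ` A \<subseteq> B" "f = restricted_map A B g"
proof (rule that[of "Smap f"])
  have f: "f \<in> hom set_cat A B" "inj_on (Smap f) A" using assms by (auto simp: hom_set_mono_ge)
  then show "inj_on (Smap f) A" "Smap f ` A \<subseteq> B" using set_map_in by auto
  show "f = restricted_map A B (Smap f)"
    using f(1) by (auto simp: restricted_map_def hom_set_cat PiE_def extensional_restrict)
qed

text \<open>The data drawn from the equivalence. Essential surjectivity is stated in the form that
  every point is a retract of a represented one.\<close>

locale mono_representation =
  fixes T :: "('v presheaf, 'v presheaf_map) cat" and \<kappa> :: "'k rel" and lam :: "'l rel"
    and \<Phi> :: "('v set, 'v setmap, 'v point, 'v point_map) funct"
  assumes inaccessible: "inaccessible |UNIV :: 'v set|"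
    and Cinfinite: "Cinfinite \<kappa>" and regular: "regularCard \<kappa>"
    and less: "\<kappa> <o lam"
    and is_functor: "is_functor (set_mono_ge lam) (kappa_points \<kappa> T) \<Phi>"
    and faithful: "\<And>A B f g. f \<in> hom (set_mono_ge lam) A B \<Longrightarrow> g \<in> hom (set_mono_ge lam) A B \<Longrightarrow>
      Farr \<Phi> f = Farr \<Phi> g \<Longrightarrow> f = g"
    and full: "\<And>A B t. A \<in> Obj (set_mono_ge lam) \<Longrightarrow> B \<in> Obj (set_mono_ge lam) \<Longrightarrow>
      t \<in> hom (kappa_points \<kappa> T) (Fobj \<Phi> A) (Fobj \<Phi> B) \<Longrightarrow>
      \<exists>f \<in> hom (set_mono_ge lam) A B. Farr \<Phi> f = t"
    and essentially_surjective: "\<And>P. P \<in> Obj (kappa_points \<kappa> T) \<Longrightarrow>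
      \<exists>A \<in> Obj (set_mono_ge lam). \<exists>s \<in> hom (kappa_points \<kappa> T) (Fobj \<Phi> A) P.
      \<exists>t \<in> hom (kappa_points \<kappa> T) P (Fobj \<Phi> A).
        Cmp (kappa_points \<kappa> T) s t = Idt (kappa_points \<kappa> T) P"
begin

definition large :: "'v set \<Rightarrow> bool" where
  "large Y \<longleftrightarrow> small Y \<and> lam \<le>o |Y|"

text \<open>\<open>el Y X\<close> is functorial in both variables: in \<open>X\<close> along arrows
  of \<open>T\<close> through \<open>tr\<close>, and in \<open>Y\<close> along injections of large
  sets through \<open>act\<close>. The arguments below work with this action on elements instead of
  the functor \<Phi>.\<close>

definition el :: "'v set \<Rightarrow> 'v presheaf \<Rightarrow> 'v set" where
  "el Y X = Fobj (Fobj \<Phi> Y) X"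

definition tr :: "'v set \<Rightarrow> 'v presheaf_map \<Rightarrow> 'v \<Rightarrow> 'v" where
  "tr Y u = Smap (Farr (Fobj \<Phi> Y) u)"

definition act :: "'v set \<Rightarrow> 'v set \<Rightarrow> ('v \<Rightarrow> 'v) \<Rightarrow> 'v presheaf \<Rightarrow> 'v \<Rightarrow> 'v" where
  "act Y Z f X = Smap (Component (Farr \<Phi> (restricted_map Y Z f)) X)"

lemma infinite_UNIV: "infinite (UNIV :: 'v set)"
proof -
  have "natLeq <o |UNIV :: 'v set|" using inaccessible by (simp add: inaccessible_def)
  from ordLess_imp_ordLeq[OF this] show ?thesis using infinite_iff_natLeq_ordLeq by blast
qed

lemma point: "large Y \<Longrightarrow> is_kappa_point \<kappa> T (Fobj \<Phi> Y)"
  using is_functor_Obj[OF is_functor, of Y] by (simp add: large_def)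

lemmas point_set_valued = is_kappa_point_set_valued[OF point]

lemma hom_restricted_map:
  "large Y \<Longrightarrow> large Z \<Longrightarrow> inj_on f Y \<Longrightarrow> f ` Y \<subseteq> Z \<Longrightarrow>
    restricted_map Y Z f \<in> hom (set_mono_ge lam) Y Z"
  by (auto simp: restricted_map_def large_def hom_set_mono_ge hom_set_cat inj_on_def)

lemma Farr_restricted_map:
  "large Y \<Longrightarrow> large Z \<Longrightarrow> inj_on f Y \<Longrightarrow> f ` Y \<subseteq> Z \<Longrightarrow>
    Farr \<Phi> (restricted_map Y Z f) \<in> hom (kappa_points \<kappa> T) (Fobj \<Phi> Y) (Fobj \<Phi> Z)"
  using is_functor_hom[OF is_functor hom_restricted_map] .

lemma act_natural:
  "large Y \<Longrightarrow> large Z \<Longrightarrow> inj_on f Y \<Longrightarrow> f ` Y \<subseteq> Z \<Longrightarrow>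
    natural_family T (Fobj \<Phi> Y) (Fobj \<Phi> Z) (act Y Z f)"
  using natural_family_Component[OF Farr_restricted_map] unfolding act_def .

lemma act_in:
  "large Y \<Longrightarrow> large Z \<Longrightarrow> inj_on f Y \<Longrightarrow> f ` Y \<subseteq> Z \<Longrightarrow> X \<in> Obj T \<Longrightarrow> x \<in> el Y X \<Longrightarrow>
    act Y Z f X x \<in> el Z X"
  using natural_familyD(1)[OF act_natural] unfolding el_def .

lemma tr_act:
  "large Y \<Longrightarrow> large Z \<Longrightarrow> inj_on f Y \<Longrightarrow> f ` Y \<subseteq> Z \<Longrightarrow> u \<in> hom T X X' \<Longrightarrow> x \<in> el Y X \<Longrightarrow>
    tr Z u (act Y Z f X x) = act Y Z f X' (tr Y u x)"
  using natural_familyD(2)[OF act_natural] unfolding el_def tr_def .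

lemma tr_in: "large Y \<Longrightarrow> u \<in> hom T X X' \<Longrightarrow> x \<in> el Y X \<Longrightarrow> tr Y u x \<in> el Y X'"
  using set_valued.map_in[OF point_set_valued] unfolding el_def tr_def .

lemma act_cong: "(\<And>y. y \<in> Y \<Longrightarrow> f y = g y) \<Longrightarrow> act Y Z f = act Y Z g"
  by (auto simp: act_def restricted_map_def fun_eq_iff cong: restrict_cong)

lemma act_ident:
  assumes "large Y" "X \<in> Obj T" "x \<in> el Y X"
  shows "act Y Y (\<lambda>y. y) X x = x"
  using assms is_functor_Idt[OF is_functor, of Y] kappa_points_Idt_apply[of X T x "Fobj \<Phi> Y" \<kappa>]
  by (simp add: act_def restricted_map_def el_def large_def)

lemma act_act:
  assumes Y: "large Y" and Z: "large Z" and W: "large W"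
    and f: "inj_on f Y" "f ` Y \<subseteq> Z" and g: "inj_on g Z" "g ` Z \<subseteq> W"
    and x: "X \<in> Obj T" "x \<in> el Y X"
  shows "act Z W g X (act Y Z f X x) = act Y W (\<lambda>y. g (f y)) X x"
proof -
  have "Cmp set_cat (restricted_map Z W g) (restricted_map Y Z f) = restricted_map Y W (\<lambda>y. g (f y))"
    using f by (auto simp: restricted_map_def compose_def intro!: restrict_ext)
  then have "Farr \<Phi> (restricted_map Y W (\<lambda>y. g (f y))) =
      Cmp (kappa_points \<kappa> T) (Farr \<Phi> (restricted_map Z W g)) (Farr \<Phi> (restricted_map Y Z f))"
    using is_functor_Cmp[OF is_functor hom_restricted_map[OF Y Z f] hom_restricted_map[OF Z W g]]
    by (simp del: set_cat_simps)
  then show ?thesis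
    unfolding act_def
    using kappa_points_Cmp_apply[OF Farr_restricted_map[OF Y Z f], of X x] x by (simp add: el_def)
qed

text \<open>The way back from points to sets: an equation between values of injections follows from
  an equation between their actions on all elements.\<close>

lemma act_faithful:
  assumes Y: "large Y" and Z: "large Z"
    and f: "inj_on f Y" "f ` Y \<subseteq> Z" and g: "inj_on g Y" "g ` Y \<subseteq> Z"
    and eq: "\<And>X x. X \<in> Obj T \<Longrightarrow> x \<in> el Y X \<Longrightarrow> act Y Z f X x = act Y Z g X x"
    and y: "y \<in> Y"
  shows "f y = g y"
proof -
  note hf = Farr_restricted_map[OF Y Z f] and hg = Farr_restricted_map[OF Y Z g]
  have "Farr \<Phi> (restricted_map Y Z f) = Farr \<Phi> (restricted_map Y Z g)"
    using hf hg eq by (intro nattrans_eqI[of T]) (auto simp: hom_kappa_points act_def el_def)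
  then have "restricted_map Y Z f = restricted_map Y Z g"
    using faithful[OF hom_restricted_map[OF Y Z f] hom_restricted_map[OF Y Z g]] by blast
  then have "restrict f Y y = restrict g Y y" by (simp add: restricted_map_def)
  then show ?thesis using y by simp
qed

lemma act_full:
  assumes Y: "large Y" and Z: "large Z" and t: "natural_family T (Fobj \<Phi> Y) (Fobj \<Phi> Z) t"
  obtains f where "inj_on f Y" "f ` Y \<subseteq> Z"
    "\<forall>X \<in> Obj T. \<forall>x \<in> el Y X. t X x = act Y Z f X x"
proof -
  define s where "s = set_nattrans T (Fobj \<Phi> Y) (Fobj \<Phi> Z) t"
  have "is_nattrans T set_cat s"
    unfolding s_def using point_set_valued[OF Y] point_set_valued[OF Z] natural_familyD[OF t]
    by (intro is_nattrans_set_nattrans)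
  then have "s \<in> hom (kappa_points \<kappa> T) (Fobj \<Phi> Y) (Fobj \<Phi> Z)"
    using point[OF Y] point[OF Z] by (simp add: hom_kappa_points s_def)
  moreover have "Y \<in> Obj (set_mono_ge lam)" "Z \<in> Obj (set_mono_ge lam)" using Y Z by (auto simp: large_def)
  ultimately obtain h where h: "h \<in> hom (set_mono_ge lam) Y Z" "Farr \<Phi> h = s" using full by blast
  from hom_set_mono_geE[OF h(1)] obtain f where f: "inj_on f Y" "f ` Y \<subseteq> Z" "h = restricted_map Y Z f" .
  show thesis
  proof (rule that[OF f(1,2)], intro ballI)
    fix X x assume "X \<in> Obj T" "x \<in> el Y X"
    then show "t X x = act Y Z f X x"
      unfolding act_def f(3)[symmetric] h(2) by (simp add: s_def el_def)
  qed
qed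

lemma act_essentially_surjective:
  assumes P: "is_kappa_point \<kappa> T P"
  obtains E s t where "large E" "natural_family T (Fobj \<Phi> E) P s" "natural_family T P (Fobj \<Phi> E) t"
    "\<forall>X \<in> Obj T. \<forall>x \<in> Fobj P X. s X (t X x) = x"
proof -
  obtain E s t where E: "E \<in> Obj (set_mono_ge lam)"
    and s: "s \<in> hom (kappa_points \<kappa> T) (Fobj \<Phi> E) P" and t: "t \<in> hom (kappa_points \<kappa> T) P (Fobj \<Phi> E)"
    and st: "Cmp (kappa_points \<kappa> T) s t = Idt (kappa_points \<kappa> T) P"
    using essentially_surjective[of P] P by auto
  show thesis
  proof (rule that[of E "\<lambda>X. Smap (Component s X)" "\<lambda>X. Smap (Component t X)"])
    show "large E" using E by (simp add: large_def)
    show "natural_family T (Fobj \<Phi> E) P (\<lambda>X. Smap (Component s X))"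
      "natural_family T P (Fobj \<Phi> E) (\<lambda>X. Smap (Component t X))"
      using natural_family_Component s t by blast+
    show "\<forall>X \<in> Obj T. \<forall>x \<in> Fobj P X. Smap (Component s X) (Smap (Component t X) x) = x"
      using kappa_points_Cmp_apply[OF t, of _ _ s] kappa_points_Idt_apply[of _ T _ P \<kappa>] st by simp
  qed
qed

end

text \<open>The elementwise criterion with composite functors and set maps unfolded to
  \<open>Q\<close> and \<open>m\<close>. It serves both for the germs along a directed system and
  for the elements supported in a small set.\<close>

lemma is_kappa_point_set_functorI:
  fixes Q :: "'v presheaf \<Rightarrow> 'v set" and \<kappa> :: "'k rel"
  assumes inf: "infinite (UNIV :: 'v set)" and P: "set_valued T (set_functor T Q m)"
    and lim: "\<And>(J :: ('k, 'k) cat) F A p x. category J \<Longrightarrow> |Arr J| <o \<kappa> \<Longrightarrow> is_functor J T F \<Longrightarrow>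
      is_limit J T F A p \<Longrightarrow> \<forall>j \<in> Obj J. x j \<in> Q (Fobj F j) \<Longrightarrow>
      \<forall>u \<in> Arr J. m (Farr F u) (x (Dom J u)) = x (Cod J u) \<Longrightarrow>
      \<exists>!a. a \<in> Q A \<and> (\<forall>j \<in> Obj J. m (p j) a = x j)"
    and surj: "\<And>(J :: ('v, 'v) cat) F A p a. category J \<Longrightarrow> |Arr J| <o |UNIV :: 'v set| \<Longrightarrow>
      is_functor J T F \<Longrightarrow> is_colimit J T F A p \<Longrightarrow> a \<in> Q A \<Longrightarrow>
      \<exists>j \<in> Obj J. \<exists>x \<in> Q (Fobj F j). m (p j) x = a"
    and pred: "\<And>(J :: ('v, 'v) cat) F A p (c :: 'v \<Rightarrow> 'v \<Rightarrow> bool) j k x y. category J \<Longrightarrow> |Arr J| <o |UNIV :: 'v set| \<Longrightarrow>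
      is_functor J T F \<Longrightarrow> is_colimit J T F A p \<Longrightarrow>
      \<forall>u \<in> Arr J. \<forall>x \<in> Q (Fobj F (Dom J u)). c (Cod J u) (m (Farr F u) x) = c (Dom J u) x \<Longrightarrow>
      j \<in> Obj J \<Longrightarrow> k \<in> Obj J \<Longrightarrow> x \<in> Q (Fobj F j) \<Longrightarrow> y \<in> Q (Fobj F k) \<Longrightarrow>
      m (p j) x = m (p k) y \<Longrightarrow> c j x = c k y"
  shows "is_kappa_point \<kappa> T (set_functor T Q m)"
proof -
  let ?P = "set_functor T Q m"
  interpret P: set_valued T ?P by fact
  interpret T: category T by (rule P.category)
  have Farr: "Smap (Farr ?P u) x = m u x" if "u \<in> hom T X Y" "x \<in> Q X" for u X Y x
    using that by simp
  have Q_F: "Fobj (comp_funct J ?P F) j = Q (Fobj F j)" if "is_functor J T F" "j \<in> Obj J"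
    for J :: "('i, 'i) cat" and F j
    using that is_functor_Obj[OF that] by (simp add: comp_funct_def)
  have m_F: "Smap (Farr (comp_funct J ?P F) u) x = m (Farr F u) x"
    if "is_functor J T F" "u \<in> Arr J" "x \<in> Q (Fobj F (Dom J u))"
    for J :: "('i, 'i) cat" and F u x
    using that Farr[OF is_functor_hom[OF that(1) homI[OF that(2) refl refl]] that(3)]
    by (simp add: comp_funct_def)
  show ?thesis
    unfolding is_kappa_point_iff[OF inf P]
  proof (intro conjI allI impI; elim conjE)
    fix J :: "('k, 'k) cat" and F A p x
    assume J: "category J" "|Arr J| <o \<kappa>" and F: "is_functor J T F" and L: "is_limit J T F A p"
      and x: "compatible J (comp_funct J ?P F) x"
    interpret J: category J by fact
    have x1: "\<forall>j \<in> Obj J. x j \<in> Q (Fobj F j)"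
      using x Q_F[OF F] by (auto simp: compatible_def)
    have x2: "\<forall>u \<in> Arr J. m (Farr F u) (x (Dom J u)) = x (Cod J u)"
      using x m_F[OF F] x1 J.Dom_in by (auto simp: compatible_def)
    have A: "A \<in> Obj T" and p: "\<And>j. j \<in> Obj J \<Longrightarrow> p j \<in> hom T A (Fobj F j)"
      using L by (auto simp: is_limit_def is_cone_def)
    have eq: "(\<lambda>a. a \<in> Fobj ?P A \<and> (\<forall>j \<in> Obj J. Smap (Farr ?P (p j)) a = x j)) =
        (\<lambda>a. a \<in> Q A \<and> (\<forall>j \<in> Obj J. m (p j) a = x j))"
      using A Farr[OF p] by auto
    show "\<exists>!a. a \<in> Fobj ?P A \<and> (\<forall>j \<in> Obj J. Smap (Farr ?P (p j)) a = x j)"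
      unfolding eq using lim[OF J F L x1 x2] .
  next
    fix J :: "('v, 'v) cat" and F A p
    assume J: "category J" "|Arr J| <o |UNIV :: 'v set|" and F: "is_functor J T F"
      and L: "is_colimit J T F A p"
    interpret J: category J by fact
    have A: "A \<in> Obj T" and p: "\<And>j. j \<in> Obj J \<Longrightarrow> p j \<in> hom T (Fobj F j) A"
      using L by (auto simp: is_colimit_def is_cocone_def)
    show "elementwise_colimit J (comp_funct J ?P F) (Fobj ?P A) (\<lambda>j. Smap (Farr ?P (p j)))"
      unfolding elementwise_colimit_def
    proof (intro conjI ballI allI impI)
      fix a assume "a \<in> Fobj ?P A"
      then show "\<exists>j \<in> Obj J. \<exists>x \<in> Fobj (comp_funct J ?P F) j. Smap (Farr ?P (p j)) x = a"
        using surj[OF J F L, of a] A Farr[OF p] Q_F[OF F] by fastforce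
    next
      fix c j k x y
      assume c: "class_predicate J (comp_funct J ?P F) c" and jk: "j \<in> Obj J" "k \<in> Obj J"
        and xy: "x \<in> Fobj (comp_funct J ?P F) j" "y \<in> Fobj (comp_funct J ?P F) k"
        and eq: "Smap (Farr ?P (p j)) x = Smap (Farr ?P (p k)) y"
      have "\<forall>u \<in> Arr J. \<forall>x \<in> Q (Fobj F (Dom J u)). c (Cod J u) (m (Farr F u) x) = c (Dom J u) x"
        using c m_F[OF F] Q_F[OF F] J.Dom_in by (auto simp: class_predicate_def)
      moreover have xy': "x \<in> Q (Fobj F j)" "y \<in> Q (Fobj F k)" using xy jk Q_F[OF F] by auto
      moreover have "m (p j) x = m (p k) y"
        using eq Farr[OF p[OF jk(1)] xy'(1)] Farr[OF p[OF jk(2)] xy'(2)] by simp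
      ultimately show "c j x = c k y" using pred[OF J F L _ jk] by blast
    qed
  qed
qed

context mono_representation
begin

section \<open>Limits and colimits in terms of the elements of a represented point\<close>

lemma point_limit:
  fixes J :: "('k, 'k) cat"
  assumes Y: "large Y" and J: "category J" "|Arr J| <o \<kappa>"
    and F: "is_functor J T F" and L: "is_limit J T F A p"
    and x: "\<And>j. j \<in> Obj J \<Longrightarrow> x j \<in> el Y (Fobj F j)"
      "\<And>u. u \<in> Arr J \<Longrightarrow> tr Y (Farr F u) (x (Dom J u)) = x (Cod J u)"
  shows "\<exists>!a. a \<in> el Y A \<and> (\<forall>j \<in> Obj J. tr Y (p j) a = x j)"
proof -
  have "compatible J (comp_funct J (Fobj \<Phi> Y) F) x"
    using x by (auto simp: compatible_def comp_funct_def el_def tr_def)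
  then show ?thesis
    using point[OF Y] J F L unfolding is_kappa_point_iff[OF infinite_UNIV point_set_valued[OF Y]]
      el_def tr_def by blast
qed

text \<open>The projections of \<open>a\<close> form a compatible family, and both elements lie over
  it; uniqueness identifies them.\<close>

lemma point_limit_eq:
  fixes J :: "('k, 'k) cat"
  assumes Y: "large Y" and J: "category J" "|Arr J| <o \<kappa>"
    and F: "is_functor J T F" and L: "is_limit J T F A p"
    and a: "a \<in> el Y A" and b: "b \<in> el Y A"
    and eq: "\<And>j. j \<in> Obj J \<Longrightarrow> tr Y (p j) a = tr Y (p j) b"
  shows "a = b"
proof -
  have p: "\<And>j. j \<in> Obj J \<Longrightarrow> p j \<in> hom T A (Fobj F j)"
    using L by (auto simp: is_limit_def is_cone_def)
  have "tr Y (Farr F u) (tr Y (p (Dom J u)) a) = tr Y (p (Cod J u)) a" if u: "u \<in> Arr J" for u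
    using set_valued.map_Cmp[OF point_set_valued[OF Y] p[OF category.Dom_in[OF J(1) u]]
        is_functor_hom[OF F homI[OF u refl refl]], of a] a L u
    by (simp add: tr_def el_def is_limit_def is_cone_def)
  then have "\<exists>!c. c \<in> el Y A \<and> (\<forall>j \<in> Obj J. tr Y (p j) c = tr Y (p j) a)"
    using point_limit[OF Y J F L, of "\<lambda>j. tr Y (p j) a"] tr_in[OF Y p a] by blast
  then show ?thesis
  proof (rule ex1E)
    fix c assume "\<forall>d. d \<in> el Y A \<and> (\<forall>j \<in> Obj J. tr Y (p j) d = tr Y (p j) a) \<longrightarrow> d = c"
    then have "a = c" "b = c" using a b eq by simp_all
    then show ?thesis by simp
  qed
qed

lemma point_colimit:
  fixes J :: "('v, 'v) cat"
  assumes Y: "large Y" and J: "category J" "|Arr J| <o |UNIV :: 'v set|"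
    and F: "is_functor J T F" and L: "is_colimit J T F A p"
  shows "elementwise_colimit J (comp_funct J (Fobj \<Phi> Y) F) (el Y A) (\<lambda>j. tr Y (p j))"
  using point[OF Y] J F L unfolding is_kappa_point_iff[OF infinite_UNIV point_set_valued[OF Y]]
      el_def tr_def by blast

lemma point_colimit_surj:
  fixes J :: "('v, 'v) cat"
  assumes Y: "large Y" and J: "category J" "|Arr J| <o |UNIV :: 'v set|"
    and F: "is_functor J T F" and L: "is_colimit J T F A p" and a: "a \<in> el Y A"
  obtains j x where "j \<in> Obj J" "x \<in> el Y (Fobj F j)" "tr Y (p j) x = a"
  using point_colimit[OF Y J F L] a that
  unfolding elementwise_colimit_def by (auto simp: comp_funct_def el_def)

lemma point_colimit_eq:
  fixes J :: "('v, 'v) cat" and c :: "'v \<Rightarrow> 'v \<Rightarrow> bool"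
  assumes Y: "large Y" and J: "category J" "|Arr J| <o |UNIV :: 'v set|"
    and F: "is_functor J T F" and L: "is_colimit J T F A p"
    and c: "\<And>u x. u \<in> Arr J \<Longrightarrow> x \<in> el Y (Fobj F (Dom J u)) \<Longrightarrow>
      c (Cod J u) (tr Y (Farr F u) x) = c (Dom J u) x"
    and jk: "j \<in> Obj J" "k \<in> Obj J" "x \<in> el Y (Fobj F j)" "y \<in> el Y (Fobj F k)"
    and eq: "tr Y (p j) x = tr Y (p k) y"
  shows "c j x = c k y"
proof -
  interpret J: category J by fact
  have "class_predicate J (comp_funct J (Fobj \<Phi> Y) F) c"
    using c J.Dom_in by (auto simp: class_predicate_def comp_funct_def el_def tr_def)
  with point_colimit[OF Y J F L]
  have "\<forall>j \<in> Obj J. \<forall>k \<in> Obj J. \<forall>x \<in> Fobj (comp_funct J (Fobj \<Phi> Y) F) j.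
      \<forall>y \<in> Fobj (comp_funct J (Fobj \<Phi> Y) F) k. tr Y (p j) x = tr Y (p k) y \<longrightarrow> c j x = c k y"
    unfolding elementwise_colimit_def by blast
  from this[rule_format, OF jk(1,2) _ _ eq] show ?thesis using jk by (simp add: comp_funct_def el_def)
qed

subsection \<open>Cardinal arithmetic\<close>

lemma infinite_kappa: "infinite (Field \<kappa>)" "Card_order \<kappa>"
  using Cinfinite by (auto simp: cinfinite_def)

lemma ksmall_subset: "A \<subseteq> B \<Longrightarrow> |B| <o \<kappa> \<Longrightarrow> |A| <o \<kappa>"
  using card_of_mono1 ordLeq_ordLess_trans by blast

lemma ksmall_image: "|A| <o \<kappa> \<Longrightarrow> |f ` A| <o \<kappa>"
  using card_of_image ordLeq_ordLess_trans by blast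

lemma ksmall_Un: "|A| <o \<kappa> \<Longrightarrow> |B| <o \<kappa> \<Longrightarrow> |A \<union> B| <o \<kappa>"
  using card_of_Un_ordLess_infinite_Field[OF infinite_kappa] by blast

lemma ksmall_UN: "|I| <o \<kappa> \<Longrightarrow> (\<And>i. i \<in> I \<Longrightarrow> |A i| <o \<kappa>) \<Longrightarrow> |\<Union>i\<in>I. A i| <o \<kappa>"
  using card_of_UNION_ordLess_infinite_Field_regularCard[OF regular Cinfinite] by blast

lemma ksmall_finite: "finite A \<Longrightarrow> |A| <o \<kappa>"
  using Cfinite_ordLess_Cinfinite[OF _ Cinfinite, of "|A|"]
  by (simp add: cfinite_def Field_card_of card_of_card_order_on)

lemma ksmall_Obj: "category J \<Longrightarrow> |Arr J| <o \<kappa> \<Longrightarrow> |Obj J| <o \<kappa>"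
  using Idt_inj_card ordLeq_ordLess_trans by blast

lemma large_superset: "large A \<Longrightarrow> A \<subseteq> B \<Longrightarrow> small B \<Longrightarrow> large B"
  unfolding large_def using card_of_mono1 ordLeq_transitive by blast

lemma kappa_less_large: "large Y \<Longrightarrow> \<kappa> <o |Y|"
  unfolding large_def using less ordLess_ordLeq_trans by blast

lemma ksmall_less_large: "large Y \<Longrightarrow> |S| <o \<kappa> \<Longrightarrow> |S| <o |Y|"
  using kappa_less_large ordLess_transitive by blast

lemma infinite_large: "large Y \<Longrightarrow> infinite Y"
  using kappa_less_large ksmall_finite ordLess_transitive ordLess_irreflexive by blast

lemma small_Sigma:
  assumes "|I| <o |UNIV :: 'v set|" "\<And>i. i \<in> I \<Longrightarrow> |A i| <o |UNIV :: 'v set|"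
  shows "|Sigma I A| <o |UNIV :: 'v set|"
proof -
  have "stable |UNIV :: 'v set|"
    using inaccessible infinite_UNIV
    by (intro regularCard_stable) (auto simp: inaccessible_def Field_card_of)
  then show ?thesis using stable_elim assms by blast
qed

lemma small_Pow: "small (D :: 'v set) \<Longrightarrow> |Pow D| <o |UNIV :: 'v set|"
  using inaccessible by (simp add: inaccessible_def small_def Field_card_of)

end

section \<open>Elements over directed unions\<close>

text \<open>Concerns the \<kappa>-directed system of the sets \<open>Y - D \<union> S\<close>, whose
  union is \<open>Y\<close>. Largeness of \<open>Y - D\<close> keeps every member of the system in
  the category, even for empty \<open>S\<close>.\<close>

locale directed_union = mono_representation +
  fixes Y D :: "'a set"
  assumes large_Y: "large Y" and D_subset: "D \<subseteq> Y" and large_Diff: "large (Y - D)"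
begin

definition indices :: "'a set set" where
  "indices = {S. S \<subseteq> D \<and> |S| <o \<kappa>}"

definition part :: "'a set \<Rightarrow> 'a set" where
  "part S = Y - D \<union> S"

definition inc :: "'a set \<Rightarrow> 'a set \<Rightarrow> 'a presheaf \<Rightarrow> 'a \<Rightarrow> 'a" where
  "inc S R = act (part S) (part R) (\<lambda>y. y)"

lemma large_part: "S \<in> indices \<Longrightarrow> large (part S)"
  using D_subset large_superset[OF large_Diff] small_subset[of _ Y] large_Y
  by (auto simp: indices_def part_def large_def)

lemma part_mono: "S \<subseteq> R \<Longrightarrow> (\<lambda>y. y) ` part S \<subseteq> part R"
  by (auto simp: part_def)

lemma part_subset: "S \<in> indices \<Longrightarrow> (\<lambda>y. y) ` part S \<subseteq> Y"
  using D_subset by (auto simp: part_def indices_def)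

lemma inc_natural:
  "S \<in> indices \<Longrightarrow> R \<in> indices \<Longrightarrow> S \<subseteq> R \<Longrightarrow>
    natural_family T (Fobj \<Phi> (part S)) (Fobj \<Phi> (part R)) (inc S R)"
  unfolding inc_def by (rule act_natural) (simp_all add: large_part part_mono[simplified])

lemma inc_in:
  "S \<in> indices \<Longrightarrow> R \<in> indices \<Longrightarrow> S \<subseteq> R \<Longrightarrow> X \<in> Obj T \<Longrightarrow> y \<in> el (part S) X \<Longrightarrow>
    inc S R X y \<in> el (part R) X"
  using natural_familyD(1)[OF inc_natural] by (simp add: el_def)

lemma inc_tr:
  "S \<in> indices \<Longrightarrow> R \<in> indices \<Longrightarrow> S \<subseteq> R \<Longrightarrow> u \<in> hom T X X' \<Longrightarrow> y \<in> el (part S) X \<Longrightarrow>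
    tr (part R) u (inc S R X y) = inc S R X' (tr (part S) u y)"
  using natural_familyD(2)[OF inc_natural] by (simp add: el_def tr_def)

lemma inc_inc:
  "S \<in> indices \<Longrightarrow> R \<in> indices \<Longrightarrow> Q \<in> indices \<Longrightarrow> S \<subseteq> R \<Longrightarrow> R \<subseteq> Q \<Longrightarrow> X \<in> Obj T \<Longrightarrow>
    y \<in> el (part S) X \<Longrightarrow> inc R Q X (inc S R X y) = inc S Q X y"
  unfolding inc_def by (subst act_act) (simp_all add: large_part part_mono[simplified])

lemma inc_refl: "S \<in> indices \<Longrightarrow> X \<in> Obj T \<Longrightarrow> y \<in> el (part S) X \<Longrightarrow> inc S S X y = y"
  unfolding inc_def by (rule act_ident) (simp_all add: large_part)

lemma indices_Un: "S \<in> indices \<Longrightarrow> R \<in> indices \<Longrightarrow> S \<union> R \<in> indices"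
  using ksmall_Un by (auto simp: indices_def)

lemma indices_UN: "|I| <o \<kappa> \<Longrightarrow> (\<And>i. i \<in> I \<Longrightarrow> S i \<in> indices) \<Longrightarrow> (\<Union>i\<in>I. S i) \<in> indices"
  using ksmall_UN[of I S] by (auto simp: indices_def)

section \<open>Germs: the colimit of the parts, element by element\<close>

definition pairs :: "'a presheaf \<Rightarrow> ('a set \<times> 'a) set" where
  "pairs X = (SIGMA S : indices. el (part S) X)"

text \<open>Equality in the directed colimit: two elements are identified when they become equal in
  some later part. Transitivity rests on directedness, through the union of two indices.\<close>

definition germ_rel :: "'a presheaf \<Rightarrow> 'a set \<times> 'a \<Rightarrow> 'a set \<times> 'a \<Rightarrow> bool" where
  "germ_rel X = (\<lambda>(S, y) (S', y').
     \<exists>R \<in> indices. S \<subseteq> R \<and> S' \<subseteq> R \<and> inc S R X y = inc S' R X y')"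

lemma germ_relI:
  "R \<in> indices \<Longrightarrow> S \<subseteq> R \<Longrightarrow> S' \<subseteq> R \<Longrightarrow> inc S R X y = inc S' R X y' \<Longrightarrow> germ_rel X (S, y) (S', y')"
  by (auto simp: germ_rel_def)

lemma germ_rel_trans:
  assumes X: "X \<in> Obj T" and p: "p \<in> pairs X" and q: "q \<in> pairs X" and r: "r \<in> pairs X"
    and pq: "germ_rel X p q" and qr: "germ_rel X q r"
  shows "germ_rel X p r"
proof -
  obtain S x S' y S'' z where e: "p = (S, x)" "q = (S', y)" "r = (S'', z)"
    by (metis surj_pair)
  obtain R R' where R: "R \<in> indices" "S \<subseteq> R" "S' \<subseteq> R" "inc S R X x = inc S' R X y"
    and R': "R' \<in> indices" "S' \<subseteq> R'" "S'' \<subseteq> R'" "inc S' R' X y = inc S'' R' X z"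
    using pq qr by (auto simp: e germ_rel_def)
  have m: "S \<in> indices" "x \<in> el (part S) X" "S' \<in> indices" "y \<in> el (part S') X"
    "S'' \<in> indices" "z \<in> el (part S'') X" using p q r by (auto simp: e pairs_def)
  let ?Q = "R \<union> R'"
  have Q: "?Q \<in> indices" using indices_Un R R' by blast
  have "inc S ?Q X x = inc S' ?Q X y"
    using inc_inc[of S R ?Q X x] inc_inc[of S' R ?Q X y] R Q X m by simp
  also have "\<dots> = inc S'' ?Q X z"
    using inc_inc[of S' R' ?Q X y] inc_inc[of S'' R' ?Q X z] R' Q X m by simp
  finally show ?thesis using Q R R' unfolding e by (intro germ_relI[of ?Q]) auto
qed

lemma germ_rel_sym:
  assumes "germ_rel X p q"
  shows "germ_rel X q p"
proof (cases p; cases q)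
  fix S y S' y' assume e: "p = (S, y)" "q = (S', y')"
  with assms obtain R where "R \<in> indices" "S \<subseteq> R" "S' \<subseteq> R" "inc S R X y = inc S' R X y'"
    by (auto simp: germ_rel_def)
  then show ?thesis unfolding e by (intro germ_relI[of R]) simp_all
qed

lemma germ_rel_refl: "X \<in> Obj T \<Longrightarrow> p \<in> pairs X \<Longrightarrow> germ_rel X p p"
  by (auto simp: germ_rel_def pairs_def)

lemma card_pairs: "X \<in> Obj T \<Longrightarrow> |pairs X| <o |UNIV :: 'a set|"
  unfolding pairs_def
proof (rule small_Sigma)
  have "small D" using small_subset[OF D_subset] large_Y by (simp add: large_def)
  moreover have "indices \<subseteq> Pow D" by (auto simp: indices_def)
  ultimately show "|indices| <o |UNIV :: 'a set|"
    using small_Pow card_of_mono1 ordLeq_ordLess_trans by blast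
next
  fix S assume "X \<in> Obj T" "S \<in> indices"
  then show "|el (part S) X| <o |UNIV :: 'a set|"
    using set_valued.small[OF point_set_valued[OF large_part]] by (simp add: el_def small_def)
qed

text \<open>The values of a point must be subsets of the universe, so a germ is encoded there.\<close>

lemma germ_exists:
  assumes X: "X \<in> Obj T"
  shows "\<exists>c :: 'a set \<times> 'a \<Rightarrow> 'a. \<forall>p \<in> pairs X. \<forall>q \<in> pairs X. c p = c q \<longleftrightarrow> germ_rel X p q"
proof -
  obtain g :: "'a set \<times> 'a \<Rightarrow> 'a" where g: "inj_on g (pairs X)"
    using ordLess_imp_ordLeq[OF card_pairs[OF X]] card_of_ordLeq[of "pairs X" "UNIV :: 'a set"] by blast
  define rep where "rep p = (SOME q. q \<in> pairs X \<and> germ_rel X p q)" for p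
  have rep: "rep p \<in> pairs X \<and> germ_rel X p (rep p)" if "p \<in> pairs X" for p
    unfolding rep_def using someI[of "\<lambda>q. q \<in> pairs X \<and> germ_rel X p q" p] germ_rel_refl[OF X that] that
    by blast
  have "g (rep p) = g (rep q) \<longleftrightarrow> germ_rel X p q" if p: "p \<in> pairs X" and q: "q \<in> pairs X" for p q
  proof
    assume "g (rep p) = g (rep q)"
    then have "rep p = rep q" using rep[OF p] rep[OF q] g by (auto dest: inj_onD)
    then show "germ_rel X p q"
      using rep[OF p] germ_rel_sym[OF conjunct2[OF rep[OF q]]] germ_rel_trans[OF X p _ q, of "rep q"] by simp
  next
    assume pq: "germ_rel X p q"
    have "germ_rel X p r \<longleftrightarrow> germ_rel X q r" if "r \<in> pairs X" for r
      using germ_rel_trans[OF X p q that pq] germ_rel_trans[OF X q p that germ_rel_sym[OF pq]] by blast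
    \<comment> \<open>Related pairs define the same predicate, and the choice operator depends on
      the predicate only.\<close>
    then have "rep p = rep q" unfolding rep_def by (intro arg_cong[of _ _ Eps]) auto
    then show "g (rep p) = g (rep q)" by simp
  qed
  then show ?thesis by (intro exI[of _ "\<lambda>p. g (rep p)"]) blast
qed

definition germ :: "'a presheaf \<Rightarrow> 'a set \<Rightarrow> 'a \<Rightarrow> 'a" where
  "germ X = curry (SOME c. \<forall>p \<in> pairs X. \<forall>q \<in> pairs X. c p = c q \<longleftrightarrow> germ_rel X p q)"

lemma germ_eq_iff:
  assumes "X \<in> Obj T" "S \<in> indices" "y \<in> el (part S) X" "S' \<in> indices" "y' \<in> el (part S') X"
  shows "germ X S y = germ X S' y' \<longleftrightarrow>
    (\<exists>R \<in> indices. S \<subseteq> R \<and> S' \<subseteq> R \<and> inc S R X y = inc S' R X y')"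
  using someI_ex[OF germ_exists[OF assms(1)]] assms unfolding germ_def
  by (auto simp: pairs_def germ_rel_def)

lemma germ_inc:
  assumes "X \<in> Obj T" "S \<in> indices" "R \<in> indices" "S \<subseteq> R" "y \<in> el (part S) X"
  shows "germ X R (inc S R X y) = germ X S y"
  using assms inc_in[OF assms(2-4,1,5)] inc_refl[OF assms(3,1)]
  by (subst germ_eq_iff) (auto intro!: bexI[of _ R])

definition germs :: "'a presheaf \<Rightarrow> 'a set" where
  "germs X = {germ X S y | S y. S \<in> indices \<and> y \<in> el (part S) X}"

definition germ_map :: "'a presheaf_map \<Rightarrow> 'a \<Rightarrow> 'a" where
  "germ_map u a = (let (S, y) = SOME (S, y). S \<in> indices \<and> y \<in> el (part S) (Dom T u) \<and> a = germ (Dom T u) S y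
     in germ (Cod T u) S (tr (part S) u y))"

abbreviation germ_point :: "'a point" where
  "germ_point \<equiv> set_functor T germs germ_map"

lemma category_T: "category T"
  using set_valued.category[OF point_set_valued[OF large_Y]] .

text \<open>The choice made in \<open>germ_map\<close> does not matter: two representatives agree in
  a later part, and the transition maps commute with \<open>tr\<close>.\<close>

lemma germ_map_germ:
  assumes u: "u \<in> hom T X X'" and S: "S \<in> indices" and y: "y \<in> el (part S) X"
  shows "germ_map u (germ X S y) = germ X' S (tr (part S) u y)"
proof -
  have X: "X \<in> Obj T" "X' \<in> Obj T" "Dom T u = X" "Cod T u = X'"
    using u category.hom_Obj[OF category_T] by (auto simp: hom_def)
  let ?P = "\<lambda>(S', y'). S' \<in> indices \<and> y' \<in> el (part S') X \<and> germ X S y = germ X S' y'"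
  obtain S' y' where e: "Eps ?P = (S', y')" by fastforce
  have "?P (Eps ?P)" using S y by (intro someI[of ?P "(S, y)"]) simp
  then have S': "S' \<in> indices" "y' \<in> el (part S') X" "germ X S y = germ X S' y'" by (auto simp: e)
  then obtain R where R: "R \<in> indices" "S \<subseteq> R" "S' \<subseteq> R" "inc S R X y = inc S' R X y'"
    using germ_eq_iff[OF X(1) S y S'(1,2)] by blast
  have "inc S' R X' (tr (part S') u y') = inc S R X' (tr (part S) u y)"
    using inc_tr[OF S R(1,2) u y] inc_tr[OF S'(1) R(1,3) u S'(2)] R(4) by simp
  then have "germ X' S' (tr (part S') u y') = germ X' S (tr (part S) u y)"
    using germ_eq_iff[OF X(2) S'(1) tr_in[OF large_part[OF S'(1)] u S'(2)] S tr_in[OF large_part[OF S] u y]]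
      R by auto
  then show ?thesis by (simp add: germ_map_def X e)
qed

lemma germsE:
  assumes "a \<in> germs X"
  obtains S y where "S \<in> indices" "y \<in> el (part S) X" "a = germ X S y"
  using assms by (auto simp: germs_def)

lemma germ_in: "S \<in> indices \<Longrightarrow> y \<in> el (part S) X \<Longrightarrow> germ X S y \<in> germs X"
  by (auto simp: germs_def)

section \<open>The germs form a point\<close>

lemma set_valued_germ_point: "set_valued T germ_point"
proof (rule set_valued_set_functor[OF category_T])
  interpret T: category T by (rule category_T)
  show "small (germs X)" if X: "X \<in> Obj T" for X
  proof -
    have "germs X = (\<lambda>(S, y). germ X S y) ` pairs X" by (auto simp: germs_def pairs_def)
    then show ?thesis
      unfolding small_def using card_pairs[OF X] card_of_image ordLeq_ordLess_trans by metis
  qed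
  show "germ_map u a \<in> germs X'" if u: "u \<in> hom T X X'" and a: "a \<in> germs X" for u X X' a
    using a by (elim germsE) (simp add: germ_map_germ[OF u] germ_in tr_in[OF large_part u])
  show "germ_map (Idt T X) a = a" if X: "X \<in> Obj T" and a: "a \<in> germs X" for X a
    using a
  proof (elim germsE)
    fix S y assume S: "S \<in> indices" "y \<in> el (part S) X" "a = germ X S y"
    then show ?thesis
      using germ_map_germ[OF T.Idt_in[OF X] S(1,2)]
        set_valued.map_Idt[OF point_set_valued[OF large_part[OF S(1)]] X, of y]
      by (simp add: tr_def el_def)
  qed
  show "germ_map (Cmp T v u) a = germ_map v (germ_map u a)"
    if u: "u \<in> hom T X Y" and v: "v \<in> hom T Y Z" and a: "a \<in> germs X" for u v X Y Z a
    using a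
  proof (elim germsE)
    fix S y assume S: "S \<in> indices" "y \<in> el (part S) X" "a = germ X S y"
    then show ?thesis
      using germ_map_germ[OF T.Cmp_in[OF u v] S(1,2)] germ_map_germ[OF u S(1,2)]
        germ_map_germ[OF v S(1) tr_in[OF large_part[OF S(1)] u S(2)]]
        set_valued.map_Cmp[OF point_set_valued[OF large_part[OF S(1)]] u v, of y]
      by (simp add: tr_def el_def)
  qed
qed

text \<open>The commutation of \<kappa>-directed colimits with \<kappa>-small limits in sets. A
  diagram of size below \<kappa> involves fewer than \<kappa> indices, and by regularity their union
  is again an index, so everything can be compared in one part.\<close>

lemma germs_limit:
  fixes J :: "('b, 'b) cat"
  assumes J: "category J" "|Arr J| <o \<kappa>" and F: "is_functor J T F" and L: "is_limit J T F A p"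
    and x: "\<forall>j \<in> Obj J. x j \<in> germs (Fobj F j)"
    and compat: "\<forall>u \<in> Arr J. germ_map (Farr F u) (x (Dom J u)) = x (Cod J u)"
  shows "\<exists>!a. a \<in> germs A \<and> (\<forall>j \<in> Obj J. germ_map (p j) a = x j)"
proof -
  interpret J: category J by fact
  have A: "A \<in> Obj T" and p: "\<And>j. j \<in> Obj J \<Longrightarrow> p j \<in> hom T A (Fobj F j)"
    using L by (auto simp: is_limit_def is_cone_def)
  note FO = is_functor_Obj[OF F]
  have FA: "Farr F u \<in> hom T (Fobj F (Dom J u)) (Fobj F (Cod J u))" if "u \<in> Arr J" for u
    using is_functor_hom[OF F homI[OF that refl refl]] .
  note Obj_small = ksmall_Obj[OF J]
  have "\<forall>j. \<exists>S y. j \<in> Obj J \<longrightarrow> S \<in> indices \<and> y \<in> el (part S) (Fobj F j) \<and> x j = germ (Fobj F j) S y"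
    using x unfolding germs_def by blast
  then obtain S y where S: "\<And>j. j \<in> Obj J \<Longrightarrow> S j \<in> indices"
    and y: "\<And>j. j \<in> Obj J \<Longrightarrow> y j \<in> el (part (S j)) (Fobj F j)"
    and xy: "\<And>j. j \<in> Obj J \<Longrightarrow> x j = germ (Fobj F j) (S j) (y j)"
    by metis
  \<comment> \<open>A common index for representatives of all members of the family.\<close>
  define S0 where "S0 = (\<Union>j\<in>Obj J. S j)"
  have S0: "S0 \<in> indices" unfolding S0_def using indices_UN[OF Obj_small] S by blast
  have S_S0: "S j \<subseteq> S0" if "j \<in> Obj J" for j using that by (auto simp: S0_def)
  define y0 where "y0 j = inc (S j) S0 (Fobj F j) (y j)" for j
  have y0: "y0 j \<in> el (part S0) (Fobj F j)" and xy0: "x j = germ (Fobj F j) S0 (y0 j)"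
    if "j \<in> Obj J" for j
    unfolding y0_def using inc_in[OF S S0 S_S0 FO y] germ_inc[OF FO S S0 S_S0 y] xy that by auto
  have "\<exists>R \<in> indices. S0 \<subseteq> R \<and>
      inc S0 R (Fobj F (Cod J u)) (tr (part S0) (Farr F u) (y0 (Dom J u))) =
      inc S0 R (Fobj F (Cod J u)) (y0 (Cod J u))" if u: "u \<in> Arr J" for u
  proof -
    have "germ (Fobj F (Cod J u)) S0 (tr (part S0) (Farr F u) (y0 (Dom J u))) =
        germ (Fobj F (Cod J u)) S0 (y0 (Cod J u))"
      using compat u xy0 J.Dom_in J.Cod_in germ_map_germ[OF FA[OF u] S0 y0] by simp
    then show ?thesis
      using germ_eq_iff[OF FO[OF J.Cod_in[OF u]] S0 tr_in[OF large_part[OF S0] FA[OF u] y0] S0 y0]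
        J.Dom_in[OF u] J.Cod_in[OF u] by blast
  qed
  then obtain R where R: "\<And>u. u \<in> Arr J \<Longrightarrow> R u \<in> indices" "\<And>u. u \<in> Arr J \<Longrightarrow> S0 \<subseteq> R u"
    and Req: "\<And>u. u \<in> Arr J \<Longrightarrow>
      inc S0 (R u) (Fobj F (Cod J u)) (tr (part S0) (Farr F u) (y0 (Dom J u))) =
      inc S0 (R u) (Fobj F (Cod J u)) (y0 (Cod J u))"
    by metis
  \<comment> \<open>So far the representatives are compatible only up to germs. Each arrow needs a
    later index at which its equation holds on the nose; \<open>S1\<close> bounds all of
    them.\<close>
  define S1 where "S1 = S0 \<union> (\<Union>u\<in>Arr J. R u)"
  have S1: "S1 \<in> indices" unfolding S1_def using indices_Un[OF S0 indices_UN[OF J(2)]] R by blast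
  have S0_S1: "S0 \<subseteq> S1" and R_S1: "\<And>u. u \<in> Arr J \<Longrightarrow> R u \<subseteq> S1" by (auto simp: S1_def)
  define y1 where "y1 j = inc S0 S1 (Fobj F j) (y0 j)" for j
  have y1: "y1 j \<in> el (part S1) (Fobj F j)" and xy1: "x j = germ (Fobj F j) S1 (y1 j)"
    if "j \<in> Obj J" for j
    unfolding y1_def using inc_in[OF S0 S1 S0_S1 FO y0] germ_inc[OF FO S0 S1 S0_S1 y0] xy0 that by auto
  have "tr (part S1) (Farr F u) (y1 (Dom J u)) = y1 (Cod J u)" if u: "u \<in> Arr J" for u
  proof -
    note d = J.Dom_in[OF u] and c = J.Cod_in[OF u]
    have t: "tr (part S0) (Farr F u) (y0 (Dom J u)) \<in> el (part S0) (Fobj F (Cod J u))"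
      using tr_in[OF large_part[OF S0] FA[OF u] y0[OF d]] .
    have "tr (part S1) (Farr F u) (y1 (Dom J u)) =
        inc S0 S1 (Fobj F (Cod J u)) (tr (part S0) (Farr F u) (y0 (Dom J u)))"
      unfolding y1_def using inc_tr[OF S0 S1 S0_S1 FA[OF u] y0[OF d]] .
    also have "\<dots> = inc S0 S1 (Fobj F (Cod J u)) (y0 (Cod J u))"
      using inc_inc[OF S0 R(1)[OF u] S1 R(2)[OF u] R_S1[OF u] FO[OF c] t]
        inc_inc[OF S0 R(1)[OF u] S1 R(2)[OF u] R_S1[OF u] FO[OF c] y0[OF c]] Req[OF u] by simp
    finally show ?thesis by (simp add: y1_def)
  qed
  from point_limit[OF large_part[OF S1] J F L y1 this]
  obtain a where a: "a \<in> el (part S1) A" "\<And>j. j \<in> Obj J \<Longrightarrow> tr (part S1) (p j) a = y1 j" by auto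
  show ?thesis
  proof (rule ex1I)
    show "germ A S1 a \<in> germs A \<and> (\<forall>j \<in> Obj J. germ_map (p j) (germ A S1 a) = x j)"
      using a germ_in[OF S1] germ_map_germ[OF p S1 a(1)] xy1 by simp
  next
    fix b assume b: "b \<in> germs A \<and> (\<forall>j \<in> Obj J. germ_map (p j) b = x j)"
    then obtain Q z where Q: "Q \<in> indices" and z: "z \<in> el (part Q) A" and bz: "b = germ A Q z"
      by (auto elim: germsE)
    define V where "V = S1 \<union> Q"
    have V: "V \<in> indices" "S1 \<subseteq> V" "Q \<subseteq> V" using indices_Un[OF S1 Q] by (auto simp: V_def)
    let ?a = "inc S1 V A a" and ?z = "inc Q V A z"
    have a': "?a \<in> el (part V) A" and z': "?z \<in> el (part V) A"
      using inc_in[OF S1 V(1,2) A a(1)] inc_in[OF Q V(1,3) A z] by auto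
    have ta: "tr (part V) (p j) ?a \<in> el (part V) (Fobj F j)"
      "tr (part V) (p j) ?z \<in> el (part V) (Fobj F j)" if "j \<in> Obj J" for j
      using tr_in[OF large_part[OF V(1)] p[OF that]] a' z' by auto
    have "\<exists>R \<in> indices. V \<subseteq> R \<and> inc V R (Fobj F j) (tr (part V) (p j) ?a) =
        inc V R (Fobj F j) (tr (part V) (p j) ?z)" if j: "j \<in> Obj J" for j
    proof -
      have "germ (Fobj F j) V (tr (part V) (p j) ?a) = germ_map (p j) (germ A S1 a)"
        using germ_map_germ[OF p[OF j] V(1) a'] germ_inc[OF A S1 V(1,2) a(1)] by simp
      also have "\<dots> = germ_map (p j) (germ A Q z)"
        using b bz a(2)[OF j] germ_map_germ[OF p[OF j] S1 a(1)] xy1[OF j] j by simp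
      also have "\<dots> = germ (Fobj F j) V (tr (part V) (p j) ?z)"
        using germ_map_germ[OF p[OF j] V(1) z'] germ_inc[OF A Q V(1,3) z] by simp
      finally show ?thesis
        using germ_eq_iff[OF FO[OF j] V(1) ta(1)[OF j] V(1) ta(2)[OF j]] by blast
    qed
    then obtain R where R: "\<And>j. j \<in> Obj J \<Longrightarrow> R j \<in> indices" "\<And>j. j \<in> Obj J \<Longrightarrow> V \<subseteq> R j"
      and Req: "\<And>j. j \<in> Obj J \<Longrightarrow> inc V (R j) (Fobj F j) (tr (part V) (p j) ?a) =
        inc V (R j) (Fobj F j) (tr (part V) (p j) ?z)"
      by metis
    \<comment> \<open>The same device for uniqueness: in the part of \<open>W\<close> the
      projections of the two candidates are equal, not merely their germs.\<close>
    define W where "W = V \<union> (\<Union>j\<in>Obj J. R j)"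
    have W: "W \<in> indices" unfolding W_def using indices_Un[OF V(1) indices_UN[OF Obj_small]] R by blast
    have V_W: "V \<subseteq> W" and R_W: "\<And>j. j \<in> Obj J \<Longrightarrow> R j \<subseteq> W" by (auto simp: W_def)
    have eq: "tr (part W) (p j) (inc V W A ?z) = tr (part W) (p j) (inc V W A ?a)" if j: "j \<in> Obj J" for j
      using inc_tr[OF V(1) W V_W p[OF j] a'] inc_tr[OF V(1) W V_W p[OF j] z'] Req[OF j]
        inc_inc[OF V(1) R(1)[OF j] W R(2)[OF j] R_W[OF j] FO[OF j] ta(1)[OF j]]
        inc_inc[OF V(1) R(1)[OF j] W R(2)[OF j] R_W[OF j] FO[OF j] ta(2)[OF j]] by simp
    have aW: "inc V W A ?a \<in> el (part W) A" and zW: "inc V W A ?z \<in> el (part W) A"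
      using inc_in[OF V(1) W V_W A] a' z' by auto
    have "inc V W A ?z = inc V W A ?a"
      using point_limit_eq[OF large_part[OF W] J F L zW aW eq] .
    then have "germ A V ?z = germ A V ?a"
      using germ_eq_iff[OF A V(1) z' V(1) a'] W V_W by blast
    then show "b = germ A S1 a"
      using germ_inc[OF A S1 V(1,2) a(1)] germ_inc[OF A Q V(1,3) z] bz by simp
  qed
qed

text \<open>Colimits commute with colimits: joint surjectivity concerns one germ and identification
  two, so each can be checked in a single part, which is a point already.\<close>

lemma germ_point: "is_kappa_point \<kappa> T germ_point"
proof (rule is_kappa_point_set_functorI[OF infinite_UNIV set_valued_germ_point germs_limit])
  fix J :: "('a, 'a) cat" and F A p a
  assume J: "category J" "|Arr J| <o |UNIV :: 'a set|" and F: "is_functor J T F"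
    and L: "is_colimit J T F A p" and a: "a \<in> germs A"
  have p: "\<And>j. j \<in> Obj J \<Longrightarrow> p j \<in> hom T (Fobj F j) A"
    using L by (auto simp: is_colimit_def is_cocone_def)
  obtain S y where S: "S \<in> indices" "y \<in> el (part S) A" "a = germ A S y" using a by (rule germsE)
  obtain j x where "j \<in> Obj J" "x \<in> el (part S) (Fobj F j)" "tr (part S) (p j) x = y"
    using point_colimit_surj[OF large_part[OF S(1)] J F L S(2)] .
  then show "\<exists>j \<in> Obj J. \<exists>x \<in> germs (Fobj F j). germ_map (p j) x = a"
    using germ_in[OF S(1)] germ_map_germ[OF p S(1)] S(3) by blast
next
  fix J :: "('a, 'a) cat" and F A p and c :: "'a \<Rightarrow> 'a \<Rightarrow> bool" and j k x y
  assume J: "category J" "|Arr J| <o |UNIV :: 'a set|" and F: "is_functor J T F"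
    and L: "is_colimit J T F A p"
    and c: "\<forall>u \<in> Arr J. \<forall>x \<in> germs (Fobj F (Dom J u)). c (Cod J u) (germ_map (Farr F u) x) = c (Dom J u) x"
    and jk: "j \<in> Obj J" "k \<in> Obj J" and xy: "x \<in> germs (Fobj F j)" "y \<in> germs (Fobj F k)"
    and eq: "germ_map (p j) x = germ_map (p k) y"
  interpret J: category J by fact
  have A: "A \<in> Obj T" and p: "\<And>j. j \<in> Obj J \<Longrightarrow> p j \<in> hom T (Fobj F j) A"
    using L by (auto simp: is_colimit_def is_cocone_def)
  note FO = is_functor_Obj[OF F]
  obtain S v where S: "S \<in> indices" "v \<in> el (part S) (Fobj F j)" "x = germ (Fobj F j) S v"
    using xy(1) by (rule germsE)
  obtain S' w where S': "S' \<in> indices" "w \<in> el (part S') (Fobj F k)" "y = germ (Fobj F k) S' w"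
    using xy(2) by (rule germsE)
  have "germ A S (tr (part S) (p j) v) = germ A S' (tr (part S') (p k) w)"
    using eq germ_map_germ[OF p[OF jk(1)] S(1,2)] germ_map_germ[OF p[OF jk(2)] S'(1,2)] S(3) S'(3)
    by simp
  then obtain R where R: "R \<in> indices" "S \<subseteq> R" "S' \<subseteq> R"
    "inc S R A (tr (part S) (p j) v) = inc S' R A (tr (part S') (p k) w)"
    using germ_eq_iff[OF A S(1) tr_in[OF large_part[OF S(1)] p[OF jk(1)] S(2)]
        S'(1) tr_in[OF large_part[OF S'(1)] p[OF jk(2)] S'(2)]] by blast
  let ?v = "inc S R (Fobj F j) v" and ?w = "inc S' R (Fobj F k) w"
  have vw: "?v \<in> el (part R) (Fobj F j)" "?w \<in> el (part R) (Fobj F k)"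
    using inc_in[OF S(1) R(1,2) FO[OF jk(1)] S(2)] inc_in[OF S'(1) R(1,3) FO[OF jk(2)] S'(2)] by auto
  have e: "tr (part R) (p j) ?v = tr (part R) (p k) ?w"
    using inc_tr[OF S(1) R(1,2) p[OF jk(1)] S(2)] inc_tr[OF S'(1) R(1,3) p[OF jk(2)] S'(2)] R(4) by simp
  \<comment> \<open>Pulled back along the germ map of the part of \<open>R\<close>, \<open>c\<close>
    becomes a class predicate for that part, where the two images agree.\<close>
  have "c j (germ (Fobj F j) R ?v) = c k (germ (Fobj F k) R ?w)"
  proof (rule point_colimit_eq[OF large_part[OF R(1)] J F L _ jk vw e,
        where c = "\<lambda>j z. c j (germ (Fobj F j) R z)"])
    fix u z assume u: "u \<in> Arr J" and z: "z \<in> el (part R) (Fobj F (Dom J u))"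
    show "c (Cod J u) (germ (Fobj F (Cod J u)) R (tr (part R) (Farr F u) z)) =
        c (Dom J u) (germ (Fobj F (Dom J u)) R z)"
      using c u germ_in[OF R(1) z] germ_map_germ[OF is_functor_hom[OF F homI[OF u refl refl]] R(1) z]
      by metis
  qed
  then show "c j x = c k y"
    using germ_inc[OF FO[OF jk(1)] S(1) R(1,2) S(2)] germ_inc[OF FO[OF jk(2)] S'(1) R(1,3) S'(2)] S(3) S'(3)
    by simp
qed

section \<open>Comparison of the point of germs with the point of \<open>Y\<close>\<close>

lemma germ_natural: "S \<in> indices \<Longrightarrow> natural_family T (Fobj \<Phi> (part S)) germ_point (\<lambda>X. germ X S)"
  unfolding natural_family_def
proof (intro conjI ballI allI impI)
  interpret T: category T by (rule category_T)
  fix X y assume "S \<in> indices" "X \<in> Obj T" "y \<in> Fobj (Fobj \<Phi> (part S)) X"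
  then show "germ X S y \<in> Fobj germ_point X" using germ_in by (simp add: el_def)
next
  fix u X X' y assume "S \<in> indices" "u \<in> hom T X X'" "y \<in> Fobj (Fobj \<Phi> (part S)) X"
  then show "Smap (Farr germ_point u) (germ X S y) = germ X' S (Smap (Farr (Fobj \<Phi> (part S)) u) y)"
    using germ_in[of S y X] germ_map_germ[of u X X' S y] by (simp add: el_def tr_def)
qed

lemma to_Y_well_defined:
  assumes X: "X \<in> Obj T" and a: "a \<in> germs X"
  shows "\<exists>!x. \<forall>S \<in> indices. \<forall>y \<in> el (part S) X. a = germ X S y \<longrightarrow> act (part S) Y (\<lambda>y. y) X y = x"
proof -
  obtain S y where S: "S \<in> indices" "y \<in> el (part S) X" "a = germ X S y" using a by (rule germsE)
  have up: "act (part R) Y (\<lambda>y. y) X (inc Q R X z) = act (part Q) Y (\<lambda>y. y) X z"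
    if "Q \<in> indices" "R \<in> indices" "Q \<subseteq> R" "z \<in> el (part Q) X" for Q R z
    unfolding inc_def using that X part_mono[OF that(3)] part_subset[OF that(2)] large_Y
    by (subst act_act) (simp_all add: large_part)
  have "act (part S') Y (\<lambda>y. y) X y' = act (part S) Y (\<lambda>y. y) X y"
    if S': "S' \<in> indices" "y' \<in> el (part S') X" "a = germ X S' y'" for S' y'
  proof -
    obtain R where R: "R \<in> indices" "S \<subseteq> R" "S' \<subseteq> R" "inc S R X y = inc S' R X y'"
      using germ_eq_iff[OF X S(1,2) S'(1,2)] S(3) S'(3) by auto
    then show ?thesis using up[OF S(1) R(1,2) S(2)] up[OF S'(1) R(1,3) S'(2)] by simp
  qed
  then show ?thesis using S by (intro ex1I[of _ "act (part S) Y (\<lambda>y. y) X y"]) blast+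
qed

text \<open>The map out of the colimit that is induced by the inclusions of the parts into
  \<open>Y\<close>.\<close>

definition to_Y :: "'a presheaf \<Rightarrow> 'a \<Rightarrow> 'a" where
  "to_Y X a = (THE x. \<forall>S \<in> indices. \<forall>y \<in> el (part S) X. a = germ X S y \<longrightarrow>
     act (part S) Y (\<lambda>y. y) X y = x)"

lemma to_Y_germ:
  assumes "X \<in> Obj T" "S \<in> indices" "y \<in> el (part S) X"
  shows "to_Y X (germ X S y) = act (part S) Y (\<lambda>y. y) X y"
  using theI'[OF to_Y_well_defined[OF assms(1) germ_in[OF assms(2,3)]]] assms
  unfolding to_Y_def by auto

lemma to_Y_natural: "natural_family T germ_point (Fobj \<Phi> Y) to_Y"
  unfolding natural_family_def
proof (intro conjI ballI allI impI)
  interpret T: category T by (rule category_T)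
  have act: "natural_family T (Fobj \<Phi> (part S)) (Fobj \<Phi> Y) (act (part S) Y (\<lambda>y. y))"
    if "S \<in> indices" for S
    using that large_Y part_subset[OF that] by (intro act_natural) (simp_all add: large_part)
  show "to_Y X a \<in> Fobj (Fobj \<Phi> Y) X" if X: "X \<in> Obj T" and "a \<in> Fobj germ_point X" for X a
  proof -
    have "a \<in> germs X" using that by simp
    then obtain S y where "S \<in> indices" "y \<in> el (part S) X" "a = germ X S y" by (rule germsE)
    then show ?thesis using to_Y_germ[OF X] natural_familyD(1)[OF act X] by (simp add: el_def)
  qed
  show "Smap (Farr (Fobj \<Phi> Y) u) (to_Y X a) = to_Y X' (Smap (Farr germ_point u) a)"
    if u: "u \<in> hom T X X'" and a: "a \<in> Fobj germ_point X" for u X X' a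
  proof -
    have X: "X \<in> Obj T" "X' \<in> Obj T" using T.hom_Obj[OF u] by auto
    have a': "a \<in> germs X" using a X by simp
    then obtain S y where S: "S \<in> indices" "y \<in> el (part S) X" "a = germ X S y" by (rule germsE)
    have t: "tr (part S) u y \<in> el (part S) X'" using tr_in[OF large_part[OF S(1)] u S(2)] .
    show ?thesis
      using natural_familyD(2)[OF act[OF S(1)] u, of y] S t to_Y_germ[OF X(1) S(1,2)] to_Y_germ[OF X(2) S(1) t]
        germ_map_germ[OF u S(1,2)] u a' by (simp add: el_def tr_def)
  qed
qed

text \<open>
  The colimit of the parts is again represented by a large set \<open>E\<close>, and the injections of the parts
  into \<open>E\<close> glue to a section of the comparison map \<open>to_Y\<close>.
\<close>

lemma el_from_part:
  assumes X: "X \<in> Obj T" and x: "x \<in> el Y X"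
  shows "\<exists>S \<in> indices. \<exists>y \<in> el (part S) X. act (part S) Y (\<lambda>y. y) X y = x"
proof -
  interpret T: category T by (rule category_T)
  obtain E s t where E: "large E"
    and s: "natural_family T (Fobj \<Phi> E) germ_point s" and t: "natural_family T germ_point (Fobj \<Phi> E) t"
    and st: "\<forall>X \<in> Obj T. \<forall>x \<in> Fobj germ_point X. s X (t X x) = x"
    by (rule act_essentially_surjective[OF germ_point])
  have "\<exists>e. inj_on e (part S) \<and> e ` part S \<subseteq> E \<and>
      (\<forall>X \<in> Obj T. \<forall>y \<in> el (part S) X. t X (germ X S y) = act (part S) E e X y)"
    if S: "S \<in> indices" for S
    using act_full[OF large_part[OF S] E natural_family_comp[OF category_T germ_natural[OF S] t]]
    by metis
  then obtain e where e: "\<And>S. S \<in> indices \<Longrightarrow> inj_on (e S) (part S)"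
      "\<And>S. S \<in> indices \<Longrightarrow> e S ` part S \<subseteq> E"
    and e_act: "\<And>S X y. S \<in> indices \<Longrightarrow> X \<in> Obj T \<Longrightarrow> y \<in> el (part S) X \<Longrightarrow>
      t X (germ X S y) = act (part S) E (e S) X y"
    by metis
  \<comment> \<open>Both maps represent the same transformation, since an element and its image in a
    later part have the same germ. Faithfulness turns this into equality of functions.\<close>
  have e_mono: "e R z = e S z" if S: "S \<in> indices" and R: "R \<in> indices" "S \<subseteq> R" and z: "z \<in> part S" for S R z
  proof (rule act_faithful[OF large_part[OF S] E _ _ e[OF S] _ z])
    have sub: "part S \<subseteq> part R" using part_mono[OF R(2)] by simp
    show "inj_on (e R) (part S)" "e R ` part S \<subseteq> E" using e[OF R(1)] sub inj_on_subset by blast+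
    fix X y assume X: "X \<in> Obj T" and y: "y \<in> el (part S) X"
    have "act (part S) E (e R) X y = act (part R) E (e R) X (inc S R X y)"
      unfolding inc_def using large_part[OF S] large_part[OF R(1)] E e[OF R(1)] sub X y
      by (subst act_act) simp_all
    also have "\<dots> = act (part S) E (e S) X y"
      using e_act[OF S X y] e_act[OF R(1) X inc_in[OF S R X y]] germ_inc[OF X S R y] by simp
    finally show "act (part S) E (e R) X y = act (part S) E (e S) X y" .
  qed
  \<comment> \<open>\<open>{z} \<inter> D\<close> is the least index whose part contains a given
    \<open>z\<close> of \<open>Y\<close>; it is empty for \<open>z\<close> outside \<open>D\<close>.
    Compatibility of the maps \<open>e S\<close> makes any other such index give the same
    value.\<close>
  define h where "h z = e ({z} \<inter> D) z" for z
  have fin: "F \<inter> D \<in> indices" if "finite F" for F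
    using that ksmall_finite[of "F \<inter> D"] by (simp add: indices_def)
  have h_e: "h z = e S z" if "S \<in> indices" "z \<in> part S" for S z
  proof -
    have "z \<in> Y" using part_subset[OF that(1)] that(2) by auto
    then have "{z} \<inter> D \<subseteq> S" "z \<in> part ({z} \<inter> D)" using that(2) by (auto simp: part_def)
    then show ?thesis unfolding h_def using e_mono[OF fin[of "{z}"] that(1)] by simp
  qed
  have h_in: "h ` Y \<subseteq> E"
  proof
    fix w assume "w \<in> h ` Y"
    then obtain z where z: "z \<in> Y" "w = h z" by blast
    then have "z \<in> part ({z} \<inter> D)" by (auto simp: part_def)
    then show "w \<in> E" using e(2)[OF fin[of "{z}"]] z by (auto simp: h_def)
  qed
  have h_inj: "inj_on h Y"
  proof (rule inj_onI)
    fix z w assume zw: "z \<in> Y" "w \<in> Y" "h z = h w"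
    then have "z \<in> part ({z, w} \<inter> D)" "w \<in> part ({z, w} \<inter> D)" by (auto simp: part_def)
    then show "z = w"
      using e(1)[OF fin[of "{z, w}"]] h_e[OF fin[of "{z, w}"]] zw(3) by (auto dest: inj_onD)
  qed
  \<comment> \<open>Fullness realises the comparison map, transported to \<open>E\<close>, by an
    injection \<open>k\<close>.\<close>
  obtain k where k: "inj_on k E" "k ` E \<subseteq> Y"
    and "\<forall>X \<in> Obj T. \<forall>x \<in> el E X. to_Y X (s X x) = act E Y k X x"
    using act_full[OF E large_Y natural_family_comp[OF category_T s to_Y_natural]] .
  then have k_act: "\<And>X x. X \<in> Obj T \<Longrightarrow> x \<in> el E X \<Longrightarrow> to_Y X (s X x) = act E Y k X x" by blast
  have kh: "k (h z) = z" if z: "z \<in> Y" for z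
  proof -
    define S where "S = {z} \<inter> D"
    have S: "S \<in> indices" "z \<in> part S" using fin[of "{z}"] z by (auto simp: S_def part_def)
    \<comment> \<open>On the part of \<open>S\<close>, going to \<open>E\<close> and on to
      \<open>Y\<close> induces the same action as the inclusion, because \<open>s\<close> undoes
      \<open>t\<close>; faithfulness applies.\<close>
    have "k (e S z) = z"
    proof (rule act_faithful[OF large_part[OF S(1)] large_Y _ _ _ part_subset[OF S(1)] _ S(2), where f = "\<lambda>z. k (e S z)"])
      show "inj_on (\<lambda>z. k (e S z)) (part S)"
        using comp_inj_on[OF e(1)[OF S(1)] inj_on_subset[OF k(1) e(2)[OF S(1)]]] by (simp add: comp_def)
      show "(\<lambda>z. k (e S z)) ` part S \<subseteq> Y" using e(2)[OF S(1)] k(2) by blast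
      fix X y assume X: "X \<in> Obj T" and y: "y \<in> el (part S) X"
      have "act (part S) Y (\<lambda>z. k (e S z)) X y = act E Y k X (act (part S) E (e S) X y)"
        using act_act[OF large_part[OF S(1)] E large_Y e[OF S(1)] k X y] by simp
      also have "\<dots> = to_Y X (s X (t X (germ X S y)))"
        using e_act[OF S(1) X y] k_act[OF X] act_in[OF large_part[OF S(1)] E e[OF S(1)] X y] by simp
      also have "\<dots> = act (part S) Y (\<lambda>y. y) X y"
        using st germ_in[OF S(1) y] X to_Y_germ[OF X S(1) y] by simp
      finally show "act (part S) Y (\<lambda>z. k (e S z)) X y = act (part S) Y (\<lambda>y. y) X y" .
    qed simp
    then show ?thesis using h_e[OF S] by simp
  qed
  \<comment> \<open>Sent to \<open>E\<close> along \<open>h\<close> and then to the germs,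
    \<open>x\<close> becomes the germ of an element of some part. That element maps to
    \<open>x\<close> because \<open>k\<close> undoes \<open>h\<close>.\<close>
  have hx: "act Y E h X x \<in> el E X" using act_in[OF large_Y E h_inj h_in X x] .
  have "s X (act Y E h X x) \<in> germs X"
    using natural_familyD(1)[OF s X] hx X by (simp add: el_def)
  then obtain S y where S: "S \<in> indices" "y \<in> el (part S) X" "s X (act Y E h X x) = germ X S y"
    by (rule germsE)
  have "act (part S) Y (\<lambda>y. y) X y = to_Y X (s X (act Y E h X x))"
    using to_Y_germ[OF X S(1,2)] S(3) by simp
  also have "\<dots> = act E Y k X (act Y E h X x)" using k_act[OF X hx] .
  also have "\<dots> = act Y Y (\<lambda>y. k (h y)) X x"
    using act_act[OF large_Y E large_Y h_inj h_in k X x] .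
  also have "\<dots> = act Y Y (\<lambda>y. y) X x" using act_cong[of Y "\<lambda>y. k (h y)" "\<lambda>y. y" Y] kh by simp
  also have "\<dots> = x" using act_ident[OF large_Y X x] .
  finally show ?thesis using S by blast
qed

end

section \<open>Supports\<close>

lemma card_Diff_ge:
  assumes "infinite A" "|S| <o |A|"
  shows "|A| \<le>o |A - S|"
proof (rule ccontr)
  assume "\<not> ?thesis"
  then have "|A - S| <o |A|" by (simp add: not_ordLeq_iff_ordLess card_of_Well_order)
  then have "|(A - S) \<union> S| <o |A|" using card_of_Un_ordLess_infinite assms by blast
  moreover have "|A| \<le>o |(A - S) \<union> S|" by (rule card_of_mono1) blast
  ultimately show False using not_ordLess_ordLeq by blast
qed

abbreviation self_injection :: "'a set \<Rightarrow> ('a \<Rightarrow> 'a) \<Rightarrow> bool" where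
  "self_injection B f \<equiv> inj_on f B \<and> f ` B \<subseteq> B"

context mono_representation
begin

lemma el_directed_union:
  assumes Y: "large Y" and D: "D \<subseteq> Y" "large (Y - D)" and x: "X \<in> Obj T" "x \<in> el Y X"
  obtains S y where "S \<subseteq> D" "|S| <o \<kappa>" "large (Y - D \<union> S)" "y \<in> el (Y - D \<union> S) X"
    "act (Y - D \<union> S) Y (\<lambda>y. y) X y = x"
proof -
  interpret directed_union T \<kappa> lam \<Phi> Y D by unfold_locales (use Y D in auto)
  show thesis using el_from_part[OF x] that large_part unfolding indices_def part_def by blast
qed

section \<open>Room inside a large set\<close>

text \<open>A large set absorbs the product with the natural numbers, so it has countably many
  self-injections with disjoint images. One image will serve as \<open>D\<close>, another witnesses
  that the complement of \<open>D\<close> is large.\<close>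

lemma disjoint_copies:
  assumes B: "large B"
  obtains i :: "nat \<Rightarrow> 'v \<Rightarrow> 'v" where
    "\<forall>n. \<forall>b \<in> B. i n b \<in> B"
    "\<forall>m n. \<forall>b \<in> B. \<forall>c \<in> B. i m b = i n c \<longleftrightarrow> m = n \<and> b = c"
proof -
  have "|UNIV :: nat set| \<le>o |B|"
    using infinite_large[OF B] infinite_iff_card_of_nat by blast
  then have "|B \<times> (UNIV :: nat set)| \<le>o |B|"
    using card_of_Times_infinite[OF infinite_large[OF B], of "UNIV :: nat set"] ordIso_iff_ordLeq by blast
  then obtain g where g: "inj_on g (B \<times> (UNIV :: nat set))" "g ` (B \<times> UNIV) \<subseteq> B"
    unfolding card_of_ordLeq[symmetric] by blast
  show thesis
  proof (rule that[of "\<lambda>n b. g (b, n)"])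
    show "\<forall>n. \<forall>b \<in> B. g (b, n) \<in> B" using g(2) by blast
    show "\<forall>m n. \<forall>b \<in> B. \<forall>c \<in> B. g (b, m) = g (c, n) \<longleftrightarrow> m = n \<and> b = c"
      using inj_on_eq_iff[OF g(1)] by auto
  qed
qed

lemma large_image:
  assumes "large B" "self_injection B f"
  shows "large (f ` B)"
proof -
  have "|B| \<le>o |f ` B|" using assms(2) card_of_ordLeq[of B "f ` B"] by blast
  then show ?thesis
    using assms small_subset[of "f ` B" B] ordLeq_transitive by (auto simp: large_def)
qed

text \<open>An element coming from \<open>U\<close> is acted on by \<open>f\<close> through the
  restriction of \<open>f\<close> to \<open>U\<close> alone, by functoriality.\<close>

lemma act_eq_on:
  assumes B: "large B" and U: "large U" "U \<subseteq> B" and x: "X \<in> Obj T" "x \<in> el U X"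
    and f: "self_injection B f" and g: "self_injection B g" and eq: "\<And>b. b \<in> U \<Longrightarrow> f b = g b"
  shows "act B B f X (act U B (\<lambda>b. b) X x) = act B B g X (act U B (\<lambda>b. b) X x)"
  using act_act[OF U(1) B B _ _ _ _ x, of "\<lambda>b. b" f] act_act[OF U(1) B B _ _ _ _ x, of "\<lambda>b. b" g]
    f g U(2) act_cong[of U f g B] eq by simp

text \<open>
  Elements of \<open>el B X\<close> come from a subset \<open>U\<close> whose complement is as large as \<open>B\<close>, so that \<open>f\<close> has a left
  inverse on \<open>U\<close> which extends to all of \<open>B\<close>.
\<close>

lemma act_inj:
  assumes B: "large B" and f: "self_injection B f" and X: "X \<in> Obj T"
    and x: "x \<in> el B X" and y: "y \<in> el B X" and eq: "act B B f X x = act B B f X y"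
  shows "x = y"
proof -
  obtain i :: "nat \<Rightarrow> 'v \<Rightarrow> 'v" where i: "\<forall>n. \<forall>b \<in> B. i n b \<in> B"
    "\<forall>m n. \<forall>b \<in> B. \<forall>c \<in> B. i m b = i n c \<longleftrightarrow> m = n \<and> b = c"
    using disjoint_copies[OF B] .
  have inj: "self_injection B (i n)" for n using i by (auto simp: inj_on_def)
  define D where "D = i 1 ` B"
  have D: "D \<subseteq> B" "large D" unfolding D_def using inj large_image[OF B] by auto
  have "i 0 ` B \<subseteq> B - D" using i by (auto simp: D_def)
  then have BD: "large (B - D)"
    using large_superset[OF large_image[OF B inj]] small_subset[of "B - D" B] B
    by (auto simp: large_def)
  obtain S x' where S: "S \<subseteq> D" "|S| <o \<kappa>" "large (B - D \<union> S)" "x' \<in> el (B - D \<union> S) X"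
    "act (B - D \<union> S) B (\<lambda>y. y) X x' = x"
    using el_directed_union[OF B D(1) BD X x] .
  obtain R y' where R: "R \<subseteq> D" "|R| <o \<kappa>" "large (B - D \<union> R)" "y' \<in> el (B - D \<union> R) X"
    "act (B - D \<union> R) B (\<lambda>y. y) X y' = y"
    using el_directed_union[OF B D(1) BD X y] .
  \<comment> \<open>Both elements come from inside this set. Its complement is \<open>D\<close>
    without fewer than \<kappa> elements, hence still as large as \<open>B\<close>.\<close>
  define U where "U = B - D \<union> (S \<union> R)"
  have U: "U \<subseteq> B" using S(1) R(1) D(1) by (auto simp: U_def)
  have "|B| \<le>o |B - U|"
  proof -
    have "|B| \<le>o |D|" using inj[of 1] card_of_ordLeq[of B D] by (auto simp: D_def)
    also have "|D| \<le>o |D - (S \<union> R)|"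
      using card_Diff_ge[OF infinite_large[OF D(2)] ksmall_less_large[OF D(2) ksmall_Un[OF S(2) R(2)]]] .
    also have "D - (S \<union> R) = B - U" using D(1) by (auto simp: U_def)
    finally show ?thesis .
  qed
  then have "|B - f ` U| \<le>o |B - U|" using card_of_mono1[of "B - f ` U" B] ordLeq_transitive by blast
  \<comment> \<open>The points missed by \<open>f\<close> on \<open>U\<close> are sent outside
    \<open>U\<close>, where they cannot collide with values of the inverse of \<open>f\<close> on
    \<open>U\<close>.\<close>
  then obtain j where j: "inj_on j (B - f ` U)" "j ` (B - f ` U) \<subseteq> B - U"
    unfolding card_of_ordLeq[symmetric] by blast
  define k where "k b = (if b \<in> f ` U then inv_into U f b else j b)" for b
  have fU: "inj_on f U" using f U inj_on_subset by blast
  have kf: "k (f b) = b" if "b \<in> U" for b using that fU by (simp add: k_def)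
  have kB: "k b \<in> B - U" if "b \<in> B" "b \<notin> f ` U" for b using that j(2) by (auto simp: k_def)
  have "self_injection B k"
  proof
    show "k ` B \<subseteq> B"
    proof (rule image_subsetI)
      show "k b \<in> B" if "b \<in> B" for b using kf kB[OF that] U by (cases "b \<in> f ` U") auto
    qed
    show "inj_on k B"
    proof (rule inj_onI)
      fix a b assume ab: "a \<in> B" "b \<in> B" "k a = k b"
      consider "a \<in> f ` U" "b \<in> f ` U" | "a \<notin> f ` U" "b \<notin> f ` U"
        | "a \<in> f ` U" "b \<notin> f ` U" | "a \<notin> f ` U" "b \<in> f ` U" by blast
      then show "a = b"
      proof cases
        case 1 then show ?thesis using kf ab(3) by auto
      next
        case 2 then show ?thesis using j(1) ab by (auto simp: k_def dest: inj_onD)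
      next
        case 3 then show ?thesis using kf kB[OF ab(2)] ab(3) by auto
      next
        case 4 then show ?thesis using kf kB[OF ab(1)] ab(3) by auto
      qed
    qed
  qed
  note k = this
  \<comment> \<open>The composite of \<open>f\<close> and \<open>k\<close> need not be the identity
    on \<open>B\<close>, but it is on \<open>U\<close>, and elements coming from inside
    \<open>U\<close> see nothing else.\<close>
  have retract: "act B B k X (act B B f X z) = z"
    if Q: "Q \<subseteq> U" "large Q" "z' \<in> el Q X" "act Q B (\<lambda>y. y) X z' = z" for Q z z'
  proof -
    have z: "z \<in> el B X" using act_in[OF Q(2) B _ _ X Q(3), of "\<lambda>y. y"] Q U by auto
    have "act B B k X (act B B f X z) = act B B (\<lambda>b. k (f b)) X z"
      using act_act[OF B B B conjunct1[OF f] conjunct2[OF f] conjunct1[OF k] conjunct2[OF k] X z] .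
    also have "\<dots> = act B B (\<lambda>b. b) X z"
    proof -
      have "self_injection B (\<lambda>b. k (f b))"
        using f k comp_inj_on[of f B k] inj_on_subset[of k B "f ` B"] by (auto simp: comp_def)
      then show ?thesis
        using act_eq_on[OF B Q(2) _ X Q(3), of "\<lambda>b. k (f b)" "\<lambda>b. b"] Q U kf by auto
    qed
    finally show ?thesis using act_ident[OF B X z] by simp
  qed
  have sub: "B - D \<union> S \<subseteq> U" "B - D \<union> R \<subseteq> U" by (auto simp: U_def)
  have "x = act B B k X (act B B f X x)" by (rule retract[OF sub(1) S(3-5), symmetric])
  also have "\<dots> = act B B k X (act B B f X y)" by (rule arg_cong[OF eq])
  also have "\<dots> = y" by (rule retract[OF sub(2) R(3-5)])
  finally show ?thesis .
qed

text \<open>The notion of support known from permutation models and nominal sets, formulated with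
  self-injections of \<open>B\<close> in place of permutations.\<close>

definition supports :: "'v set \<Rightarrow> 'v set \<Rightarrow> 'v presheaf \<Rightarrow> 'v \<Rightarrow> bool" where
  "supports B S X x \<longleftrightarrow> S \<subseteq> B \<and>
     (\<forall>f g. self_injection B f \<and> self_injection B g \<and> (\<forall>b \<in> S. f b = g b) \<longrightarrow>
       act B B f X x = act B B g X x)"

text \<open>
  If \<open>x\<close> comes from both \<open>U\<close> and \<open>V\<close>, it is supported by \<open>U \<inter> V\<close>: after making room, an injection can be
  changed first outside \<open>U\<close> and then outside \<open>V\<close>.  Taking \<open>U\<close> and \<open>V\<close> to be the complement of \<open>D\<close> and \<open>D\<close>
  itself, each enlarged by fewer than \<open>\<kappa>\<close> elements, makes \<open>U \<inter> V\<close> small.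
\<close>

lemma support_exists:
  assumes B: "large B" and X: "X \<in> Obj T" and x: "x \<in> el B X"
  obtains S where "|S| <o \<kappa>" "supports B S X x"
proof -
  obtain i :: "nat \<Rightarrow> 'v \<Rightarrow> 'v" where i: "\<forall>n. \<forall>b \<in> B. i n b \<in> B"
    "\<forall>m n. \<forall>b \<in> B. \<forall>c \<in> B. i m b = i n c \<longleftrightarrow> m = n \<and> b = c"
    using disjoint_copies[OF B] .
  have inj: "self_injection B (i n)" for n using i by (auto simp: inj_on_def)
  define D where "D = i 1 ` B"
  have D: "D \<subseteq> B" "large D" unfolding D_def using inj large_image[OF B] by auto
  have "i 0 ` B \<subseteq> B - D" using i by (auto simp: D_def)
  then have BD: "large (B - D)"
    using large_superset[OF large_image[OF B inj]] small_subset[of "B - D" B] B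
    by (auto simp: large_def)
  obtain S x1 where S: "S \<subseteq> D" "|S| <o \<kappa>" "large (B - D \<union> S)" "x1 \<in> el (B - D \<union> S) X"
    "act (B - D \<union> S) B (\<lambda>y. y) X x1 = x"
    using el_directed_union[OF B D(1) BD X x] .
  have BBD: "B - (B - D) = D" using D(1) by auto
  obtain R x2 where R: "R \<subseteq> B - D" "|R| <o \<kappa>" "large (D \<union> R)" "x2 \<in> el (D \<union> R) X"
    "act (D \<union> R) B (\<lambda>y. y) X x2 = x"
    \<comment> \<open>Here the complement of \<open>D\<close> plays the role of the set that is cut
      down, and \<open>D\<close> is kept whole.\<close>
    using el_directed_union[OF B Diff_subset _ X x, of D] D(2) unfolding BBD by blast
  define U V where "U = B - D \<union> S" and "V = D \<union> R"
  have U: "large U" "U \<subseteq> B" "x1 \<in> el U X" "act U B (\<lambda>y. y) X x1 = x"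
    and V: "large V" "V \<subseteq> B" "x2 \<in> el V X" "act V B (\<lambda>y. y) X x2 = x"
    using S R D(1) unfolding U_def V_def by auto
  \<comment> \<open>Outside \<open>U \<inter> V\<close> nothing of \<open>f\<close> is left. The
    disjoint copies keep \<open>h f\<close> injective whatever \<open>f\<close> does.\<close>
  define h where "h f b = (if b \<in> U \<inter> V then i 0 (f b) else if b \<in> D then i 1 b else i 2 b)"
    for f :: "'v \<Rightarrow> 'v" and b
  have step: "act B B (i 0) X (act B B f X x) = act B B (h f) X x" if f: "self_injection B f" for f
  proof -
    have fB: "f b \<in> B" if "b \<in> B" for b using f that by auto
    have f_eq: "f b = f c \<longleftrightarrow> b = c" if "b \<in> B" "c \<in> B" for b c using f that by (auto dest: inj_onD)
    \<comment> \<open>The intermediate map: it agrees on \<open>U\<close> with \<open>f\<close>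
      followed by \<open>i 0\<close>, and on \<open>V\<close> with \<open>h f\<close>, because the
      elements of \<open>V\<close> outside \<open>U\<close> lie in \<open>D\<close>.\<close>
    define f1 where "f1 b = (if b \<in> U then i 0 (f b) else i 1 b)" for b
    have hf: "self_injection B (h f)" and f1: "self_injection B f1"
      using i fB f_eq by (auto simp: h_def f1_def inj_on_def)
    have if0: "self_injection B (\<lambda>b. i 0 (f b))" using i fB f_eq by (auto simp: inj_on_def)
    have "act B B (i 0) X (act B B f X x) = act B B (\<lambda>b. i 0 (f b)) X x"
      using act_act[OF B B B conjunct1[OF f] conjunct2[OF f] conjunct1[OF inj] conjunct2[OF inj] X x] .
    also have "\<dots> = act B B f1 X x"
      using act_eq_on[OF B U(1,2) X U(3) if0 f1] U(4) by (simp add: f1_def)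
    also have "\<dots> = act B B (h f) X x"
    proof -
      have "f1 b = h f b" if "b \<in> V" for b
        using that R(1) D(1) by (auto simp: f1_def h_def U_def V_def)
      then show ?thesis using act_eq_on[OF B V(1,2) X V(3) f1 hf] V(4) by simp
    qed
    finally show ?thesis .
  qed
  \<comment> \<open>As \<open>S\<close> lies in \<open>D\<close> and \<open>R\<close> in its
    complement, the intersection is contained in \<open>S \<union> R\<close>.\<close>
  have "|U \<inter> V| <o \<kappa>"
    using R(1) by (intro ksmall_subset[OF _ ksmall_Un[OF S(2) R(2)]]) (auto simp: U_def V_def)
  moreover have "supports B (U \<inter> V) X x"
    unfolding supports_def
  proof (intro conjI allI impI; (elim conjE)?)
    show "U \<inter> V \<subseteq> B" using U by blast
    fix f g assume fg: "inj_on f B" "f ` B \<subseteq> B" "inj_on g B" "g ` B \<subseteq> B" "\<forall>b \<in> U \<inter> V. f b = g b"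
    have "h f = h g" using fg(5) by (auto simp: h_def fun_eq_iff)
    then have "act B B (i 0) X (act B B f X x) = act B B (i 0) X (act B B g X x)"
      using step[of f] step[of g] fg by simp
    \<comment> \<open>The auxiliary \<open>i 0\<close>, which made the room, is cancelled by
      injectivity of the action.\<close>
    then show "act B B f X x = act B B g X x"
      using act_inj[OF B inj X act_in[OF B B _ _ X x] act_in[OF B B _ _ X x]] fg by blast
  qed
  ultimately show thesis using that by blast
qed

section \<open>Behaviour of supports under the two actions\<close>

text \<open>Maps agreeing on the image of \<open>S\<close> agree on \<open>S\<close> after
  composition with \<open>f\<close>.\<close>

lemma supports_act:
  assumes B: "large B" and x: "X \<in> Obj T" "x \<in> el B X" "supports B S X x" and f: "self_injection B f"
  shows "supports B (f ` S) X (act B B f X x)"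
  unfolding supports_def
proof (intro conjI allI impI; (elim conjE)?)
  show "f ` S \<subseteq> B" using x(3) f unfolding supports_def by blast
  fix g h assume gh: "inj_on g B" "g ` B \<subseteq> B" "inj_on h B" "h ` B \<subseteq> B" "\<forall>b \<in> f ` S. g b = h b"
  have "self_injection B (\<lambda>b. k (f b))" if "self_injection B k" for k
    using f that comp_inj_on[of f B k] inj_on_subset[of k B "f ` B"] by (auto simp: comp_def)
  then have "act B B (\<lambda>b. g (f b)) X x = act B B (\<lambda>b. h (f b)) X x"
    using x(3) gh unfolding supports_def by (metis imageI)
  then show "act B B g X (act B B f X x) = act B B h X (act B B f X x)"
    using act_act[OF B B B _ _ _ _ x(1,2)] f gh by simp
qed

lemma supports_tr:
  assumes B: "large B" and u: "u \<in> hom T X X'" and x: "x \<in> el B X" "supports B S X x"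
  shows "supports B S X' (tr B u x)"
  using x(2) tr_act[OF B B _ _ u x(1)] unfolding supports_def by metis

lemma act_fixed:
  assumes B: "large B" and x: "X \<in> Obj T" "x \<in> el B X" "supports B S X x"
    and f: "self_injection B f" "\<And>b. b \<in> S \<Longrightarrow> f b = b"
  shows "act B B f X x = x"
proof -
  have "act B B f X x = act B B (\<lambda>b. b) X x"
    using x(3) f unfolding supports_def by (metis image_ident inj_on_id2 subset_refl)
  then show ?thesis using act_ident[OF B x(1,2)] by simp
qed

end

section \<open>The point of a set of cardinality \<open>\<kappa>\<close>\<close>

text \<open>\<open>A\<close> is too small to be an object, so \<open>el A X\<close> is replaced by
  the elements over \<open>B\<close> supported in \<open>A\<close>. Having \<kappa> elements,
  \<open>A\<close> still contains a disjoint copy of any set of fewer than \<kappa> elements beside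
  another such subset.\<close>

locale supported_part = mono_representation +
  fixes B A :: "'a set"
  assumes large_B: "large B" and A_subset: "A \<subseteq> B" and card_A: "|A| =o \<kappa>"
begin

definition supported :: "'a presheaf \<Rightarrow> 'a set" where
  "supported X = {x \<in> el B X. \<exists>S \<subseteq> A. |S| <o \<kappa> \<and> supports B S X x}"

lemma card_A_less: "|A| <o |B|"
  using card_A kappa_less_large[OF large_B] ordIso_ordLess_trans by blast

text \<open>Fewer than \<kappa> elements are removed from \<open>A\<close>, so \<open>S\<close>
  still fits into the rest; all other elements of \<open>B\<close> are sent outside
  \<open>A\<close>, which is possible because \<open>A\<close> is smaller than
  \<open>B\<close>.\<close>

lemma move_into_A:
  assumes S0: "S0 \<subseteq> A" "|S0| <o \<kappa>" and S: "S \<subseteq> B" "|S| <o \<kappa>"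
  obtains f where "self_injection B f" "\<And>b. b \<in> S0 \<Longrightarrow> f b = b" "f ` S \<subseteq> A"
proof -
  have kA: "\<kappa> \<le>o |A|" using card_A ordIso_symmetric ordIso_iff_ordLeq by blast
  have infA: "infinite A" using ksmall_finite[of A] card_A not_ordLess_ordIso by blast
  have "|S0| <o |A|" using S0(2) kA ordLess_ordLeq_trans by blast
  then have "|A| \<le>o |A - S0|" by (rule card_Diff_ge[OF infA])
  moreover have "|S - S0| \<le>o |A|"
    using ksmall_subset[of "S - S0" S] S(2) kA ordLess_ordLeq_trans ordLess_imp_ordLeq by blast
  ultimately have "|S - S0| \<le>o |A - S0|" using ordLeq_transitive by blast
  then obtain j where j: "inj_on j (S - S0)" "j ` (S - S0) \<subseteq> A - S0"
    unfolding card_of_ordLeq[symmetric] by blast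
  have "|B| \<le>o |B - A|" by (rule card_Diff_ge[OF infinite_large[OF large_B] card_A_less])
  then obtain m where m: "inj_on m B" "m ` B \<subseteq> B - A" unfolding card_of_ordLeq[symmetric] by blast
  define f where "f b = (if b \<in> S0 then b else if b \<in> S then j b else m b)" for b
  have f_A: "f b \<in> A - S0" if "b \<in> S - S0" for b using j(2) that by (auto simp: f_def)
  have f_m: "f b \<in> B - A" if "b \<in> B - S - S0" for b using m(2) that by (auto simp: f_def)
  have "inj_on f B"
  proof (rule inj_onI)
    fix a b assume ab: "a \<in> B" "b \<in> B" "f a = f b"
    consider "a \<in> S0" | "a \<in> S - S0" | "a \<in> B - S - S0" using ab(1) by blast
    then show "a = b"
    proof cases
      case 1 then show ?thesis using ab f_A[of b] f_m[of b] S0(1) by (auto simp: f_def)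
    next
      case 2 then show ?thesis using ab f_A[of a] f_m[of b] inj_onD[OF j(1), of a b]
        by (cases "b \<in> S0"; cases "b \<in> S") (auto simp: f_def)
    next
      case 3 then show ?thesis using ab f_m[of a] f_A[of b] inj_onD[OF m(1), of a b] S0(1)
        by (cases "b \<in> S0"; cases "b \<in> S") (auto simp: f_def)
    qed
  qed
  moreover have "f ` B \<subseteq> B"
    using f_A f_m S0(1) A_subset by (auto simp: f_def split: if_splits)
  moreover have "f ` S \<subseteq> A" using f_A S0(1) by (auto simp: f_def)
  ultimately show thesis using that[of f] by (simp add: f_def)
qed

lemma category_T: "category T"
  using set_valued.category[OF point_set_valued[OF large_B]] .

section \<open>The supported elements form a point\<close>

lemma tr_supported: "u \<in> hom T X X' \<Longrightarrow> x \<in> supported X \<Longrightarrow> tr B u x \<in> supported X'"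
  using tr_in[OF large_B] supports_tr[OF large_B] by (auto simp: supported_def)

lemma set_valued_supported: "set_valued T (set_functor T supported (tr B))"
proof (rule set_valued_set_functor[OF category_T])
  note P = point_set_valued[OF large_B]
  show "small (supported X)" if "X \<in> Obj T" for X
    using set_valued.small[OF P that] small_subset[of "supported X" "el B X"]
    by (auto simp: supported_def el_def)
  show "tr B (Idt T X) x = x" if "X \<in> Obj T" "x \<in> supported X" for X x
    using set_valued.map_Idt[OF P] that by (auto simp: supported_def el_def tr_def)
  show "tr B (Cmp T v u) x = tr B v (tr B u x)"
    if "u \<in> hom T X Y" "v \<in> hom T Y Z" "x \<in> supported X" for u v X Y Z x
    using set_valued.map_Cmp[OF P] that by (auto simp: supported_def el_def tr_def)
qed (rule tr_supported)

text \<open>The limit element over \<open>B\<close> is supported by the union of the supports of its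
  components: maps agreeing there act equally on every projection, hence on the element. Regularity
  keeps the union below \<kappa>.\<close>

lemma supported_limit:
  fixes J :: "('b, 'b) cat"
  assumes J: "category J" "|Arr J| <o \<kappa>" and F: "is_functor J T F" and L: "is_limit J T F Z p"
    and x: "\<forall>j \<in> Obj J. x j \<in> supported (Fobj F j)"
    and compat: "\<forall>u \<in> Arr J. tr B (Farr F u) (x (Dom J u)) = x (Cod J u)"
  shows "\<exists>!a. a \<in> supported Z \<and> (\<forall>j \<in> Obj J. tr B (p j) a = x j)"
proof -
  have Z: "Z \<in> Obj T" and p: "\<And>j. j \<in> Obj J \<Longrightarrow> p j \<in> hom T Z (Fobj F j)"
    using L by (auto simp: is_limit_def is_cone_def)
  have xB: "\<And>j. j \<in> Obj J \<Longrightarrow> x j \<in> el B (Fobj F j)" using x by (auto simp: supported_def)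
  obtain a where a: "a \<in> el B Z" "\<And>j. j \<in> Obj J \<Longrightarrow> tr B (p j) a = x j"
    using point_limit[OF large_B J F L xB] compat by blast
  have "\<forall>j. \<exists>S. j \<in> Obj J \<longrightarrow> S \<subseteq> A \<and> |S| <o \<kappa> \<and> supports B S (Fobj F j) (x j)"
    using x by (auto simp: supported_def)
  then obtain S where S: "\<And>j. j \<in> Obj J \<Longrightarrow> S j \<subseteq> A" "\<And>j. j \<in> Obj J \<Longrightarrow> |S j| <o \<kappa>"
    "\<And>j. j \<in> Obj J \<Longrightarrow> supports B (S j) (Fobj F j) (x j)" by metis
  define R where "R = (\<Union>j\<in>Obj J. S j)"
  have "supports B R Z a"
    unfolding supports_def
  proof (intro conjI allI impI; (elim conjE)?)
    show "R \<subseteq> B" using S(1) A_subset by (auto simp: R_def)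
    fix f g assume fg: "inj_on f B" "f ` B \<subseteq> B" "inj_on g B" "g ` B \<subseteq> B" "\<forall>b \<in> R. f b = g b"
    show "act B B f Z a = act B B g Z a"
    proof (rule point_limit_eq[OF large_B J F L])
      show "act B B f Z a \<in> el B Z" "act B B g Z a \<in> el B Z"
        using act_in[OF large_B large_B _ _ Z a(1)] fg by blast+
      fix j assume j: "j \<in> Obj J"
      have "act B B f (Fobj F j) (x j) = act B B g (Fobj F j) (x j)"
        using S(3)[OF j] fg j unfolding supports_def R_def by blast
      then show "tr B (p j) (act B B f Z a) = tr B (p j) (act B B g Z a)"
        using tr_act[OF large_B large_B fg(1,2) p[OF j] a(1)]
          tr_act[OF large_B large_B fg(3,4) p[OF j] a(1)] a(2)[OF j] by simp
    qed
  qed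
  moreover have "R \<subseteq> A" "|R| <o \<kappa>"
    unfolding R_def using S(1) ksmall_UN[OF ksmall_Obj[OF J] S(2)] by auto
  ultimately have "a \<in> supported Z" using a(1) by (auto simp: supported_def)
  moreover have "b = a" if "b \<in> supported Z" "\<forall>j \<in> Obj J. tr B (p j) b = x j" for b
    using point_limit_eq[OF large_B J F L _ a(1)] that a(2) by (auto simp: supported_def)
  ultimately show ?thesis using a(2) by blast
qed

text \<open>A preimage over \<open>B\<close> may have its support outside \<open>A\<close>. An
  injection that moves this support into \<open>A\<close> and fixes the support of \<open>a\<close>
  turns it into a supported preimage of the same \<open>a\<close>.\<close>

lemma supported_colimit_surj:
  fixes J :: "('a, 'a) cat"
  assumes J: "category J" "|Arr J| <o |UNIV :: 'a set|" and F: "is_functor J T F"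
    and L: "is_colimit J T F Z p" and a: "a \<in> supported Z"
  shows "\<exists>j \<in> Obj J. \<exists>x \<in> supported (Fobj F j). tr B (p j) x = a"
proof -
  have Z: "Z \<in> Obj T" and p: "\<And>j. j \<in> Obj J \<Longrightarrow> p j \<in> hom T (Fobj F j) Z"
    using L by (auto simp: is_colimit_def is_cocone_def)
  obtain S0 where S0: "S0 \<subseteq> A" "|S0| <o \<kappa>" "supports B S0 Z a" and aB: "a \<in> el B Z"
    using a by (auto simp: supported_def)
  obtain j x where j: "j \<in> Obj J" and x: "x \<in> el B (Fobj F j)" "tr B (p j) x = a"
    using point_colimit_surj[OF large_B J F L aB] .
  have Fj: "Fobj F j \<in> Obj T" using is_functor_Obj[OF F j] .
  obtain S where S: "|S| <o \<kappa>" "supports B S (Fobj F j) x"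
    using support_exists[OF large_B Fj x(1)] .
  have "S \<subseteq> B" using S(2) by (simp add: supports_def)
  from move_into_A[OF S0(1,2) this S(1)]
  obtain f where f: "self_injection B f" "\<And>b. b \<in> S0 \<Longrightarrow> f b = b" "f ` S \<subseteq> A" by blast
  have "act B B f (Fobj F j) x \<in> supported (Fobj F j)"
    using act_in[OF large_B large_B _ _ Fj x(1)] f supports_act[OF large_B Fj x(1) S(2) f(1)]
      ksmall_image[OF S(1), of f] by (auto simp: supported_def)
  moreover have "tr B (p j) (act B B f (Fobj F j) x) = a"
    using tr_act[OF large_B large_B _ _ p[OF j] x(1), of f] f(1) x(2)
      act_fixed[OF large_B Z aB S0(3) f(1,2)] by simp
  ultimately show ?thesis using j by blast
qed

text \<open>
  To compare two elements over \<open>A\<close> inside the colimit over \<open>B\<close>, the predicate \<open>c\<close> on supported elements is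
  extended to all of \<open>el B\<close> by moving an element into \<open>A\<close>.
\<close>

lemma supported_colimit_eq:
  fixes J :: "('a, 'a) cat" and c :: "'a \<Rightarrow> 'a \<Rightarrow> bool"
  assumes J: "category J" "|Arr J| <o |UNIV :: 'a set|" and F: "is_functor J T F"
    and L: "is_colimit J T F Z p"
    and c: "\<forall>u \<in> Arr J. \<forall>x \<in> supported (Fobj F (Dom J u)). c (Cod J u) (tr B (Farr F u) x) = c (Dom J u) x"
    and jk: "j \<in> Obj J" "k \<in> Obj J" and xy: "x \<in> supported (Fobj F j)" "y \<in> supported (Fobj F k)"
    and eq: "tr B (p j) x = tr B (p k) y"
  shows "c j x = c k y"
proof -
  interpret J: category J by fact
  note FO = is_functor_Obj[OF F]
  obtain S1 where S1: "S1 \<subseteq> A" "|S1| <o \<kappa>" "supports B S1 (Fobj F j) x" and xB: "x \<in> el B (Fobj F j)"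
    using xy(1) by (auto simp: supported_def)
  obtain S2 where S2: "S2 \<subseteq> A" "|S2| <o \<kappa>" "supports B S2 (Fobj F k) y" and yB: "y \<in> el B (Fobj F k)"
    using xy(2) by (auto simp: supported_def)
  \<comment> \<open>The movements considered fix the supports of \<open>x\<close> and
    \<open>y\<close>, so that the extended predicate agrees with \<open>c\<close> at these
    two.\<close>
  define S0 where "S0 = S1 \<union> S2"
  have S0: "S0 \<subseteq> A" "|S0| <o \<kappa>" using S1 S2 ksmall_Un by (auto simp: S0_def)
  define moves where "moves S f \<longleftrightarrow> self_injection B f \<and> (\<forall>b \<in> S0. f b = b) \<and> f ` S \<subseteq> A" for S f
  \<comment> \<open>The value of \<open>c\<close> after moving \<open>z\<close> into
    \<open>A\<close> could depend on the movement, so \<open>d\<close> asks for it for all movements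
    taking some sufficiently large set \<open>S\<close> into \<open>A\<close>. Allowing
    \<open>S\<close> to grow is what makes \<open>d\<close> invariant along the diagram.\<close>
  define d where "d i z \<longleftrightarrow> (\<exists>S \<subseteq> B. |S| <o \<kappa> \<and> (\<forall>f. moves S f \<longrightarrow> c i (act B B f (Fobj F i) z)))" for i z
  have d_supported: "d i z \<longleftrightarrow> c i z"
    if i: "i \<in> Obj J" and z: "z \<in> el B (Fobj F i)" and S: "S \<subseteq> S0" "supports B S (Fobj F i) z" for i z S
  proof -
    have fixed: "act B B f (Fobj F i) z = z" if "moves R f" for R f
    proof (rule act_fixed[OF large_B FO[OF i] z S(2)])
      show "self_injection B f" using that by (simp add: moves_def)
      show "f b = b" if "b \<in> S" for b using \<open>moves R f\<close> that S(1) by (auto simp: moves_def)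
    qed
    \<comment> \<open>Without such a movement the universal condition in \<open>d\<close> would hold
      vacuously and say nothing about \<open>c\<close>.\<close>
    have "\<exists>f. moves R f" if "R \<subseteq> B" "|R| <o \<kappa>" for R
      using move_into_A[OF S0 that] unfolding moves_def by metis
    then show ?thesis
      unfolding d_def using fixed ksmall_finite[of "{}"] by (metis empty_subsetI finite.emptyI)
  qed
  have "d j x = d k y"
  proof (rule point_colimit_eq[OF large_B J F L _ jk xB yB eq])
    fix u z assume u: "u \<in> Arr J" and z: "z \<in> el B (Fobj F (Dom J u))"
    note D = FO[OF J.Dom_in[OF u]] and h = is_functor_hom[OF F homI[OF u refl refl]]
    obtain R where R: "|R| <o \<kappa>" "supports B R (Fobj F (Dom J u)) z"
      using support_exists[OF large_B D z] .
    have RB: "R \<subseteq> B" using R(2) by (simp add: supports_def)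
    \<comment> \<open>Once the movement takes the support \<open>R\<close> of \<open>z\<close> into
      \<open>A\<close>, the moved element is supported, and the invariance of \<open>c\<close>
      applies to it.\<close>
    have key: "c (Cod J u) (act B B f (Fobj F (Cod J u)) (tr B (Farr F u) z)) =
        c (Dom J u) (act B B f (Fobj F (Dom J u)) z)" if f: "moves (S \<union> R) f" for S f
    proof -
      have f': "self_injection B f" "f ` R \<subseteq> A" using f by (auto simp: moves_def)
      have sup: "act B B f (Fobj F (Dom J u)) z \<in> supported (Fobj F (Dom J u))"
        using act_in[OF large_B large_B _ _ D z] f' supports_act[OF large_B D z R(2) f'(1)]
          ksmall_image[OF R(1), of f] by (auto simp: supported_def)
      show ?thesis
        using c[rule_format, OF u sup] tr_act[OF large_B large_B _ _ h z, of f] f'(1) by simp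
    qed
    have moves_Un: "moves S f" if "moves (S \<union> R) f" for S f using that by (auto simp: moves_def)
    have Un: "S \<union> R \<subseteq> B \<and> |S \<union> R| <o \<kappa>" if "S \<subseteq> B" "|S| <o \<kappa>" for S
      using that RB ksmall_Un[OF _ R(1)] by blast
    show "d (Cod J u) (tr B (Farr F u) z) = d (Dom J u) z"
    proof
      assume "d (Cod J u) (tr B (Farr F u) z)"
      then obtain S where S: "S \<subseteq> B" "|S| <o \<kappa>"
        "\<And>f. moves S f \<Longrightarrow> c (Cod J u) (act B B f (Fobj F (Cod J u)) (tr B (Farr F u) z))"
        unfolding d_def by blast
      then show "d (Dom J u) z"
        unfolding d_def using Un[OF S(1,2)] key[of S] moves_Un[of S] by (intro exI[of _ "S \<union> R"]) auto
    next
      assume "d (Dom J u) z"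
      then obtain S where S: "S \<subseteq> B" "|S| <o \<kappa>"
        "\<And>f. moves S f \<Longrightarrow> c (Dom J u) (act B B f (Fobj F (Dom J u)) z)"
        unfolding d_def by blast
      then show "d (Cod J u) (tr B (Farr F u) z)"
        unfolding d_def using Un[OF S(1,2)] key[of S] moves_Un[of S] by (intro exI[of _ "S \<union> R"]) auto
    qed
  qed
  then show ?thesis
    using d_supported[OF jk(1) xB _ S1(3)] d_supported[OF jk(2) yB _ S2(3)] by (simp add: S0_def)
qed

lemma supported_point: "is_kappa_point \<kappa> T (set_functor T supported (tr B))"
  by (rule is_kappa_point_set_functorI[OF infinite_UNIV set_valued_supported])
    (fact supported_limit supported_colimit_surj supported_colimit_eq)+

text \<open>
  A set representing this point embeds into \<open>B\<close>, and its image is fixed by every permutation of \<open>B\<close>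
  which fixes \<open>A\<close>.
\<close>

lemma inconsistent: False
proof -
  interpret T: category T by (rule category_T)
  obtain E s t where E: "large E" and s: "natural_family T (Fobj \<Phi> E) (set_functor T supported (tr B)) s"
    and "natural_family T (set_functor T supported (tr B)) (Fobj \<Phi> E) t"
    and "\<forall>X \<in> Obj T. \<forall>x \<in> Fobj (set_functor T supported (tr B)) X. s X (t X x) = x"
    using act_essentially_surjective[OF supported_point] .
  have incl: "natural_family T (set_functor T supported (tr B)) (Fobj \<Phi> B) (\<lambda>X x. x)"
    unfolding natural_family_def
  proof (intro conjI ballI allI impI)
    show "x \<in> Fobj (Fobj \<Phi> B) X" if "X \<in> Obj T" "x \<in> Fobj (set_functor T supported (tr B)) X" for X x
      using that by (simp add: supported_def el_def)
    show "Smap (Farr (Fobj \<Phi> B) u) x = Smap (Farr (set_functor T supported (tr B)) u) x"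
      if "u \<in> hom T X X'" "x \<in> Fobj (set_functor T supported (tr B)) X" for u X X' x
      using that T.hom_Obj[OF that(1)] by (simp add: tr_def)
  qed
  \<comment> \<open>Fullness realises the map \<open>s\<close>, followed by the inclusion into the
    point of \<open>B\<close>, by an injection.\<close>
  obtain e where e: "inj_on e E" "e ` E \<subseteq> B"
    and "\<forall>X \<in> Obj T. \<forall>x \<in> el E X. s X x = act E B e X x"
    using act_full[OF E large_B natural_family_comp[OF category_T s incl]] .
  then have e_act: "\<And>X x. X \<in> Obj T \<Longrightarrow> x \<in> el E X \<Longrightarrow> s X x = act E B e X x" by blast
  have "e ` E \<subseteq> A"
  proof (rule ccontr)
    assume "\<not> e ` E \<subseteq> A"
    then obtain z where z: "z \<in> E" "e z \<notin> A" by blast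
    have "|B| \<le>o |B - A|" by (rule card_Diff_ge[OF infinite_large[OF large_B] card_A_less])
    then have "infinite (B - A)" using infinite_large[OF large_B] card_of_ordLeq_finite by blast
    then obtain w where w: "w \<in> B - A" "w \<noteq> e z"
      by (metis finite.emptyI finite_insert finite_subset insertI1 subsetI)
    \<comment> \<open>The transposition of two elements outside \<open>A\<close>: it fixes
      \<open>A\<close> pointwise, hence every supported element, yet it moves
      \<open>e z\<close>.\<close>
    define \<sigma> where "\<sigma> = id(e z := w, w := e z)"
    have \<sigma>: "self_injection B \<sigma>" "\<And>b. b \<in> A \<Longrightarrow> \<sigma> b = b"
      using w z e(2) by (auto simp: \<sigma>_def inj_on_def)
    \<comment> \<open>All values of \<open>s\<close> are supported in \<open>A\<close>, so composing
      \<open>e\<close> with the transposition does not change its action; faithfulness then gives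
      equality as functions.\<close>
    have "\<sigma> (e z) = e z"
    proof (rule act_faithful[OF E large_B _ _ e _ z(1), where f = "\<lambda>v. \<sigma> (e v)"])
      show "inj_on (\<lambda>v. \<sigma> (e v)) E" "(\<lambda>v. \<sigma> (e v)) ` E \<subseteq> B"
        using comp_inj_on[OF e(1) inj_on_subset[OF conjunct1[OF \<sigma>(1)] e(2)]] e(2) \<sigma>(1) by (auto simp: comp_def)
      fix X x assume X: "X \<in> Obj T" and x: "x \<in> el E X"
      have "s X x \<in> supported X" using natural_familyD(1)[OF s X, of x] x X by (simp add: el_def)
      then obtain S where S: "S \<subseteq> A" "supports B S X (s X x)" and sB: "s X x \<in> el B X"
        by (auto simp: supported_def)
      have "act B B \<sigma> X (s X x) = s X x"
        using act_fixed[OF large_B X sB S(2) \<sigma>(1)] \<sigma>(2) S(1) by blast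
      then show "act E B (\<lambda>v. \<sigma> (e v)) X x = act E B e X x"
        using act_act[OF E large_B large_B e _ _ X x, of \<sigma>] \<sigma>(1) e_act[OF X x] by simp
    qed
    then show False using w by (simp add: \<sigma>_def)
  qed
  then have "|E| \<le>o |A|" using e(1) card_of_ordLeq by blast
  then have "|E| \<le>o \<kappa>" using card_A ordLeq_ordIso_trans by blast
  then show False using kappa_less_large[OF E] not_ordLess_ordLeq by blast
qed

end

theorem theorem3p3:
  fixes \<kappa> :: "'k rel" and lam :: "'l rel"
  assumes "inaccessible |UNIV :: 'v set|"
    and "Cinfinite \<kappa>" and "regularCard \<kappa>"
    and "Card_order lam" and "\<kappa> <o lam"
    and "lam <o |UNIV :: 'v set|"
  shows "\<not> (\<exists>T :: ('v presheaf, 'v presheaf_map) cat.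
    kappa_topos \<kappa> T \<and>
    equivalent (set_mono_ge lam :: ('v set, 'v setmap) cat) (kappa_points \<kappa> T))"
proof
  assume "\<exists>T :: ('v presheaf, 'v presheaf_map) cat. kappa_topos \<kappa> T \<and>
    equivalent (set_mono_ge lam :: ('v set, 'v setmap) cat) (kappa_points \<kappa> T)"
  then obtain T :: "('v presheaf, 'v presheaf_map) cat"
    where "equivalent (set_mono_ge lam :: ('v set, 'v setmap) cat) (kappa_points \<kappa> T)" by blast
  then obtain \<Phi> where "mono_representation T \<kappa> lam \<Phi>"
  proof (rule equivalentE)
    fix \<Phi>
    assume \<Phi>: "is_functor (set_mono_ge lam :: ('v set, 'v setmap) cat) (kappa_points \<kappa> T) \<Phi>"
      "\<And>A B f g. f \<in> hom (set_mono_ge lam) A B \<Longrightarrow> g \<in> hom (set_mono_ge lam) A B \<Longrightarrow>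
        Farr \<Phi> f = Farr \<Phi> g \<Longrightarrow> f = g"
      "\<And>A B t. A \<in> Obj (set_mono_ge lam) \<Longrightarrow> B \<in> Obj (set_mono_ge lam) \<Longrightarrow>
        t \<in> hom (kappa_points \<kappa> T) (Fobj \<Phi> A) (Fobj \<Phi> B) \<Longrightarrow>
        \<exists>f \<in> hom (set_mono_ge lam) A B. Farr \<Phi> f = t"
      "\<And>P. P \<in> Obj (kappa_points \<kappa> T) \<Longrightarrow> \<exists>A \<in> Obj (set_mono_ge lam).
        \<exists>s \<in> hom (kappa_points \<kappa> T) (Fobj \<Phi> A) P. \<exists>t \<in> hom (kappa_points \<kappa> T) P (Fobj \<Phi> A).
        Cmp (kappa_points \<kappa> T) s t = Idt (kappa_points \<kappa> T) P \<and>
        Cmp (kappa_points \<kappa> T) t s = Idt (kappa_points \<kappa> T) (Fobj \<Phi> A)"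
    have "mono_representation T \<kappa> lam \<Phi>"
    proof
      fix P assume "P \<in> Obj (kappa_points \<kappa> T)"
      from \<Phi>(4)[OF this] show "\<exists>A \<in> Obj (set_mono_ge lam).
        \<exists>s \<in> hom (kappa_points \<kappa> T) (Fobj \<Phi> A) P. \<exists>t \<in> hom (kappa_points \<kappa> T) P (Fobj \<Phi> A).
        Cmp (kappa_points \<kappa> T) s t = Idt (kappa_points \<kappa> T) P" by blast
    qed (fact assms \<Phi>(1-3))+
    then show thesis using that by blast
  qed
  then interpret mono_representation T \<kappa> lam \<Phi> .
  \<comment> \<open>The cardinals live on types of their own, so copies inside the universe are
    needed: \<open>B\<close> of cardinality exactly \<open>lam\<close>, and then \<open>A\<close> of
    cardinality \<kappa> inside \<open>B\<close>.\<close>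
  have "|Field lam| =o lam" using assms(4) by (rule card_of_Field_ordIso)
  moreover have "|Field lam| \<le>o |UNIV :: 'v set|"
    using calculation assms(6) ordIso_ordLess_trans ordLess_imp_ordLeq by blast
  ultimately obtain B :: "'v set" where B: "|B| =o lam"
    using internalize_card_of_ordLeq2[of "Field lam" "UNIV :: 'v set"] ordIso_symmetric ordIso_transitive
    by blast
  then have large_B: "large B"
    using assms(6) ordIso_ordLess_trans[OF B] ordIso_symmetric[OF B] ordIso_iff_ordLeq
    unfolding large_def small_def by blast
  have "|Field \<kappa>| =o \<kappa>" using infinite_kappa(2) by (rule card_of_Field_ordIso)
  moreover have "|Field \<kappa>| \<le>o |B|"
    using calculation kappa_less_large[OF large_B] ordIso_ordLess_trans ordLess_imp_ordLeq by blast
  ultimately obtain A where "A \<subseteq> B" "|A| =o \<kappa>"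
    using internalize_card_of_ordLeq2[of "Field \<kappa>" B] ordIso_symmetric ordIso_transitive by blast
  then interpret supported_part T \<kappa> lam \<Phi> B A by unfold_locales (rule large_B)
  show False by (rule inconsistent)
qed

end
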